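(* Let $n$ be a positive integer with $n\equiv 3\pmod 4$, and let $a,b$ be indeterminates. Then, modulo $[n](1-aq^n)(a-q^n)(1-bq^n)(b-q^n)$, \[ \sum_{k=0}^{n-1}[6k+1]\frac{(aq,q/a;q^2)_k(q^2,b^3q,q/b^3;q^4)_k}{(q^4,q^4/a,aq^4;q^4)_k(q^2/b^3,b^3q^2;q^2)_k}q^{2k} \equiv\frac{(1-aq^n)(a-q^n)(-1-b^2+bq^n)}{(b-a)(1-ba)}\frac{(q^5,aq^2,q^2/a;q^4)_{(3n-1)/4}}{(q,q^4/a,aq^4;q^4)_{(3n-1)/4}} +\frac{(1-bq^n)(b-q^n)(-1-a^2+aq^n)}{(a-b)(1-ab)}\frac{(q^3,b^3,1/b^3;q^4)_{(n+1)/4}}{(1/q,q^2/b^3,b^3q^2;q^4)_{(n+1)/4}}. \]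
   Context: For $x$ and integer $n\ge 0$, $(x;q)_n=\prod_{j=0}^{n-1}(1-xq^j)$, and $(x_1,\dots,x_m;q)_n=(x_1;q)_n\cdots(x_m;q)_n$. $[r]=(1-q^r)/(1-q)$ is the $q$-integer. A congruence modulo a polynomial $P$ in $q,a,b$ between rational functions whose denominators are coprime to $P$ means that the difference is a rational function whose numerator is divisible by $P$ and whose denominator is coprime to $P$. *)

theory Defs
  imports "HOL-Computational_Algebra.Computational_Algebra"
begin

definition qpoch :: "'a::field \<Rightarrow> 'a \<Rightarrow> nat \<Rightarrow> 'a" where
  "qpoch x q n = (\<Prod>j<n. 1 - x * q ^ j)"

definition qpochs :: "'a::field list \<Rightarrow> 'a \<Rightarrow> nat \<Rightarrow> 'a" where
  "qpochs xs q n = (\<Prod>x\<leftarrow>xs. qpoch x q n)"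

definition qint :: "'a::field \<Rightarrow> nat \<Rightarrow> 'a" where
  "qint q r = (1 - q ^ r) / (1 - q)"

(* Q(q,a,b) is the fraction field of the iterated polynomial ring Q[q][a][b]:
   the innermost variable is q, the middle one is a, the outermost one is b. *)
type_synonym pol_qab = "rat poly poly poly"
type_synonym ratfun_qab = "pol_qab fract"

definition indet_q :: ratfun_qab where "indet_q = Fract [:[:[:0, 1:]:]:] 1"
definition indet_a :: ratfun_qab where "indet_a = Fract [:[:0, 1:]:] 1"
definition indet_b :: ratfun_qab where "indet_b = Fract [:0, 1:] 1"

(* Some representation of X has a denominator coprime to P; over a factorial ring this
   says that the denominator of X in lowest terms is coprime to P. *)
definition den_coprime :: "'r::{idom_divide, algebraic_semidom} fract \<Rightarrow> 'r \<Rightarrow> bool" where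
  "den_coprime X P \<longleftrightarrow> (\<exists>N D. D \<noteq> 0 \<and> X = Fract N D \<and> coprime D P)"

(* The modulus M is given as an element of the fraction field, so that it may be written
   with the q-integer (1 - q^n) / (1 - q); the congruence requires it to be a polynomial P. *)
definition ratfun_cong ::
    "'r::{idom_divide, algebraic_semidom} fract \<Rightarrow> 'r fract \<Rightarrow> 'r fract \<Rightarrow> bool" where
  "ratfun_cong X Y M \<longleftrightarrow>
     (\<exists>P. M = Fract P 1 \<and> den_coprime X P \<and> den_coprime Y P \<and>
       (\<exists>N D. D \<noteq> 0 \<and> X - Y = Fract N D \<and> P dvd N \<and> coprime D P))"

end

theory Submission
  imports Defs "HOL-Computational_Algebra.Field_as_Ring"
begin

text \<open>
  A fraction of \<open>\<rat>[q,a,b]\<close> is divisible by the modulus as soon as it vanishes under each of the following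
  substitutions: \<open>q\<close> becomes an \<open>n\<close>-th root of unity other than 1, \<open>a\<close> becomes \<open>q ^ n\<close> or \<open>1 / q ^ n\<close>, or \<open>b\<close>
  becomes \<open>q ^ n\<close> or \<open>1 / q ^ n\<close>.

  Put \<open>p = b ^ 3\<close>.  Creative telescoping gives first-order recurrences for the sum under \<open>p \<mapsto> p * q ^ 4\<close>
  and under \<open>a \<mapsto> a * q ^ 4\<close>.  Starting from a trivial sum, they evaluate it in closed form when \<open>p\<close> or
  \<open>a\<close> is a power of \<open>q\<close> that makes the sum terminate; this settles the substitutions for \<open>a\<close> and \<open>b\<close>.
  At a root of unity of order \<open>d\<close> the first recurrence shows that the sum over a block of length \<open>d\<close>,
  cleared of denominators, is a polynomial in \<open>p\<close> with more zeros than its degree, and the whole sum is a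
  combination of such blocks.
\<close>

subsection \<open>Two recurrences for the sum\<close>

text \<open>The two summands on the right form a Chinese remainder interpolation: at
  \<open>a = q ^ n\<close> or \<open>a = 1 / q ^ n\<close> the first one vanishes and the weight of
  the second equals 1, and for \<open>b\<close> the roles are exchanged. The closed forms next to
  the weights are thus the values of the sum at these points. The cube is what makes the sum
  terminate for \<open>b\<close>: \<open>(p * q; q^4)_k\<close> acquires a zero factor at
  \<open>p = 1 / q ^ (3 * n)\<close> because 4 divides \<open>3 * n - 1\<close>, whereas it does not
  divide \<open>n - 1\<close>. Moreover \<open>(3 * n - 1) / 4 < n\<close>, so cutting the sum at
  \<open>n\<close> loses nothing. The congruence also demands denominators coprime to the modulus.
  The obstacle lies at roots of unity whose order \<open>d\<close> is a proper divisor of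
  \<open>n\<close>: there \<open>(q^4; q^4)_k\<close> vanishes for \<open>k \<ge> d\<close>, within
  the range of summation. Hence specialisation is a relation that asks for a representation with
  non-vanishing denominator, and the factors free of \<open>a\<close> and \<open>b\<close> are
  rewritten before they are specialised.\<close>

text \<open>The next two identities say that the telescoping certificates \<open>G\<close> of \<open>hterm_telescope_p\<close> and
  \<open>hterm_telescope_a\<close> below are correct; \<open>K\<close> stands for \<open>q ^ (2 * k)\<close> and \<open>c\<close> for an inverse.  The
  certificates were found by solving for a rational multiple of the summand.\<close>

lemma telescoping_identity_p:
  fixes q a p K :: "'a::field"
  assumes "a * c = 1"
  shows "K * (1 - q * K ^ 3) *
      ((1 - p * q * K ^ 2) * (p * q ^ 3 - 1) * (p - K) * (p * q ^ 2 - K) *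
         ((1 - p * q ^ 3 * c) * (1 - a * p * q ^ 3)) -
       (1 - p * q) * (p * q ^ 3 - K ^ 2) * (1 - p * q ^ 2 * K) * (1 - p * q ^ 4 * K) *
         ((1 - p * q * c) * (1 - a * p * q))) =
    - p * (1 - p ^ 2 * q ^ 4) *
      ((1 - a * q * K) * (1 - q * K * c) * (1 - q ^ 2 * K ^ 2) * (1 - p * q * K ^ 2) * (1 - q * K) *
         (p * q ^ 3 - K ^ 2) -
       q ^ 2 * (1 - K ^ 2) * ((1 - K ^ 2 * c) * (1 - a * K ^ 2)) * (p - K) * (q - K) *
         (1 - p * q ^ 4 * K))"
  using assms by algebra

lemma telescoping_identity_a:
  fixes q a p K :: "'a::field"
  assumes "p * c = 1"
  shows "K * (1 - q * K ^ 3) *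
      (- (1 - a * q * K) * (1 - a * q ^ 3 * K) * (a - K ^ 2) *
         ((1 - a * q ^ 3 * c) * (1 - a * p * q ^ 3)) -
       (a * q ^ 3 - K) * (a * q - K) * (1 - a * q ^ 4 * K ^ 2) *
         ((1 - a * q * c) * (1 - a * p * q))) =
    a * (1 + a * q ^ 2) *
      ((1 - a * q * K) * (1 - q ^ 2 * K ^ 2) * ((1 - p * q * K ^ 2) * (1 - q * K ^ 2 * c)) * (1 - q * K) *
         (a * q ^ 3 - K) -
       q ^ 2 * (1 - K ^ 2) * (a - K ^ 2) * ((1 - p * K) * (1 - K * c)) * (q - K) *
         (1 - a * q ^ 4 * K ^ 2))"
  using assms by algebra

section \<open>Shifts of q-shifted factorials\<close>

lemma qpoch_0 [simp]: "qpoch x q 0 = 1"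
  by (simp add: qpoch_def)

lemma qpoch_Suc: "qpoch x q (Suc n) = qpoch x q n * (1 - x * q ^ n)"
  by (simp add: qpoch_def)

lemma qpoch_Suc_left: "qpoch x q (Suc n) = (1 - x) * qpoch (x * q) q n"
  unfolding qpoch_def prod.lessThan_Suc_shift by (simp add: mult_ac)

lemma qpoch_shift: "(1 - x) * qpoch (x * q) q n = qpoch x q n * (1 - x * q ^ n)"
  by (metis qpoch_Suc qpoch_Suc_left)

lemma qpoch_shift2:
  "(1 - x) * (1 - x * q) * qpoch (x * q ^ 2) q n = qpoch x q n * ((1 - x * q ^ n) * (1 - x * q ^ Suc n))"
proof -
  have "qpoch x q (Suc (Suc n)) = (1 - x) * (1 - x * q) * qpoch (x * q ^ 2) q n"
    by (simp add: qpoch_Suc_left power2_eq_square mult_ac)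
  thus ?thesis by (simp add: qpoch_Suc mult.assoc)
qed

lemma qpoch_nonzero: "(\<And>j. j < n \<Longrightarrow> x * q ^ j \<noteq> 1) \<Longrightarrow> qpoch x q n \<noteq> 0"
  by (auto simp: qpoch_def prod_zero_iff)

lemma qpoch_eq_0: "j < n \<Longrightarrow> x * q ^ j = 1 \<Longrightarrow> qpoch x q n = 0"
  by (auto simp: qpoch_def prod_zero_iff)

section \<open>The summand, the sum and their poles\<close>

definition hterm :: "'a::field \<Rightarrow> 'a \<Rightarrow> 'a \<Rightarrow> nat \<Rightarrow> 'a" where
  "hterm q a p k =
     (qpoch (a * q) (q ^ 2) k * qpoch (q / a) (q ^ 2) k * qpoch (q ^ 2) (q ^ 4) k *
      qpoch (p * q) (q ^ 4) k * qpoch (q / p) (q ^ 4) k) /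
     (qpoch (q ^ 4) (q ^ 4) k * qpoch (q ^ 4 / a) (q ^ 4) k * qpoch (a * q ^ 4) (q ^ 4) k *
      qpoch (q ^ 2 / p) (q ^ 2) k * qpoch (p * q ^ 2) (q ^ 2) k) * q ^ (2 * k)"

text \<open>The \<open>q\<close>-integer \<open>[6k+1]\<close> enters as
  \<open>1 - q ^ (6 * k + 1)\<close>, and the division by \<open>1 - q\<close> is postponed. The
  free parameter \<open>p\<close> replaces \<open>b ^ 3\<close> because the shift to
  \<open>p * q ^ 4\<close> corresponds to no shift of \<open>b\<close> by an integral power of
  \<open>q\<close>.\<close>

definition hsum :: "'a::field \<Rightarrow> 'a \<Rightarrow> 'a \<Rightarrow> nat \<Rightarrow> 'a" where
  "hsum q a p n = (\<Sum>k<n. (1 - q ^ (6 * k + 1)) * hterm q a p k)"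

text \<open>No denominator of the terms with \<open>k \<le> n\<close> vanishes. The powers of
  \<open>q\<close> are restricted only up to \<open>n\<close>, so that \<open>q\<close> may also be
  a root of unity of odd order \<open>2 * m + 1\<close> with \<open>n = Suc m\<close>.\<close>

definition admissible :: "'a::field \<Rightarrow> 'a \<Rightarrow> 'a \<Rightarrow> nat \<Rightarrow> bool" where
  "admissible q a p n \<longleftrightarrow> q \<noteq> 0 \<and> a \<noteq> 0 \<and> p \<noteq> 0 \<and> (\<forall>j. 0 < j \<longrightarrow> j \<le> n \<longrightarrow> q ^ (4 * j) \<noteq> 1) \<and>
     (\<forall>j>0. a \<noteq> q ^ (4 * j) \<and> a * q ^ (4 * j) \<noteq> 1 \<and> p \<noteq> q ^ (2 * j) \<and> p * q ^ (2 * j) \<noteq> 1)"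

text \<open>Inversion only permutes the factors of the summand. With the same symmetry in
  \<open>p\<close>, positive powers of \<open>q\<close> reduce to the negative ones, at which the
  sums are evaluated.\<close>

lemma hterm_inverse_a: "hterm q (1 / a) p k = hterm q a p k"
  by (simp add: hterm_def mult_ac)

lemma hterm_inverse_p: "hterm q a (1 / p) k = hterm q a p k"
  by (simp add: hterm_def mult_ac)

lemma hterm_0 [simp]: "hterm q a p 0 = 1"
  by (simp add: hterm_def)

lemma admissible_nonzero:
  assumes "admissible q a p n" "k \<le> n"
  shows "qpoch (q ^ 4) (q ^ 4) k \<noteq> 0" "qpoch (q ^ 4 / a) (q ^ 4) k \<noteq> 0"
    "qpoch (a * q ^ 4) (q ^ 4) k \<noteq> 0" "qpoch (q ^ 2 / p) (q ^ 2) k \<noteq> 0"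
    "qpoch (p * q ^ 2) (q ^ 2) k \<noteq> 0"
proof -
  have e4: "q ^ 4 * (q ^ 4) ^ j = q ^ (4 * Suc j)" for j
    by (simp add: power_mult [symmetric] power_add [symmetric])
  have e2: "q ^ 2 * (q ^ 2) ^ j = q ^ (2 * Suc j)" for j
    by (simp add: power_mult [symmetric] power_add [symmetric])
  show "qpoch (q ^ 4) (q ^ 4) k \<noteq> 0"
    using assms by (intro qpoch_nonzero) (auto simp: admissible_def e4 simp del: power_Suc mult_Suc_right)
  show "qpoch (q ^ 4 / a) (q ^ 4) k \<noteq> 0"
    using assms by (intro qpoch_nonzero) (auto simp: admissible_def e4 simp del: power_Suc mult_Suc_right)
  show "qpoch (a * q ^ 4) (q ^ 4) k \<noteq> 0"
    using assms by (intro qpoch_nonzero) (auto simp: admissible_def e4 mult.assoc simp del: power_Suc mult_Suc_right)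
  show "qpoch (q ^ 2 / p) (q ^ 2) k \<noteq> 0"
    using assms by (intro qpoch_nonzero) (auto simp: admissible_def e2 simp del: power_Suc mult_Suc_right)
  show "qpoch (p * q ^ 2) (q ^ 2) k \<noteq> 0"
    using assms by (intro qpoch_nonzero) (auto simp: admissible_def e2 mult.assoc simp del: power_Suc mult_Suc_right)
qed

lemma hterm_Suc:
  assumes "admissible q a p n" "k < n" and K: "K = q ^ (2 * k)"
  shows "hterm q a p (Suc k) =
    hterm q a p k *
      ((1 - a * q * K) * (1 - q * K / a) * (1 - q ^ 2 * K ^ 2) * (1 - p * q * K ^ 2) * (1 - q * K ^ 2 / p) * q ^ 2 /
       ((1 - q ^ 4 * K ^ 2) * (1 - q ^ 4 * K ^ 2 / a) * (1 - a * q ^ 4 * K ^ 2) * (1 - q ^ 2 * K / p) * (1 - p * q ^ 2 * K)))"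
proof -
  have e: "(q ^ 4) ^ k = K ^ 2" "(q ^ 2) ^ k = K"
    by (simp_all add: K power_mult [symmetric] mult_ac)
  show ?thesis
    unfolding hterm_def qpoch_Suc e
    by (simp add: K[symmetric] power_add times_divide_times_eq power2_eq_square[of q] mult_ac)
qed

section \<open>The recurrence in \<open>p\<close>\<close>

lemma hterm_shift_p:
  assumes adm: "admissible q a p n" and "k \<le> n" and K: "K = q ^ (2 * k)"
    and p: "p \<noteq> 1" "p * q \<noteq> 1" "p * q ^ 3 \<noteq> K ^ 2"
  shows "hterm q a (p * q ^ 4) k =
    hterm q a p k * ((1 - p * q * K ^ 2) * (p * q ^ 3 - 1) * (p - K) * (p * q ^ 2 - K) * (1 - p * q ^ 4) /
      ((1 - p * q) * (1 - p) * (p * q ^ 3 - K ^ 2) * (1 - p * q ^ 2 * K) * (1 - p * q ^ 4 * K)))"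
proof -
  have nz: "q \<noteq> 0" "a \<noteq> 0" "p \<noteq> 0" and pj: "\<And>j. j > 0 \<Longrightarrow> p \<noteq> q ^ (2 * j) \<and> p * q ^ (2 * j) \<noteq> 1"
    using adm by (auto simp: admissible_def)
  note nn = admissible_nonzero[OF adm \<open>k \<le> n\<close>]
  have e: "(q ^ 4) ^ k = K ^ 2" "(q ^ 2) ^ k = K"
    by (simp_all add: K power_mult [symmetric] mult_ac)
  have K0: "K \<noteq> 0" using nz K by simp
  have c1: "p * q ^ 2 \<noteq> 1" using pj[of 1] by simp
  have c2: "p * q ^ 4 \<noteq> 1" using pj[of 2] by simp
  have c3: "p * q ^ 2 * K \<noteq> 1" using pj[of "Suc k"] by (simp add: K power_add [symmetric] mult.assoc)
  have c4: "p * q ^ 4 * K \<noteq> 1" using pj[of "k + 2"] by (simp add: K power_add eval_nat_numeral mult_ac)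
  have c5: "p \<noteq> K" using pj[of k] p by (cases k) (auto simp: K)
  have c6: "p * q ^ 2 \<noteq> K"
  proof
    assume eq: "p * q ^ 2 = K"
    show False
    proof (cases k)
      case 0 thus False using c1 eq K by simp
    next
      case (Suc j)
      hence "p * q ^ 2 = q ^ (2 * j) * q ^ 2" using eq K by (simp add: power_add [symmetric])
      hence "p = q ^ (2 * j)" using nz by simp
      thus False using pj[of j] p by (cases j) auto
    qed
  qed
  define A where "A = qpoch (p * q) (q ^ 4) k"
  define B where "B = qpoch (q / p) (q ^ 4) k"
  define C where "C = qpoch (q ^ 2 / p) (q ^ 2) k"
  define D where "D = qpoch (p * q ^ 2) (q ^ 2) k"
  \<comment> \<open>The shift by \<open>q ^ 4\<close> is one step in base \<open>q ^ 4\<close> and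
    two steps in base \<open>q ^ 2\<close>, so all four factorials in \<open>p\<close> change by
    boundary factors only.\<close>
  have A': "qpoch (p * q ^ 4 * q) (q ^ 4) k = A * (1 - p * q * K ^ 2) / (1 - p * q)"
    using qpoch_shift[of "p * q" "q ^ 4" k] p by (simp add: e A_def mult_ac eq_divide_eq)
  have B': "qpoch (q / (p * q ^ 4)) (q ^ 4) k = B * (p * q ^ 3 - 1) / (p * q ^ 3 - K ^ 2)"
  proof -
    have "q / (p * q ^ 4) * q ^ 4 = q / p" using nz by simp
    hence "(1 - q / (p * q ^ 4)) * B = qpoch (q / (p * q ^ 4)) (q ^ 4) k * (1 - q / (p * q ^ 4) * K ^ 2)"
      using qpoch_shift[of "q / (p * q ^ 4)" "q ^ 4" k] by (simp only: e B_def)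
    moreover have e1: "q / (p * q ^ 4) = 1 / (p * q ^ 3)" using nz by (simp add: field_simps eval_nat_numeral)
    ultimately show ?thesis unfolding e1 using nz p by (simp add: divide_simps) (simp add: algebra_simps)
  qed
  have C': "qpoch (q ^ 2 / (p * q ^ 4)) (q ^ 2) k = C * ((p * q ^ 2 - 1) * (p - 1)) / ((p * q ^ 2 - K) * (p - K))"
  proof -
    have "q ^ 2 / (p * q ^ 4) * (q ^ 2) ^ 2 = q ^ 2 / p"
      using nz by (simp add: field_simps power_mult [symmetric] power_add [symmetric])
    hence "(1 - q ^ 2 / (p * q ^ 4)) * (1 - q ^ 2 / (p * q ^ 4) * q ^ 2) * C =
       qpoch (q ^ 2 / (p * q ^ 4)) (q ^ 2) k * ((1 - q ^ 2 / (p * q ^ 4) * K) * (1 - q ^ 2 / (p * q ^ 4) * (q ^ 2 * K)))"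
      using qpoch_shift2[of "q ^ 2 / (p * q ^ 4)" "q ^ 2" k] by (simp only: e C_def power_Suc)
    moreover have e1: "q ^ 2 / (p * q ^ 4) = 1 / (p * q ^ 2)" using nz by (simp add: field_simps eval_nat_numeral)
    ultimately show ?thesis unfolding e1 using nz p c5 c6 by (simp add: divide_simps) (simp add: algebra_simps)
  qed
  have D': "qpoch (p * q ^ 4 * q ^ 2) (q ^ 2) k =
      D * ((1 - p * q ^ 2 * K) * (1 - p * q ^ 4 * K)) / ((1 - p * q ^ 2) * (1 - p * q ^ 4))"
  proof -
    have "(1 - p * q ^ 2) * (1 - p * q ^ 4) * qpoch (p * q ^ 4 * q ^ 2) (q ^ 2) k =
      D * ((1 - p * q ^ 2 * K) * (1 - p * q ^ 4 * K))"
      using qpoch_shift2[of "p * q ^ 2" "q ^ 2" k] unfolding power_Suc e D_def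
      by (simp add: eval_nat_numeral mult.assoc)
    thus ?thesis using c1 c2 by (simp add: eq_divide_eq mult_ac)
  qed
  show ?thesis
    unfolding hterm_def A' B' C' D' A_def[symmetric] B_def[symmetric] C_def[symmetric] D_def[symmetric] K[symmetric]
    using nz nn p c1 c2 c3 c4 c5 c6 K0
    by (simp add: divide_simps A_def[symmetric] B_def[symmetric] C_def[symmetric] D_def[symmetric])
       (simp add: algebra_simps)
qed

text \<open>The certificate \<open>G\<close> is a rational multiple of the summand, and its factor
  \<open>1 - (q ^ (2 * k)) ^ 2\<close> kills it at \<open>k = 0\<close>. Writing
  \<open>G (Suc k)\<close> through the term ratio turns the claim into an identity of rational
  functions in \<open>q\<close>, \<open>a\<close>, \<open>p\<close> and
  \<open>K = q ^ (2 * k)\<close>.\<close>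

lemma hterm_telescope_p:
  assumes adm: "admissible q a p n" and "k < n"
    and p: "p \<noteq> 1" "p * q \<noteq> 1" "\<And>j. j \<le> n \<Longrightarrow> p * q ^ 3 \<noteq> q ^ (4 * j)"
    and w: "a \<noteq> p * q ^ 3" "a * p * q ^ 3 \<noteq> 1"
  defines "G \<equiv> \<lambda>k. hterm q a p k * (- (p * (1 - p ^ 2 * q ^ 4) * (1 - p * q ^ 4) * (1 - (q ^ (2 * k)) ^ 2) *
      (1 - (q ^ (2 * k)) ^ 2 / a) * (1 - a * (q ^ (2 * k)) ^ 2) * (p - q ^ (2 * k)) * (q - q ^ (2 * k)) * q ^ 2) /
      ((1 - p) * (1 - p * q) * ((1 - p * q ^ 3 / a) * (1 - a * p * q ^ 3)) *
       (p * q ^ 3 - (q ^ (2 * k)) ^ 2) * (1 - p * q ^ 2 * q ^ (2 * k)) * q ^ (2 * k)))"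
  shows "(1 - q ^ (6 * k + 1)) * hterm q a (p * q ^ 4) k -
      (1 - p * q ^ 4) * (1 - a * p * q) * (1 - p * q / a) / ((1 - p) * ((1 - p * q ^ 3 / a) * (1 - a * p * q ^ 3))) *
        ((1 - q ^ (6 * k + 1)) * hterm q a p k) = G (Suc k) - G k"
proof -
  have nz: "q \<noteq> 0" "a \<noteq> 0" "p \<noteq> 0" and pj: "\<And>j. j > 0 \<Longrightarrow> p \<noteq> q ^ (2 * j) \<and> p * q ^ (2 * j) \<noteq> 1"
    and aj: "\<And>j. j > 0 \<Longrightarrow> a \<noteq> q ^ (4 * j) \<and> a * q ^ (4 * j) \<noteq> 1"
    and qj: "\<And>j. j > 0 \<Longrightarrow> j \<le> n \<Longrightarrow> q ^ (4 * j) \<noteq> 1"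
    using adm by (auto simp: admissible_def)
  define K where "K = q ^ (2 * k)"
  define u where "u = hterm q a p k"
  have K0: "K \<noteq> 0" using nz K_def by simp
  have K': "q ^ (2 * Suc k) = q ^ 2 * K" by (simp add: K_def power_add [symmetric])
  have c3: "1 - p * q ^ 2 * K \<noteq> 0" using pj[of "Suc k"] by (simp add: K_def power_add [symmetric] mult.assoc)
  have c4: "1 - p * q ^ 4 * K \<noteq> 0" using pj[of "k + 2"] by (simp add: K_def power_add eval_nat_numeral mult_ac)
  have c7: "p * q ^ 3 - K ^ 2 \<noteq> 0" using p(3)[of k] \<open>k < n\<close> by (simp add: K_def power_mult [symmetric] mult_ac)
  have "p * q ^ 3 \<noteq> q ^ (4 * Suc k)" using p(3)[of "Suc k"] \<open>k < n\<close> by simp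
  moreover have "q ^ (4 * Suc k) = (q ^ 2 * K) ^ 2" unfolding K'[symmetric]
    by (subst power_mult [symmetric], rule arg_cong[of _ _ "\<lambda>i. q ^ i"]) simp
  ultimately have c8: "p * q ^ 3 - (q ^ 2 * K) ^ 2 \<noteq> 0" by simp
  have c8': "p - q * K ^ 2 \<noteq> 0"
  proof
    assume "p - q * K ^ 2 = 0"
    hence "p * q ^ 3 - (q ^ 2 * K) ^ 2 = 0" by algebra
    with c8 show False by simp
  qed
  have e4: "q ^ 4 * K ^ 2 = q ^ (4 * Suc k)" by (simp add: K_def power_add [symmetric] power_mult [symmetric])
  have c9: "1 - q ^ 4 * K ^ 2 \<noteq> 0" "1 - q ^ 4 * K ^ 2 / a \<noteq> 0" "1 - a * q ^ 4 * K ^ 2 \<noteq> 0"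
    using qj[of "Suc k"] aj[of "Suc k"] \<open>k < n\<close> nz
    unfolding mult.assoc e4 by (auto simp: mult.assoc simp del: mult_Suc_right)
  have c10: "1 - q ^ 2 * K / p \<noteq> 0"
    using pj[of "Suc k"] nz unfolding K' by auto
  have w': "1 - p * q ^ 3 / a \<noteq> 0" "1 - a * p * q ^ 3 \<noteq> 0" using w nz by auto
  have p': "1 - p \<noteq> 0" "1 - p * q \<noteq> 0" using p by auto
  have six: "q ^ (6 * k + 1) = q * K ^ 3" by (simp add: K_def power_mult [symmetric] mult_ac)
  \<comment> \<open>Over the common denominator \<open>M\<close> all parts of the claim share the
    factor \<open>u * (1 - p * q ^ 4)\<close>; what remains of the numerators is the telescoping
    identity with \<open>c = 1 / a\<close>.\<close>
  define M where "M = K * (1 - p) * (1 - p * q) * ((1 - p * q ^ 3 / a) * (1 - a * p * q ^ 3)) *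
    (p * q ^ 3 - K ^ 2) * (1 - p * q ^ 2 * K) * (1 - p * q ^ 4 * K)"
  have M0: "M \<noteq> 0" unfolding M_def using K0 p' w' c7 c3 c4 by simp
  have 1: "(1 - q * K ^ 3) * hterm q a (p * q ^ 4) k =
     u * (1 - p * q ^ 4) * (K * (1 - q * K ^ 3) * ((1 - p * q * K ^ 2) * (p * q ^ 3 - 1) * (p - K) * (p * q ^ 2 - K) *
        ((1 - p * q ^ 3 / a) * (1 - a * p * q ^ 3)))) / M"
    unfolding hterm_shift_p[OF adm less_imp_le[OF \<open>k < n\<close>] K_def p(1,2) c7[unfolded right_minus_eq]] u_def M_def
    using K0 p' w w' c7 c3 c4 nz by (simp add: frac_eq_eq)
  have 2: "(1 - p * q ^ 4) * (1 - a * p * q) * (1 - p * q / a) / ((1 - p) * ((1 - p * q ^ 3 / a) * (1 - a * p * q ^ 3))) *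
        ((1 - q * K ^ 3) * u) =
     u * (1 - p * q ^ 4) * (K * (1 - q * K ^ 3) * ((1 - p * q) * (p * q ^ 3 - K ^ 2) * (1 - p * q ^ 2 * K) * (1 - p * q ^ 4 * K) *
       ((1 - p * q / a) * (1 - a * p * q)))) / M"
    unfolding M_def using K0 p' w w' c7 c3 c4 nz by (simp add: frac_eq_eq)
  have 3: "G k = u * (1 - p * q ^ 4) * (- p * (1 - p ^ 2 * q ^ 4) * (q ^ 2 * (1 - K ^ 2) * ((1 - K ^ 2 / a) * (1 - a * K ^ 2)) *
       (p - K) * (q - K) * (1 - p * q ^ 4 * K))) / M"
    unfolding G_def M_def K_def[symmetric] u_def[symmetric] using K0 p' w w' c7 c3 c4 nz by (simp add: frac_eq_eq)
  have 4: "G (Suc k) = u * (1 - p * q ^ 4) * (- p * (1 - p ^ 2 * q ^ 4) * ((1 - a * q * K) * (1 - q * K / a) * (1 - q ^ 2 * K ^ 2) *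
       (1 - p * q * K ^ 2) * (1 - q * K) * (p * q ^ 3 - K ^ 2))) / M"
  proof -
    have x1: "(p - q ^ 2 * K) = p * (1 - q ^ 2 * K / p)" "(1 - q * K ^ 2 / p) = (p - q * K ^ 2) / p"
      "p * q ^ 3 - q ^ 4 * K ^ 2 = q ^ 3 * (p - q * K ^ 2)" "q - q ^ 2 * K = q * (1 - q * K)"
      "(q ^ 2 * K) ^ 2 = q ^ 4 * K ^ 2" "1 - a * (q ^ 4 * K ^ 2) = 1 - a * q ^ 4 * K ^ 2"
      "1 - p * q ^ 2 * (q ^ 2 * K) = 1 - p * q ^ 4 * K"
      using nz by (simp_all add: field_simps eval_nat_numeral)
    show ?thesis
      unfolding G_def M_def K' hterm_Suc[OF adm \<open>k < n\<close> K_def] u_def[symmetric] x1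
      using K0 p' w' c7 c3 c4 c8' c9 c10 nz by (simp add: frac_eq_eq) (simp add: eval_nat_numeral)
  qed
  have "a * (1 / a) = 1" using nz by simp
  note id = telescoping_identity_p[OF this, of K q p]
  show ?thesis
    unfolding six u_def[symmetric] 1 2 3 4 diff_divide_distrib[symmetric]
    by (rule arg_cong[where f = "\<lambda>z. z / M"]) (use id in \<open>simp only: right_diff_distrib[symmetric] mult_1_right times_divide_eq_right\<close>)
qed

lemma hsum_shift_p:
  assumes adm: "admissible q a p n"
    and p: "p \<noteq> 1" "p * q \<noteq> 1" "\<And>j. j \<le> n \<Longrightarrow> p * q ^ 3 \<noteq> q ^ (4 * j)"
    and w: "a \<noteq> p * q ^ 3" "a * p * q ^ 3 \<noteq> 1" and z: "hterm q a p n = 0"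
  shows "hsum q a (p * q ^ 4) n * ((1 - p) * ((1 - p * q ^ 3 / a) * (1 - a * p * q ^ 3))) =
    (1 - p * q ^ 4) * (1 - a * p * q) * (1 - p * q / a) * hsum q a p n"
proof -
  have "a \<noteq> 0" using adm by (simp add: admissible_def)
  define s where "s = (1 - p * q ^ 4) * (1 - a * p * q) * (1 - p * q / a) / ((1 - p) * ((1 - p * q ^ 3 / a) * (1 - a * p * q ^ 3)))"
  have "hsum q a (p * q ^ 4) n - s * hsum q a p n =
     (\<Sum>k<n. (1 - q ^ (6 * k + 1)) * hterm q a (p * q ^ 4) k - s * ((1 - q ^ (6 * k + 1)) * hterm q a p k))"
    by (simp add: hsum_def sum_subtractf sum_distrib_left)
  \<comment> \<open>The sum telescopes to \<open>G n - G 0\<close>: the first contains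
    \<open>hterm q a p n\<close>, which is zero by assumption, the second the factor
    \<open>1 - 1\<close>.\<close>
  also have "\<dots> = 0"
    unfolding s_def
    by (subst sum.cong[OF refl hterm_telescope_p[OF adm _ p w]], simp, assumption, subst sum_lessThan_telescope)
       (simp add: z)
  finally have "hsum q a (p * q ^ 4) n = s * hsum q a p n" by simp
  moreover have "1 - p \<noteq> 0" "1 - p * q ^ 3 / a \<noteq> 0" "1 - a * p * q ^ 3 \<noteq> 0" using p w \<open>a \<noteq> 0\<close> by auto
  ultimately show ?thesis by (simp add: s_def)
qed

section \<open>Evaluation when \<open>p\<close> is a negative power of \<open>q\<close>\<close>

lemma power_eq_power_iff:
  fixes q :: "'a::field"
  assumes "q \<noteq> 0" "\<And>j. j > 0 \<Longrightarrow> q ^ j \<noteq> 1"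
  shows "q ^ i = q ^ j \<longleftrightarrow> i = j"
proof (induction i j rule: linorder_wlog)
  case (le i j)
  show ?case
  proof (cases "i = j")
    case False
    have "q ^ j = q ^ i * q ^ (j - i)" using le by (simp add: power_add [symmetric])
    thus ?thesis using assms(2)[of "j - i"] assms(1) le False by auto
  qed simp
qed auto

text \<open>At \<open>p = 1 / q ^ (4 * N + 1)\<close> the factor \<open>(p * q; q^4)_k\<close>
  vanishes for \<open>k > N\<close>, so the recurrence has no boundary term at \<open>n\<close>.
  Multiplying \<open>p\<close> by \<open>q ^ 4\<close> lowers \<open>N\<close> by one, down to
  \<open>p = 1 / q\<close>, where only the term \<open>k = 0\<close> survives.\<close>

lemma hsum_at_negative_power_p:
  fixes q a :: "'a::field"
  assumes q: "q \<noteq> 0" "\<And>j. j > 0 \<Longrightarrow> q ^ j \<noteq> 1"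
    and a: "a \<noteq> 0" "\<And>j. j > 0 \<Longrightarrow> a \<noteq> q ^ (2 * j)" "\<And>j. j > 0 \<Longrightarrow> a * q ^ (2 * j) \<noteq> 1"
    and "N < n"
  shows "hsum q a (1 / q ^ (4 * N + 1)) n =
    (1 - q) * (qpoch (q ^ 5) (q ^ 4) N * qpoch (a * q ^ 2) (q ^ 4) N * qpoch (q ^ 2 / a) (q ^ 4) N) /
      (qpoch q (q ^ 4) N * qpoch (q ^ 4 / a) (q ^ 4) N * qpoch (a * q ^ 4) (q ^ 4) N)"
  using \<open>N < n\<close>
proof (induction N)
  case 0
  have "hterm q a (1 / q) k = 0" if "k > 0" for k
    using that q(1) qpoch_eq_0[of 0 k "1" "q ^ 4"] by (simp add: hterm_def)
  hence "hsum q a (1 / q) n = (\<Sum>k\<in>{0}. (1 - q ^ (6 * k + 1)) * hterm q a (1 / q) k)"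
    unfolding hsum_def using 0 by (intro sum.mono_neutral_right) auto
  thus ?case by simp
next
  case (Suc N)
  note pow_eq = power_eq_power_iff[OF q]
  define p where "p = 1 / q ^ (4 * Suc N + 1)"
  define Q where "Q = q ^ (4 * N)"
  have Q0: "Q \<noteq> 0" using q(1) by (simp add: Q_def)
  have pQ: "p = 1 / (Q * q ^ 5)" by (simp add: p_def Q_def power_add [symmetric] add_ac)
  have p4: "p * q ^ 4 = 1 / q ^ (4 * N + 1)"
    using q(1) by (simp add: p_def field_simps eval_nat_numeral power_add)
  \<comment> \<open>Equations between \<open>p\<close> and powers of \<open>q\<close> become
    equations of exponents. Since \<open>4 * Suc N + 1\<close> is odd, no even power of
    \<open>q\<close> inverts \<open>p\<close>.\<close>
  have mul: "p * q ^ i = q ^ j \<longleftrightarrow> i = j + (4 * Suc N + 1)" for i j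
  proof -
    have "p * q ^ i = q ^ j \<longleftrightarrow> q ^ i = q ^ (j + (4 * Suc N + 1))"
      unfolding p_def power_add[of q j] using q(1) by (simp add: divide_eq_eq del: mult_Suc_right)
    thus ?thesis by (simp only: pow_eq)
  qed
  have "p * q ^ 0 \<noteq> q ^ (2 * j)" for j unfolding mul by simp
  moreover have "p * q ^ (2 * j) \<noteq> q ^ 0" for j unfolding mul by presburger
  moreover have "a \<noteq> q ^ (4 * j)" "a * q ^ (4 * j) \<noteq> 1" if "j > 0" for j using a(2,3)[of "2 * j"] that by auto
  ultimately have adm: "admissible q a p n"
    using q a(1) unfolding admissible_def by (auto simp: p_def)
  have p1: "p \<noteq> 1" using mul[of 0 0] by simp
  have p2: "p * q \<noteq> 1" using mul[of 1 0] by simp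
  have p3: "p * q ^ 3 \<noteq> q ^ (4 * j)" for j using mul[of 3 "4 * j"] by simp
  have "p * q ^ (3 + 2 * (2 * N + 1)) = 1" using mul[of _ 0] by simp
  hence "p * q ^ 3 * q ^ (2 * (2 * N + 1)) = 1" by (simp only: power_add mult.assoc)
  hence pe: "p * q ^ 3 = 1 / q ^ (2 * (2 * N + 1))" using q(1) by (simp add: field_simps)
  have w: "a \<noteq> p * q ^ 3" "a * p * q ^ 3 \<noteq> 1"
    unfolding mult.assoc[of a] pe using a(2,3)[of "2 * N + 1"] q(1) by (auto simp: field_simps)
  have "p * q ^ (1 + 4 * Suc N) = 1" using mul[of _ 0] by simp
  hence "p * q * (q ^ 4) ^ Suc N = 1"
    by (simp only: power_add power_mult power_one_right mult.assoc)
  hence z: "hterm q a p n = 0" using qpoch_eq_0[of "Suc N" n "p * q" "q ^ 4"] Suc.prems by (simp add: hterm_def)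
  have IH: "hsum q a (p * q ^ 4) n = (1 - q) * (qpoch (q ^ 5) (q ^ 4) N * qpoch (a * q ^ 2) (q ^ 4) N * qpoch (q ^ 2 / a) (q ^ 4) N) /
      (qpoch q (q ^ 4) N * qpoch (q ^ 4 / a) (q ^ 4) N * qpoch (a * q ^ 4) (q ^ 4) N)"
    unfolding p4 using Suc by simp
  have eN: "(q ^ 4) ^ N = Q" by (simp add: Q_def power_mult)
  have x: "q * Q \<noteq> 1" "q ^ 5 * Q \<noteq> 1" using q(2)[of "4 * N + 1"] q(2)[of "4 * N + 5"]
    by (simp_all add: Q_def power_add mult_ac)
  have y: "a * q ^ 2 * Q \<noteq> 1" "a * q ^ 4 * Q \<noteq> 1" "a \<noteq> q ^ 2 * Q" "a \<noteq> q ^ 4 * Q"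
    using a(2,3)[of "2 * N + 1"] a(2,3)[of "2 * N + 2"] by (simp_all add: Q_def power_add mult_ac eval_nat_numeral)
  \<comment> \<open>Once \<open>p = 1 / (Q * q ^ 5)\<close> is inserted, both products have the
    denominator \<open>Q ^ 3 * q ^ 9 * a\<close>; the multiplier is this denominator.\<close>
  have s: "((1 - p) * ((1 - p * q ^ 3 / a) * (1 - a * p * q ^ 3))) * (Q * q ^ 5 * (Q * q ^ 2) * (Q * q ^ 2) * a) =
      (Q * q ^ 5 - 1) * (a * Q * q ^ 2 - 1) * (Q * q ^ 2 - a)"
    "(1 - p * q ^ 4) * (1 - a * p * q) * (1 - p * q / a) * (Q * q ^ 5 * (Q * q ^ 2) * (Q * q ^ 2) * a) =
      (Q * q - 1) * (Q * q ^ 4 - a) * (a * Q * q ^ 4 - 1)"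
    unfolding pQ using q(1) a(1) Q0 by (simp_all add: field_simps eval_nat_numeral)
  have rec: "(1 - p * q ^ 4) * (1 - a * p * q) * (1 - p * q / a) * hsum q a p n =
    hsum q a (p * q ^ 4) n * ((1 - p) * ((1 - p * q ^ 3 / a) * (1 - a * p * q ^ 3)))"
    using hsum_shift_p[OF adm p1 p2 p3 w z] by simp
  have "(Q * q - 1) * (Q * q ^ 4 - a) * (a * Q * q ^ 4 - 1) * hsum q a p n =
    hsum q a (p * q ^ 4) n * ((Q * q ^ 5 - 1) * (a * Q * q ^ 2 - 1) * (Q * q ^ 2 - a))"
    unfolding s[symmetric] using arg_cong[OF rec, of "\<lambda>z. z * (Q * q ^ 5 * (Q * q ^ 2) * (Q * q ^ 2) * a)"]
    by (simp only: mult_ac)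
  hence "hsum q a p n = hsum q a (p * q ^ 4) n * (((Q * q ^ 5 - 1) * (a * Q * q ^ 2 - 1) * (Q * q ^ 2 - a)) /
    ((Q * q - 1) * (Q * q ^ 4 - a) * (a * Q * q ^ 4 - 1)))"
    using x y by (simp add: eq_divide_eq mult_ac)
  also have "((Q * q ^ 5 - 1) * (a * Q * q ^ 2 - 1) * (Q * q ^ 2 - a)) / ((Q * q - 1) * (Q * q ^ 4 - a) * (a * Q * q ^ 4 - 1))
     = ((1 - q ^ 5 * Q) * (1 - a * q ^ 2 * Q) * (1 - q ^ 2 / a * Q)) / ((1 - q * Q) * (1 - q ^ 4 / a * Q) * (1 - a * q ^ 4 * Q))"
    using x y a(1) by (simp add: divide_simps) (simp add: algebra_simps)
  finally show ?case
    unfolding IH p_def [symmetric] qpoch_Suc eN by (simp add: times_divide_times_eq mult_ac)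
qed

section \<open>The recurrence in \<open>a\<close> and the evaluation at negative powers of
  \<open>q\<close>\<close>

lemma hterm_shift_a:
  assumes adm: "admissible q a p n" and "k \<le> n" and K: "K = q ^ (2 * k)"
    and a: "a \<noteq> 1" "a * q \<noteq> K" "a * q ^ 3 \<noteq> K" "a * q \<noteq> 1" "a * q ^ 3 \<noteq> 1"
  shows "hterm q (a * q ^ 4) p k =
    hterm q a p k * ((1 - a * q * K) * (1 - a * q ^ 3 * K) * (a - K ^ 2) * (1 - a * q ^ 4) /
      ((a - 1) * (a * q ^ 3 - K) * (a * q - K) * (1 - a * q ^ 4 * K ^ 2)))"
proof -
  have nz: "q \<noteq> 0" "a \<noteq> 0" "p \<noteq> 0" and aj: "\<And>j. j > 0 \<Longrightarrow> a \<noteq> q ^ (4 * j) \<and> a * q ^ (4 * j) \<noteq> 1"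
    using adm by (auto simp: admissible_def)
  note nn = admissible_nonzero[OF adm \<open>k \<le> n\<close>]
  have e: "(q ^ 4) ^ k = K ^ 2" "(q ^ 2) ^ k = K"
    by (simp_all add: K power_mult [symmetric] mult_ac)
  have K0: "K \<noteq> 0" using nz K by simp
  have c1: "a * q ^ 4 \<noteq> 1" using aj[of 1] by simp
  have c2: "a * q ^ 4 * K ^ 2 \<noteq> 1"
    using aj[of "Suc k"] by (simp add: K power_add [symmetric] power_mult [symmetric] mult_ac)
  have K2: "K ^ 2 = q ^ (4 * k)" by (simp add: K power_mult [symmetric] mult_ac)
  have c3: "a \<noteq> K ^ 2" unfolding K2 using aj[of k] a(1) by (cases "k = 0") auto
  define A where "A = qpoch (a * q) (q ^ 2) k"
  define B where "B = qpoch (q / a) (q ^ 2) k"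
  define C where "C = qpoch (q ^ 4 / a) (q ^ 4) k"
  define D where "D = qpoch (a * q ^ 4) (q ^ 4) k"
  have A': "qpoch (a * q ^ 4 * q) (q ^ 2) k = A * ((1 - a * q * K) * (1 - a * q ^ 3 * K)) / ((1 - a * q) * (1 - a * q ^ 3))"
  proof -
    have "(1 - a * q) * (1 - a * q ^ 3) * qpoch (a * q ^ 4 * q) (q ^ 2) k = A * ((1 - a * q * K) * (1 - a * q ^ 3 * K))"
      using qpoch_shift2[of "a * q" "q ^ 2" k] unfolding power_Suc e A_def
      by (simp add: eval_nat_numeral mult.assoc)
    thus ?thesis using a by (simp add: eq_divide_eq mult_ac)
  qed
  have B': "qpoch (q / (a * q ^ 4)) (q ^ 2) k = B * ((a * q ^ 3 - 1) * (a * q - 1)) / ((a * q ^ 3 - K) * (a * q - K))"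
  proof -
    have "q / (a * q ^ 4) * (q ^ 2) ^ 2 = q / a"
      using nz by (simp add: field_simps power_mult [symmetric] power_add [symmetric])
    hence "(1 - q / (a * q ^ 4)) * (1 - q / (a * q ^ 4) * q ^ 2) * B =
       qpoch (q / (a * q ^ 4)) (q ^ 2) k * ((1 - q / (a * q ^ 4) * K) * (1 - q / (a * q ^ 4) * (q ^ 2 * K)))"
      using qpoch_shift2[of "q / (a * q ^ 4)" "q ^ 2" k] by (simp only: e B_def power_Suc)
    moreover have e1: "q / (a * q ^ 4) = 1 / (a * q ^ 3)" using nz by (simp add: field_simps eval_nat_numeral)
    moreover have e2: "1 / (a * q ^ 3) * q ^ 2 = 1 / (a * q)" "1 / (a * q ^ 3) * (q ^ 2 * K) = 1 / (a * q) * K"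
      using nz by (simp_all add: field_simps eval_nat_numeral)
    ultimately have "(1 - 1 / (a * q ^ 3)) * (1 - 1 / (a * q)) * B =
      qpoch (1 / (a * q ^ 3)) (q ^ 2) k * ((1 - 1 / (a * q ^ 3) * K) * (1 - 1 / (a * q) * K))" by (simp only:)
    thus ?thesis unfolding e1 using nz a by (simp add: divide_simps) (simp add: algebra_simps)
  qed
  have C': "qpoch (q ^ 4 / (a * q ^ 4)) (q ^ 4) k = C * (a - 1) / (a - K ^ 2)"
  proof -
    have e1: "q ^ 4 / (a * q ^ 4) = 1 / a" using nz by simp
    have "(1 - 1 / a) * C = qpoch (1 / a) (q ^ 4) k * (1 - 1 / a * K ^ 2)"
      using qpoch_shift[of "1 / a" "q ^ 4" k] by (simp add: e C_def)
    thus ?thesis unfolding e1 using nz c3 by (simp add: divide_simps) (simp add: algebra_simps)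
  qed
  have D': "qpoch (a * q ^ 4 * q ^ 4) (q ^ 4) k = D * (1 - a * q ^ 4 * K ^ 2) / (1 - a * q ^ 4)"
    using qpoch_shift[of "a * q ^ 4" "q ^ 4" k] c1 by (simp add: e D_def eq_divide_eq mult_ac)
  show ?thesis
    unfolding hterm_def A' B' C' D' A_def[symmetric] B_def[symmetric] C_def[symmetric] D_def[symmetric] K[symmetric]
    using nz nn a c1 c2 c3 K0
    by (simp add: divide_simps A_def[symmetric] B_def[symmetric] C_def[symmetric] D_def[symmetric])
       (simp add: algebra_simps)
qed

text \<open>The counterpart of \<open>hterm_telescope_p\<close> for a shift of \<open>a\<close>. The
  poles of \<open>G\<close> lie where \<open>a * q\<close> or \<open>a * q ^ 3\<close> is an even
  power of \<open>q\<close>; excluding these values decides where an induction along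
  \<open>a\<close> can start.\<close>

lemma hterm_telescope_a:
  assumes adm: "admissible q a p n" and "k < n"
    and a: "a \<noteq> 1" "\<And>j. a * q \<noteq> q ^ (2 * j)" "\<And>j. a * q ^ 3 \<noteq> q ^ (2 * j)"
    and w: "p \<noteq> a * q ^ 3" "a * p * q ^ 3 \<noteq> 1"
  defines "G \<equiv> \<lambda>k. hterm q a p k * ((1 + a * q ^ 2) * (1 - a * q ^ 4) * (a * q ^ 2) *
      ((1 - (q ^ (2 * k)) ^ 2) * (a - (q ^ (2 * k)) ^ 2) * ((1 - p * q ^ (2 * k)) * (1 - q ^ (2 * k) / p)) * (q - q ^ (2 * k))) /
      ((1 - a) * ((1 - a * q ^ 3 / p) * (1 - a * p * q ^ 3)) *
       (a * q ^ 3 - q ^ (2 * k)) * (a * q - q ^ (2 * k)) * q ^ (2 * k)))"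
  shows "(1 - q ^ (6 * k + 1)) * hterm q (a * q ^ 4) p k -
      (1 - a * q ^ 4) * (1 - a * p * q) * (1 - a * q / p) / ((1 - a) * ((1 - a * q ^ 3 / p) * (1 - a * p * q ^ 3))) *
        ((1 - q ^ (6 * k + 1)) * hterm q a p k) = G (Suc k) - G k"
proof -
  have nz: "q \<noteq> 0" "a \<noteq> 0" "p \<noteq> 0" and pj: "\<And>j. j > 0 \<Longrightarrow> p \<noteq> q ^ (2 * j) \<and> p * q ^ (2 * j) \<noteq> 1"
    and aj: "\<And>j. j > 0 \<Longrightarrow> a \<noteq> q ^ (4 * j) \<and> a * q ^ (4 * j) \<noteq> 1"
    and qj: "\<And>j. j > 0 \<Longrightarrow> j \<le> n \<Longrightarrow> q ^ (4 * j) \<noteq> 1"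
    using adm by (auto simp: admissible_def)
  define K where "K = q ^ (2 * k)"
  define u where "u = hterm q a p k"
  have K0: "K \<noteq> 0" using nz K_def by simp
  have K': "q ^ (2 * Suc k) = q ^ 2 * K" by (simp add: K_def power_add [symmetric])
  have c3: "1 - p * q ^ 2 * K \<noteq> 0" using pj[of "Suc k"] by (simp add: K_def power_add [symmetric] mult.assoc)
  have c5: "a * q - K \<noteq> 0" "a * q ^ 3 - K \<noteq> 0" using a(2,3)[of k] by (simp_all add: K_def)
  have c6: "a * q - q ^ 2 * K \<noteq> 0" "a * q ^ 3 - q ^ 2 * K \<noteq> 0" using a(2,3)[of "Suc k"] K' by (simp_all only: right_minus_eq not_False_eq_True)
  have c6': "a - q * K \<noteq> 0"
  proof
    assume "a - q * K = 0"
    hence "a * q - q ^ 2 * K = 0" by algebra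
    with c6 show False by simp
  qed
  have e4: "q ^ 4 * K ^ 2 = q ^ (4 * Suc k)" by (simp add: K_def power_add [symmetric] power_mult [symmetric])
  have c9: "1 - q ^ 4 * K ^ 2 \<noteq> 0" "1 - q ^ 4 * K ^ 2 / a \<noteq> 0" "1 - a * q ^ 4 * K ^ 2 \<noteq> 0" "a - q ^ 4 * K ^ 2 \<noteq> 0"
    using qj[of "Suc k"] aj[of "Suc k"] \<open>k < n\<close> nz
    unfolding mult.assoc e4 by (auto simp: mult.assoc simp del: mult_Suc_right)
  have c10: "1 - q ^ 2 * K / p \<noteq> 0"
    using pj[of "Suc k"] nz unfolding K' by auto
  have w': "1 - a * q ^ 3 / p \<noteq> 0" "1 - a * p * q ^ 3 \<noteq> 0" using w nz by auto
  have a': "1 - a \<noteq> 0" "a - 1 \<noteq> 0" using a by auto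
  have six: "q ^ (6 * k + 1) = q * K ^ 3" by (simp add: K_def power_mult [symmetric] mult_ac)
  define M where "M = K * (1 - a) * ((1 - a * q ^ 3 / p) * (1 - a * p * q ^ 3)) *
    (a * q ^ 3 - K) * (a * q - K) * (1 - a * q ^ 4 * K ^ 2)"
  have M0: "M \<noteq> 0" unfolding M_def using K0 a' w' c5 c9 by simp
  have a34: "a * q \<noteq> 1" "a * q ^ 3 \<noteq> 1" using a(2,3)[of 0] by simp_all
  have 1: "(1 - q * K ^ 3) * hterm q (a * q ^ 4) p k =
     u * (1 - a * q ^ 4) * (K * (1 - q * K ^ 3) * (- (1 - a * q * K) * (1 - a * q ^ 3 * K) * (a - K ^ 2) *
        ((1 - a * q ^ 3 / p) * (1 - a * p * q ^ 3)))) / M"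
    unfolding hterm_shift_a[OF adm less_imp_le[OF \<open>k < n\<close>] K_def a(1) c5[unfolded right_minus_eq] a34] u_def M_def
    using K0 a' w w' c5 c9 nz by (simp add: frac_eq_eq) (simp add: algebra_simps)
  have 2: "(1 - a * q ^ 4) * (1 - a * p * q) * (1 - a * q / p) / ((1 - a) * ((1 - a * q ^ 3 / p) * (1 - a * p * q ^ 3))) *
        ((1 - q * K ^ 3) * u) =
     u * (1 - a * q ^ 4) * (K * (1 - q * K ^ 3) * ((a * q ^ 3 - K) * (a * q - K) * (1 - a * q ^ 4 * K ^ 2) *
       ((1 - a * q / p) * (1 - a * p * q)))) / M"
    unfolding M_def using K0 a' w w' c5 c9 nz by (simp add: frac_eq_eq)
  have 3: "G k = u * (1 - a * q ^ 4) * (a * (1 + a * q ^ 2) * (q ^ 2 * (1 - K ^ 2) * (a - K ^ 2) *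
       ((1 - p * K) * (1 - K / p)) * (q - K) * (1 - a * q ^ 4 * K ^ 2))) / M"
    unfolding G_def M_def K_def[symmetric] u_def[symmetric] using K0 a' w w' c5 c9 nz by (simp add: frac_eq_eq)
  have 4: "G (Suc k) = u * (1 - a * q ^ 4) * (a * (1 + a * q ^ 2) * ((1 - a * q * K) * (1 - q ^ 2 * K ^ 2) *
       ((1 - p * q * K ^ 2) * (1 - q * K ^ 2 / p)) * (1 - q * K) * (a * q ^ 3 - K))) / M"
  proof -
    have x1: "(1 - q * K / a) = (a - q * K) / a" "1 - q ^ 4 * K ^ 2 / a = (a - q ^ 4 * K ^ 2) / a"
      "a * q ^ 3 - q ^ 2 * K = q ^ 2 * (a * q - K)" "q - q ^ 2 * K = q * (1 - q * K)"
      "a * q - q ^ 2 * K = q * (a - q * K)"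
      "(q ^ 2 * K) ^ 2 = q ^ 4 * K ^ 2" "1 - p * (q ^ 2 * K) = 1 - p * q ^ 2 * K"
      using nz by (simp_all add: field_simps eval_nat_numeral)
    show ?thesis
      unfolding G_def M_def K' hterm_Suc[OF adm \<open>k < n\<close> K_def] u_def[symmetric] x1
      using K0 a' w' c3 c5 c6' c9 c10 nz by (simp add: frac_eq_eq)
  qed
  have "p * (1 / p) = 1" using nz by simp
  note id = telescoping_identity_a[OF this, of K q a]
  show ?thesis
    unfolding six u_def[symmetric] 1 2 3 4 diff_divide_distrib[symmetric]
    by (rule arg_cong[where f = "\<lambda>z. z / M"]) (use id in \<open>simp only: right_diff_distrib[symmetric] mult_1_right times_divide_eq_right\<close>)
qed

lemma hsum_shift_a:
  assumes adm: "admissible q a p n"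
    and a: "a \<noteq> 1" "\<And>j. a * q \<noteq> q ^ (2 * j)" "\<And>j. a * q ^ 3 \<noteq> q ^ (2 * j)"
    and w: "p \<noteq> a * q ^ 3" "a * p * q ^ 3 \<noteq> 1" and z: "hterm q a p n = 0"
  shows "hsum q (a * q ^ 4) p n * ((1 - a) * ((1 - a * q ^ 3 / p) * (1 - a * p * q ^ 3))) =
    (1 - a * q ^ 4) * (1 - a * p * q) * (1 - a * q / p) * hsum q a p n"
proof -
  have "p \<noteq> 0" using adm by (simp add: admissible_def)
  define s where "s = (1 - a * q ^ 4) * (1 - a * p * q) * (1 - a * q / p) / ((1 - a) * ((1 - a * q ^ 3 / p) * (1 - a * p * q ^ 3)))"
  have "hsum q (a * q ^ 4) p n - s * hsum q a p n =
     (\<Sum>k<n. (1 - q ^ (6 * k + 1)) * hterm q (a * q ^ 4) p k - s * ((1 - q ^ (6 * k + 1)) * hterm q a p k))"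
    by (simp add: hsum_def sum_subtractf sum_distrib_left)
  also have "\<dots> = 0"
    unfolding s_def
    by (subst sum.cong[OF refl hterm_telescope_a[OF adm _ a w]], simp, subst sum_lessThan_telescope)
       (simp add: z)
  finally have "hsum q (a * q ^ 4) p n = s * hsum q a p n" by simp
  moreover have "1 - a \<noteq> 0" "1 - a * q ^ 3 / p \<noteq> 0" "1 - a * p * q ^ 3 \<noteq> 0" using a w \<open>p \<noteq> 0\<close> by auto
  ultimately show ?thesis by (simp add: s_def)
qed

text \<open>At \<open>a = 1 / q ^ 3\<close> the factor \<open>(a * q; q^2)_k\<close> vanishes for
  \<open>k > 1\<close>, which leaves two terms. The one-term sum at \<open>a = q\<close> cannot
  serve as the start: the step from there would use \<open>hsum_shift_a\<close> with
  \<open>a * q ^ 3 = 1\<close>, which is excluded.\<close>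

lemma hsum_base_a:
  fixes q p :: "'a::field"
  assumes q: "q \<noteq> 0" "\<And>j. j > 0 \<Longrightarrow> q ^ j \<noteq> 1"
    and p: "p \<noteq> 0" "\<And>j. j > 0 \<Longrightarrow> p \<noteq> q ^ (2 * j)" "\<And>j. j > 0 \<Longrightarrow> p * q ^ (2 * j) \<noteq> 1"
    and "n > 1"
  shows "hsum q (1 / q ^ 3) p n =
    (1 - q) * (qpoch (q ^ 3) (q ^ 4) 1 * qpoch p (q ^ 4) 1 * qpoch (1 / p) (q ^ 4) 1) /
      (qpoch (1 / q) (q ^ 4) 1 * qpoch (q ^ 2 / p) (q ^ 4) 1 * qpoch (p * q ^ 2) (q ^ 4) 1)"
proof -
  have "hterm q (1 / q ^ 3) p k = 0" if "k > 1" for k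
  proof -
    have "1 / q ^ 3 * q * (q ^ 2) ^ 1 = 1" using q(1) by (simp add: field_simps eval_nat_numeral)
    from qpoch_eq_0[OF that this] show ?thesis by (simp add: hterm_def)
  qed
  hence "hterm q (1 / q ^ 3) p k = 0" if "k \<noteq> 0" "k \<noteq> Suc 0" for k using that by simp
  hence "hsum q (1 / q ^ 3) p n = (\<Sum>k\<in>{0,1}. (1 - q ^ (6 * k + 1)) * hterm q (1 / q ^ 3) p k)"
    unfolding hsum_def using \<open>n > 1\<close> by (intro sum.mono_neutral_right) auto
  also have "\<dots> = (1 - q) + (1 - q ^ 7) * hterm q (1 / q ^ 3) p 1" by (simp add: eval_nat_numeral)
  also have "(1 - q ^ 7) * hterm q (1 / q ^ 3) p 1 =
      - ((1 - q ^ 2) ^ 2 * (1 - p * q) * (1 - q / p) / ((1 - q) * (1 - q ^ 2 / p) * (1 - p * q ^ 2)))"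
  proof -
    have x: "1 / q ^ 3 * q = 1 / q ^ 2" "q / (1 / q ^ 3) = q ^ 4" "q ^ 4 / (1 / q ^ 3) = q ^ 7" "1 / q ^ 3 * q ^ 4 = q"
      using q(1) by (simp_all add: field_simps eval_nat_numeral)
    have nz: "1 - q ^ 4 \<noteq> 0" "1 - q ^ 7 \<noteq> 0" "1 - q \<noteq> 0" "1 - q ^ 2 / p \<noteq> 0" "1 - p * q ^ 2 \<noteq> 0"
      using q(2)[of 4] q(2)[of 7] q(2)[of 1] p(2,3)[of 1] p(1) by auto
    have "(1 - q ^ 7) * hterm q (1 / q ^ 3) p 1 = (1 - q ^ 7) * ((1 - 1 / q ^ 2) * (1 - q ^ 4) * (1 - q ^ 2) * (1 - p * q) * (1 - q / p) /
       ((1 - q ^ 4) * (1 - q ^ 7) * (1 - q) * (1 - q ^ 2 / p) * (1 - p * q ^ 2)) * q ^ 2)"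
      unfolding hterm_def x by (simp add: qpoch_def)
    also have "\<dots> = ((1 - 1 / q ^ 2) * q ^ 2) * (1 - q ^ 2) * (1 - p * q) * (1 - q / p) /
       ((1 - q) * (1 - q ^ 2 / p) * (1 - p * q ^ 2))"
      using nz by (simp add: frac_eq_eq)
    also have "(1 - 1 / q ^ 2) * q ^ 2 = - (1 - q ^ 2)" using q(1) by (simp add: field_simps)
    finally show ?thesis
      by (simp only: power2_eq_square[of "1 - q ^ 2"] mult_minus_left minus_divide_left mult.assoc)
  qed
  also have "(1 - q) + - ((1 - q ^ 2) ^ 2 * (1 - p * q) * (1 - q / p) / ((1 - q) * (1 - q ^ 2 / p) * (1 - p * q ^ 2))) =
     (1 - q) * (((1 - q ^ 3) * (1 - p) * (1 - 1 / p)) / ((1 - 1 / q) * (1 - q ^ 2 / p) * (1 - p * q ^ 2)))"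
  proof -
    have nz: "1 - q \<noteq> 0" "p - q ^ 2 \<noteq> 0" "1 - p * q ^ 2 \<noteq> 0"
      using q(2)[of 1] p(2,3)[of 1] p(1) by auto
    have e: "1 - q ^ 2 / p = (p - q ^ 2) / p" "1 - q / p = (p - q) / p" "1 - 1 / p = (p - 1) / p" "1 - 1 / q = - (1 - q) / q"
      using q(1) p(1) by (simp_all add: field_simps)
    show ?thesis unfolding e using nz q(1) p(1)
      by (simp add: divide_simps) algebra
  qed
  finally show ?thesis by (simp add: qpoch_def mult_ac)
qed

text \<open>At \<open>a = 1 / q ^ (4 * m + 3)\<close> the factor \<open>(a * q; q^2)_k\<close>
  vanishes for \<open>k > 2 * m + 1\<close>, so the recurrence has no boundary term, and each step
  lowers \<open>m\<close> by one. With \<open>2 * m < n\<close> the bound \<open>Suc n\<close> keeps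
  all terms up to \<open>2 * m + 1\<close> in range.\<close>

lemma hsum_at_negative_power_a:
  fixes q p :: "'a::field"
  assumes q: "q \<noteq> 0" "\<And>j. j > 0 \<Longrightarrow> q ^ j \<noteq> 1"
    and p: "p \<noteq> 0" "\<And>j. p \<noteq> q ^ (2 * j)" "\<And>j. p * q ^ (2 * j) \<noteq> 1"
    and "2 * m < n"
  shows "hsum q (1 / q ^ (4 * m + 3)) p (Suc n) =
    (1 - q) * (qpoch (q ^ 3) (q ^ 4) (Suc m) * qpoch p (q ^ 4) (Suc m) * qpoch (1 / p) (q ^ 4) (Suc m)) /
      (qpoch (1 / q) (q ^ 4) (Suc m) * qpoch (q ^ 2 / p) (q ^ 4) (Suc m) * qpoch (p * q ^ 2) (q ^ 4) (Suc m))"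
  using \<open>2 * m < n\<close>
proof (induction m)
  case 0
  show ?case using hsum_base_a[OF q p(1) p(2) p(3), of "Suc n"] 0 by simp
next
  case (Suc m)
  note pow_eq = power_eq_power_iff[OF q]
  define a where "a = 1 / q ^ (4 * Suc m + 3)"
  define Q where "Q = q ^ (4 * Suc m)"
  have Q0: "Q \<noteq> 0" using q(1) by (simp add: Q_def)
  have aQ: "a = 1 / (Q * q ^ 3)" unfolding a_def Q_def by (simp only: power_add)
  have Q4: "Q = q ^ (4 * m) * q ^ 4"
  proof -
    have "4 * Suc m = 4 * m + 4" by simp
    thus ?thesis unfolding Q_def by (simp only: power_add)
  qed
  have a4: "a * q ^ 4 = 1 / q ^ (4 * m + 3)"
    using q(1) unfolding aQ Q4 by (simp add: field_simps power_add)
  have a0: "a \<noteq> 0" using q(1) by (simp add: a_def)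
  have mul: "a * q ^ i = q ^ j \<longleftrightarrow> i = j + (4 * Suc m + 3)" for i j
  proof -
    have "a * q ^ i = q ^ j \<longleftrightarrow> q ^ i = q ^ (j + (4 * Suc m + 3))"
      unfolding a_def power_add[of q j] using q(1) by (simp add: divide_eq_eq del: mult_Suc_right)
    thus ?thesis by (simp only: pow_eq)
  qed
  have "a * q ^ 0 \<noteq> q ^ (4 * j)" for j unfolding mul by simp
  moreover have "a * q ^ (4 * j) \<noteq> q ^ 0" for j unfolding mul by presburger
  ultimately have adm: "admissible q a p (Suc n)"
    using q p a0 unfolding admissible_def by auto
  have a1: "a \<noteq> 1" using mul[of 0 0] by simp
  have a2: "a * q \<noteq> q ^ (2 * j)" for j using mul[of 1 "2 * j"] by simp
  have a3: "a * q ^ 3 \<noteq> q ^ (2 * j)" for j using mul[of 3 "2 * j"] by simp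
  have ae: "a * q ^ 3 = 1 / Q" unfolding aQ using q(1) by simp
  have Q2: "Q = q ^ (2 * (2 * Suc m))" unfolding Q_def by (rule arg_cong[of _ _ "\<lambda>i. q ^ i"]) simp
  have w: "p \<noteq> a * q ^ 3" "a * p * q ^ 3 \<noteq> 1"
  proof -
    show "p \<noteq> a * q ^ 3" unfolding ae using p(3)[of "2 * Suc m"] Q0 unfolding Q2[symmetric] by (auto simp: field_simps)
    have "a * p * q ^ 3 = p / Q"
    proof -
      have "a * p * q ^ 3 = p * (a * q ^ 3)" by (simp add: mult_ac)
      thus ?thesis by (simp add: ae)
    qed
    thus "a * p * q ^ 3 \<noteq> 1" using p(2)[of "2 * Suc m"] Q0 unfolding Q2[symmetric] by simp
  qed
  have "a * q ^ (1 + 2 * (2 * Suc m + 1)) = q ^ 0" unfolding mul by simp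
  hence "a * q * (q ^ 2) ^ (2 * Suc m + 1) = 1"
    by (simp only: power_0 power_add power_mult power_one_right mult.assoc)
  moreover have "2 * Suc m + 1 < Suc n" using Suc.prems by simp
  ultimately have z: "hterm q a p (Suc n) = 0" using qpoch_eq_0[of "2 * Suc m + 1" "Suc n" "a * q" "q ^ 2"] by (simp add: hterm_def)
  have IH: "hsum q (a * q ^ 4) p (Suc n) = (1 - q) * (qpoch (q ^ 3) (q ^ 4) (Suc m) * qpoch p (q ^ 4) (Suc m) * qpoch (1 / p) (q ^ 4) (Suc m)) /
      (qpoch (1 / q) (q ^ 4) (Suc m) * qpoch (q ^ 2 / p) (q ^ 4) (Suc m) * qpoch (p * q ^ 2) (q ^ 4) (Suc m))"
    unfolding a4 using Suc by simp
  have eN: "(q ^ 4) ^ Suc m = Q" by (simp only: Q_def power_mult)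
  have x: "q ^ 3 * Q \<noteq> 1" "Q / q \<noteq> 1"
  proof -
    have "q ^ 3 * Q = q ^ (4 * Suc m + 3)" by (simp only: Q_def power_add mult.commute)
    thus "q ^ 3 * Q \<noteq> 1" using q(2)[of "4 * Suc m + 3"] by simp
    have "Q / q = q ^ (4 * m + 3)" using q(1) unfolding Q4 by (simp add: power_add eval_nat_numeral)
    thus "Q / q \<noteq> 1" using q(2)[of "4 * m + 3"] by simp
  qed
  have y: "p * q ^ 2 * Q \<noteq> 1" "p * Q \<noteq> 1" "p \<noteq> q ^ 2 * Q" "p \<noteq> Q"
    using p(2,3)[of "2 * Suc m + 1"] p(2,3)[of "2 * Suc m"] by (simp_all add: Q_def power_add mult_ac eval_nat_numeral)
  have s: "((1 - a) * ((1 - a * q ^ 3 / p) * (1 - a * p * q ^ 3))) * (Q * q ^ 3 * Q * Q * p * q) =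
      (Q * q ^ 3 - 1) * (p * Q - 1) * (Q - p) * q"
    "(1 - a * q ^ 4) * (1 - a * p * q) * (1 - a * q / p) * (Q * q ^ 3 * Q * Q * p * q) =
      (Q - q) * (Q * q ^ 2 - p) * (p * Q * q ^ 2 - 1)"
    unfolding aQ using q(1) p(1) Q0 by (simp_all add: field_simps eval_nat_numeral)
  have rec: "(1 - a * q ^ 4) * (1 - a * p * q) * (1 - a * q / p) * hsum q a p (Suc n) =
    hsum q (a * q ^ 4) p (Suc n) * ((1 - a) * ((1 - a * q ^ 3 / p) * (1 - a * p * q ^ 3)))"
    using hsum_shift_a[OF adm a1 a2 a3 w z] by simp
  have "(Q - q) * (Q * q ^ 2 - p) * (p * Q * q ^ 2 - 1) * hsum q a p (Suc n) =
    hsum q (a * q ^ 4) p (Suc n) * ((Q * q ^ 3 - 1) * (p * Q - 1) * (Q - p) * q)"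
    unfolding s[symmetric] using arg_cong[OF rec, of "\<lambda>z. z * (Q * q ^ 3 * Q * Q * p * q)"]
    by (simp only: mult_ac)
  hence "hsum q a p (Suc n) = hsum q (a * q ^ 4) p (Suc n) * (((Q * q ^ 3 - 1) * (p * Q - 1) * (Q - p) * q) /
    ((Q - q) * (Q * q ^ 2 - p) * (p * Q * q ^ 2 - 1)))"
    using x y q(1) by (simp add: eq_divide_eq mult_ac)
  also have "((Q * q ^ 3 - 1) * (p * Q - 1) * (Q - p) * q) / ((Q - q) * (Q * q ^ 2 - p) * (p * Q * q ^ 2 - 1))
     = ((1 - q ^ 3 * Q) * (1 - p * Q) * (1 - 1 / p * Q)) / ((1 - 1 / q * Q) * (1 - q ^ 2 / p * Q) * (1 - p * q ^ 2 * Q))"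
    using x y q(1) p(1) by (simp add: divide_simps) (simp add: algebra_simps)
  finally show ?case
    unfolding a_def [symmetric] qpoch_Suc[of _ _ "Suc m"] eN unfolding IH by (simp add: times_divide_times_eq mult_ac)
qed

subsection \<open>Vanishing at roots of unity\<close>

lemma power_eq_1_iff_dvd:
  fixes q :: "'a::field"
  assumes "q ^ d = 1" "\<And>j. 0 < j \<Longrightarrow> j < d \<Longrightarrow> q ^ j \<noteq> 1" "d > 0"
  shows "q ^ i = 1 \<longleftrightarrow> d dvd i"
proof -
  have "q ^ i = q ^ (d * (i div d) + i mod d)" by simp
  also have "\<dots> = q ^ (i mod d)" by (simp only: power_add power_mult assms(1) power_one mult_1_left)
  finally show ?thesis using assms(2)[of "i mod d"] assms(3) by (auto simp: dvd_eq_mod_eq_0)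
qed

text \<open>The value \<open>E p\<close> is \<open>p ^ m\<close> times the denominator
  \<open>(q^2/p, p*q^2; q^2)_m\<close>. Two telescoping products express its change by boundary
  factors, which at \<open>q ^ (2 * m + 1) = 1\<close> collapse to
  \<open>(1 - p) / (1 - p * q ^ 4)\<close>. This is the reciprocal of a quotient in
  \<open>hsum_shift_p\<close>, so the two cancel in the product of sum and denominator.\<close>

lemma prod_shift_root_of_unity:
  fixes q p :: "'a::field"
  assumes q: "q ^ (2 * m + 1) = 1" and p: "p * q \<noteq> 1" "p * q ^ 3 \<noteq> 1" "p * q ^ 2 \<noteq> 1"
  defines "E \<equiv> \<lambda>p. \<Prod>j<m. (p - q ^ (2 * Suc j)) * (1 - p * q ^ (2 * Suc j))"
  shows "E (p * q ^ 4) * (1 - p * q ^ 4) = E p * (1 - p)"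
proof -
  have f: "(\<Prod>j<m. 1 - p * q ^ 4 * q ^ (2 * Suc j)) * ((1 - p * q ^ 2) * (1 - p * q ^ 4)) =
      (\<Prod>j<m. 1 - p * q ^ (2 * Suc j)) * ((1 - p * q ^ (2 * m + 2)) * (1 - p * q ^ (2 * m + 4)))" for m
  proof (induction m)
    case (Suc m)
    have x: "1 - p * q ^ 4 * q ^ (2 * Suc m) = 1 - p * q ^ (2 * Suc m + 4)" "2 * m + 4 = 2 * Suc m + 2" "2 * m + 2 = 2 * Suc m"
      by (simp_all add: power_add eval_nat_numeral mult_ac)
    have alg: "A * X * B = C * Y * (Z * X)" if "A * B = C * (Y * Z)" for A B C X Y Z :: 'a
      using that by algebra
    show ?case
      unfolding prod.lessThan_Suc x by (rule alg) (use Suc.IH in \<open>simp only: x\<close>)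
  qed (simp add: eval_nat_numeral)
  have g: "(\<Prod>j<m. p * q ^ 4 - q ^ (2 * Suc j)) * ((p * q ^ 2 - q ^ (2 * m + 2)) * (p * q ^ 2 - q ^ (2 * m))) =
      q ^ (4 * m + 2) * ((p * q ^ 2 - 1) * (p - 1)) * (\<Prod>j<m. p - q ^ (2 * Suc j))" for m
  proof (induction m)
    case 0
    show ?case by (simp add: algebra_simps eval_nat_numeral)
  next
    case (Suc m)
    have x: "q ^ (2 * Suc m) = q ^ 2 * q ^ (2 * m)" "q ^ (2 * Suc m + 2) = q ^ 4 * q ^ (2 * m)"
      "q ^ (2 * m + 2) = q ^ 2 * q ^ (2 * m)" "q ^ (4 * Suc m + 2) = q ^ 4 * q ^ (4 * m + 2)"
      by (simp_all add: power_add eval_nat_numeral mult_ac)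
    have alg: "A * (p * q ^ 4 - q ^ 2 * z) * ((p * q ^ 2 - q ^ 4 * z) * (p * q ^ 2 - q ^ 2 * z)) =
        q ^ 4 * w * ((p * q ^ 2 - 1) * (p - 1)) * (B * (p - q ^ 2 * z))"
      if "A * ((p * q ^ 2 - q ^ 2 * z) * (p * q ^ 2 - z)) = w * ((p * q ^ 2 - 1) * (p - 1)) * B" for A B w z :: 'a
      using that by algebra
    show ?case
      unfolding prod.lessThan_Suc x by (rule alg) (use Suc.IH in \<open>simp only: x\<close>)
  qed
  have x: "q ^ (2 * m + 2) = q" "q ^ (2 * m + 4) = q ^ 3" "q ^ (4 * m + 2) = 1" "q * q ^ (2 * m) = 1"
  proof -
    have "2 * m + 2 = (2 * m + 1) + 1" "2 * m + 4 = (2 * m + 1) + 3" "4 * m + 2 = (2 * m + 1) + (2 * m + 1)" by simp_all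
    hence "q ^ (2 * m + 2) = q ^ (2 * m + 1) * q" "q ^ (2 * m + 4) = q ^ (2 * m + 1) * q ^ 3"
      "q ^ (4 * m + 2) = q ^ (2 * m + 1) * q ^ (2 * m + 1)" "q * q ^ (2 * m) = q ^ (2 * m + 1)"
      by (simp_all only: power_add power_one_right mult.commute)
    thus "q ^ (2 * m + 2) = q" "q ^ (2 * m + 4) = q ^ 3" "q ^ (4 * m + 2) = 1" "q * q ^ (2 * m) = 1"
      by (simp_all only: q mult_1_left)
  qed
  have E: "E p = (\<Prod>j<m. p - q ^ (2 * Suc j)) * (\<Prod>j<m. 1 - p * q ^ (2 * Suc j))" for p
    by (simp add: E_def prod.distrib)
  note f = f[of m, unfolded x]
  note g = g[of m, unfolded x]
  have h: "(p * q ^ 2 - q) * (p * q ^ 2 - q ^ (2 * m)) = (1 - p * q) * (1 - p * q ^ 3)"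
  proof -
    have "(p * q ^ 2 - q) * (p * q ^ 2 - z) = (1 - p * q) * (1 - p * q ^ 3)" if "q * z = 1" for z
      using that by algebra
    thus ?thesis using x(4) by blast
  qed
  have alg: "G' * F' * (1 - p * q ^ 4) * ((1 - p * q) * (1 - p * q ^ 3) * (1 - p * q ^ 2)) =
      G * F * (1 - p) * ((1 - p * q) * (1 - p * q ^ 3) * (1 - p * q ^ 2))"
    if "F' * ((1 - p * q ^ 2) * (1 - p * q ^ 4)) = F * ((1 - p * q) * (1 - p * q ^ 3))"
      "G' * ((1 - p * q) * (1 - p * q ^ 3)) = 1 * ((p * q ^ 2 - 1) * (p - 1)) * G" for F F' G G' :: 'a
    using that by algebra
  have "E (p * q ^ 4) * (1 - p * q ^ 4) * ((1 - p * q) * (1 - p * q ^ 3) * (1 - p * q ^ 2)) =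
    E p * (1 - p) * ((1 - p * q) * (1 - p * q ^ 3) * (1 - p * q ^ 2))"
    unfolding E by (rule alg[OF f g[unfolded h]])
  thus ?thesis using p by simp
qed

text \<open>Cleared of denominators, the sum is a polynomial \<open>T\<close> in \<open>p\<close> of degree at most \<open>2 * m\<close>.
  It vanishes at \<open>1 / q\<close> for trivial reasons, and the recurrence \<open>hsum_shift_p\<close> carries this zero to
  all \<open>2 * m + 1\<close> powers of \<open>q\<close>.\<close>

lemma hsum_root_of_unity:
  fixes q a p :: "'a::field"
  assumes inf: "infinite (UNIV :: 'a set)"
    and q: "q ^ (2 * m + 1) = 1" "\<And>j. 0 < j \<Longrightarrow> j < 2 * m + 1 \<Longrightarrow> q ^ j \<noteq> 1" "m > 0"
    and a: "a \<noteq> 0" "\<And>j. a \<noteq> q ^ j" and p: "p \<noteq> 0" "\<And>j. p \<noteq> q ^ j"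
  shows "hsum q a p (Suc m) = 0"
proof -
  define d where "d = 2 * m + 1"
  have qd: "q ^ i = 1 \<longleftrightarrow> d dvd i" for i
    unfolding d_def by (rule power_eq_1_iff_dvd) (use q in auto)
  have d4: "d dvd x" if "d dvd 2 * (2 * x)" for x
  proof -
    have cop: "coprime d 2" by (simp add: d_def)
    from that have "d dvd 2 * x" by (rule iffD1[OF coprime_dvd_mult_right_iff[OF cop]])
    thus ?thesis by (rule iffD1[OF coprime_dvd_mult_right_iff[OF cop]])
  qed
  have q0: "q \<noteq> 0" using q(1) by auto
  \<comment> \<open>Since \<open>q ^ (2 * m)\<close> is the inverse of \<open>q\<close>, the
    negative powers of \<open>q\<close> are among the non-negative ones.\<close>
  have inv_pow: "x * q ^ j \<noteq> 1" if "\<And>j. x \<noteq> q ^ j" for x j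
  proof
    assume "x * q ^ j = 1"
    moreover have "q ^ j * q ^ (2 * m * j) = 1"
      unfolding power_add [symmetric] qd
      using dvd_triv_left[of d j] by (simp add: d_def algebra_simps)
    moreover have "x * (q ^ j * q ^ (2 * m * j)) = (x * q ^ j) * q ^ (2 * m * j)" by (simp only: mult.assoc)
    ultimately have "x = q ^ (2 * m * j)" by simp
    with that show False by blast
  qed
  \<comment> \<open>Here \<open>c k\<close> collects the factors free of \<open>p\<close>,
    \<open>N k\<close> is \<open>p ^ k\<close> times the numerator in \<open>p\<close>, and
    \<open>M k\<close> supplies the factors of \<open>E p\<close> that the denominator of the
    \<open>k\<close>-th term lacks.\<close>
  define c where "c k = (1 - q ^ (6 * k + 1)) * (qpoch (a * q) (q ^ 2) k * qpoch (q / a) (q ^ 2) k * qpoch (q ^ 2) (q ^ 4) k) /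
    (qpoch (q ^ 4) (q ^ 4) k * qpoch (q ^ 4 / a) (q ^ 4) k * qpoch (a * q ^ 4) (q ^ 4) k) * q ^ (2 * k)" for k
  define N where "N k = (\<Prod>j<k. [:1, - (q ^ (4 * j + 1)):] * [:- (q ^ (4 * j + 1)), 1:])" for k
  define M where "M k = (\<Prod>j\<in>{k..<m}. [:- (q ^ (2 * Suc j)), 1:] * [:1, - (q ^ (2 * Suc j)):])" for k
  define T where "T = (\<Sum>k<Suc m. smult (c k) (N k * M k))"
  define E where "E p = (\<Prod>j<m. (p - q ^ (2 * Suc j)) * (1 - p * q ^ (2 * Suc j)))" for p
  have T_eq: "poly T p = hsum q a p (Suc m) * E p" and E_nz: "E p \<noteq> 0"
    if p: "p \<noteq> 0" "\<And>j. p \<noteq> q ^ j" for p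
  proof -
    show E_nz: "E p \<noteq> 0" unfolding E_def using inv_pow[of p] p by (auto simp: prod_zero_iff simp del: mult_Suc_right)
    have "c k * (poly (N k) p * poly (M k) p) = (1 - q ^ (6 * k + 1)) * hterm q a p k * E p" if "k \<le> m" for k
    proof -
      define D where "D = (\<Prod>j<k. (p - q ^ (2 * Suc j)) * (1 - p * q ^ (2 * Suc j)))"
      have Em: "E p = D * poly (M k) p"
      proof -
        have "{..<m} = {..<k} \<union> {k..<m}" "{..<k} \<inter> {k..<m} = {}" using that by auto
        thus ?thesis unfolding E_def D_def M_def poly_prod
          by (simp add: prod.union_disjoint algebra_simps)
      qed
      have D0: "D \<noteq> 0" using E_nz Em by auto
      have pk: "p ^ k = (\<Prod>j<k. p)" by simp
      have e: "q ^ (2 * Suc j) = q ^ 2 * q ^ (2 * j)" "(q ^ 2) ^ j = q ^ (2 * j)" "(q ^ 4) ^ j = q ^ (4 * j)" for j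
        by (simp only: power_add [symmetric] mult_Suc_right, simp_all add: power_mult)
      have "D = p ^ k * (qpoch (q ^ 2 / p) (q ^ 2) k * qpoch (p * q ^ 2) (q ^ 2) k)"
        unfolding D_def qpoch_def pk prod.distrib [symmetric] e using p(1)
        by (intro prod.cong refl) (simp add: field_simps)
      moreover have "poly (N k) p = p ^ k * (qpoch (p * q) (q ^ 4) k * qpoch (q / p) (q ^ 4) k)"
        unfolding N_def qpoch_def poly_prod pk prod.distrib [symmetric] e using p(1)
        by (intro prod.cong refl) (simp add: field_simps)
      ultimately have "poly (N k) p / D = (qpoch (p * q) (q ^ 4) k * qpoch (q / p) (q ^ 4) k) / (qpoch (q ^ 2 / p) (q ^ 2) k * qpoch (p * q ^ 2) (q ^ 2) k)"
        using p(1) by simp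
      hence "(1 - q ^ (6 * k + 1)) * hterm q a p k = c k * (poly (N k) p / D)"
        unfolding hterm_def c_def by (simp add: times_divide_times_eq mult_ac)
      thus ?thesis unfolding Em using D0 by simp
    qed
    thus "poly T p = hsum q a p (Suc m) * E p"
      unfolding T_def hsum_def poly_sum sum_distrib_right by (intro sum.cong) auto
  qed
  have deg: "degree T \<le> 2 * m"
  proof -
    have "degree (N k) \<le> 2 * k" for k
    proof -
      have "degree (N k) \<le> sum (degree \<circ> (\<lambda>j. [:1, - (q ^ (4 * j + 1)):] * [:- (q ^ (4 * j + 1)), 1:])) {..<k}"
        unfolding N_def by (rule degree_prod_sum_le) simp
      also have "\<dots> \<le> sum (\<lambda>_. 2) {..<k}"
        by (intro sum_mono) (auto intro!: order.trans[OF degree_mult_le])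
      finally show ?thesis by simp
    qed
    note degN = this
    have degM: "degree (M k) \<le> 2 * (m - k)" for k
    proof -
      have "degree (M k) \<le> sum (degree \<circ> (\<lambda>j. [:- (q ^ (2 * Suc j)), 1:] * [:1, - (q ^ (2 * Suc j)):])) {k..<m}"
        unfolding M_def by (rule degree_prod_sum_le) simp
      also have "\<dots> \<le> sum (\<lambda>_. 2) {k..<m}"
        by (intro sum_mono) (auto intro!: order.trans[OF degree_mult_le])
      finally show ?thesis by simp
    qed
    have "degree (N k * M k) \<le> 2 * m" if "k \<le> m" for k
      using degree_mult_le[of "N k" "M k"] degN[of k] degM[of k] that by simp
    thus ?thesis unfolding T_def
      by (intro degree_sum_le) (auto intro: order.trans[OF degree_smult_le])
  qed
  \<comment> \<open>For generic \<open>p\<close> this is \<open>hsum_shift_p\<close> combined with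
    the change of \<open>E\<close>. As an identity of polynomials over an infinite field it extends
    to the finitely many excluded values; it is needed at powers of \<open>q\<close>, where the sum
    itself may have poles.\<close>
  have rec: "poly T (p * q ^ 4) * ((1 - p * q ^ 3 / a) * (1 - a * p * q ^ 3)) = (1 - a * p * q) * (1 - p * q / a) * poly T p" for p
  proof -
    define U where "U = pcompose T [:0, q ^ 4:] * ([:1, - (q ^ 3 / a):] * [:1, - (a * q ^ 3):]) - [:1, - (a * q):] * [:1, - (q / a):] * T"
    have U: "poly U p = poly T (p * q ^ 4) * ((1 - p * q ^ 3 / a) * (1 - a * p * q ^ 3)) - (1 - a * p * q) * (1 - p * q / a) * poly T p" for p
      unfolding U_def poly_diff poly_mult poly_pcompose by (simp add: mult_ac)
    have "poly U p = 0" if bad: "p \<noteq> 0" "p \<notin> (\<lambda>j. q ^ j) ` {..<d}" "p \<noteq> a / q ^ 3" "p \<noteq> 1 / (a * q ^ 3)" for p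
    proof -
      have pj: "p \<noteq> q ^ j" for j
      proof -
        have "q ^ j = q ^ (d * (j div d) + j mod d)" by simp
        also have "\<dots> = q ^ (j mod d)" using qd[of d] by (simp only: power_add power_mult) simp
        finally show ?thesis using bad(2) by (auto simp: d_def)
      qed
      have pj': "p * q ^ j \<noteq> 1" for j using inv_pow pj by blast
      have pj4: "p * q ^ 4 \<noteq> q ^ j" for j
      proof
        assume "p * q ^ 4 = q ^ j"
        moreover have "q ^ 4 * q ^ (4 * (2 * m)) = 1" unfolding power_add [symmetric] qd
          using dvd_triv_left[of d 4] by (simp add: d_def algebra_simps)
        moreover have "p * (q ^ 4 * q ^ (4 * (2 * m))) = (p * q ^ 4) * q ^ (4 * (2 * m))" by (simp only: mult.assoc)
        ultimately have "p = q ^ j * q ^ (4 * (2 * m))" by simp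
        thus False using pj[of "j + 4 * (2 * m)"] by (simp add: power_add)
      qed
      have adm: "admissible q a p (Suc m)"
        unfolding admissible_def
      proof (intro conjI allI impI)
        show "q ^ (4 * j) \<noteq> 1" if "0 < j" "j \<le> Suc m" for j
        proof
          assume "q ^ (4 * j) = 1"
          hence "d dvd 2 * (2 * j)" unfolding qd by simp
          hence "d dvd j" by (rule d4)
          thus False using that q(3) by (auto simp: d_def dest!: dvd_imp_le)
        qed
      qed (use q0 a bad inv_pow pj in auto)
      \<comment> \<open>The factor \<open>1 - q ^ (2 * (2 * m + 1))\<close> occurs in
        \<open>(q^2; q^4)_k\<close> as soon as \<open>k > m\<close>.\<close>
      have z: "hterm q a p (Suc m) = 0"
      proof -
        have "q ^ (2 + 4 * m) = 1" unfolding qd using dvd_triv_left[of d 2] by (simp add: d_def algebra_simps)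
        hence "q ^ 2 * (q ^ 4) ^ m = 1" by (simp only: power_add power_mult)
        thus ?thesis using qpoch_eq_0[of m "Suc m" "q ^ 2" "q ^ 4"] by (simp add: hterm_def)
      qed
      have p1: "p \<noteq> 1" using pj[of 0] by simp
      have p2: "p * q \<noteq> 1" "p * q ^ 2 \<noteq> 1" "p * q ^ 3 \<noteq> 1" "p * q ^ 4 \<noteq> 1" using pj'[of 1] pj'[of 2] pj'[of 3] pj'[of 4] by auto
      have p3: "p * q ^ 3 \<noteq> q ^ (4 * j)" for j
        using pj4[of "4 * j + 1"] q0 by (auto simp: eval_nat_numeral mult_ac)
      have w: "a \<noteq> p * q ^ 3" "a * p * q ^ 3 \<noteq> 1" using bad q0 a(1) by (auto simp: field_simps)
      have p40: "p * q ^ 4 \<noteq> 0" using bad(1) q0 by simp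
      note h = hsum_shift_p[OF adm p1 p2(1) p3 w z]
      note e = prod_shift_root_of_unity[OF q(1) p2(1,3,2), folded E_def]
      have alg: "S' * E' * W * ((1 - p) * z) = A * B * (S * E) * ((1 - p) * z)"
        if "S' * ((1 - p) * W) = z * A * B * S" "E' * z = E * (1 - p)" for S S' E E' A B W z :: 'a
      proof -
        have "S' * E' * W * ((1 - p) * z) = (S' * ((1 - p) * W)) * (E' * z)" by (simp only: mult_ac)
        also have "\<dots> = A * B * (S * E) * ((1 - p) * z)" unfolding that by (simp only: mult_ac)
        finally show ?thesis .
      qed
      have "(poly T (p * q ^ 4) * ((1 - p * q ^ 3 / a) * (1 - a * p * q ^ 3))) * ((1 - p) * (1 - p * q ^ 4)) =
         ((1 - a * p * q) * (1 - p * q / a) * poly T p) * ((1 - p) * (1 - p * q ^ 4))"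
        unfolding T_eq[OF bad(1) pj] T_eq[OF p40 pj4] by (rule alg[OF h e])
      thus ?thesis using p1 p2 unfolding U by simp
    qed
    hence "- {x. poly U x = 0} \<subseteq> {0} \<union> (\<lambda>j. q ^ j) ` {..<d} \<union> {a / q ^ 3, 1 / (a * q ^ 3)}" by blast
    hence "finite (- {x. poly U x = 0})" by (rule finite_subset) simp
    hence "infinite {x. poly U x = 0}"
      using inf finite_UnI[of "{x. poly U x = 0}" "- {x. poly U x = 0}"] by (auto simp: Compl_partition)
    hence "U = 0" using poly_roots_finite by blast
    thus ?thesis using U[of p] by simp
  qed
  \<comment> \<open>The starting point \<open>q ^ (2 * m) = 1 / q\<close> kills \<open>N k\<close>
    for \<open>k > 0\<close> through the factor \<open>j = 0\<close>, and \<open>M 0\<close> through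
    the factor \<open>j = m - 1\<close>. Afterwards the factors on the left of \<open>rec\<close>
    are nonzero because \<open>a\<close> is no power of \<open>q\<close>, so the zero is passed
    on.\<close>
  have root: "poly T (q ^ (2 * m + 4 * i)) = 0" for i
  proof (induction i)
    case 0
    have q1: "q * q ^ (2 * m) = 1" using q(1) by simp
    have "poly (N k) (q ^ (2 * m)) * poly (M k) (q ^ (2 * m)) = 0" for k
    proof (cases "k = 0")
      case True
      have "poly ([:- (q ^ (2 * Suc (m - 1))), 1:] * [:1, - (q ^ (2 * Suc (m - 1))):]) (q ^ (2 * m)) = 0"
        using q(3) by (simp add: Suc_pred' [symmetric] del: mult_Suc_right power_Suc mult_pCons_left)
      hence "poly (M 0) (q ^ (2 * m)) = 0"
        unfolding M_def poly_prod using q(3) by (intro prod_zero bexI[of _ "m - 1"]) simp_all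
      thus ?thesis using True by simp
    next
      case False
      have "poly (N k) (q ^ (2 * m)) = 0"
        unfolding N_def poly_prod using False q1 by (auto simp: prod_zero_iff mult_ac intro!: bexI[of _ 0])
      thus ?thesis by simp
    qed
    thus ?case unfolding T_def poly_sum poly_smult poly_mult by (intro sum.neutral) simp
  next
    case (Suc i)
    define x where "x = q ^ (2 * m + 4 * i)"
    have x4: "q ^ (2 * m + 4 * Suc i) = x * q ^ 4" by (simp add: x_def power_add [symmetric] add_ac)
    have xj: "x * q ^ 3 = q ^ (2 * m + 4 * i + 3)" by (simp add: x_def power_add)
    have "x * q ^ 3 / a \<noteq> 1" unfolding xj using a(1) a(2)[of "2 * m + 4 * i + 3"] by (auto simp: divide_eq_eq)
    moreover have "a * x * q ^ 3 \<noteq> 1" unfolding mult.assoc xj using inv_pow a by blast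
    ultimately show ?case unfolding x4 using rec[of x] Suc a(1) unfolding x_def by auto
  qed
  have "T = 0"
  proof (rule ccontr)
    assume "T \<noteq> 0"
    \<comment> \<open>The exponents advance by 4, which is prime to the odd order
      \<open>d\<close>.\<close>
    have inj: "inj_on (\<lambda>i. q ^ (2 * m + 4 * i)) {..<d}"
    proof (rule linorder_inj_onI)
      fix i j assume ij: "i < j" "i \<in> {..<d}" "j \<in> {..<d}"
      show "q ^ (2 * m + 4 * i) \<noteq> q ^ (2 * m + 4 * j)"
      proof
        assume "q ^ (2 * m + 4 * i) = q ^ (2 * m + 4 * j)"
        moreover have "q ^ (2 * m + 4 * j) = q ^ (2 * m + 4 * i) * q ^ (4 * (j - i))"
        proof -
          have "2 * m + 4 * j = (2 * m + 4 * i) + 4 * (j - i)" using ij by simp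
          from arg_cong[OF this, of "\<lambda>i. q ^ i"] show ?thesis by (simp only: power_add)
        qed
        ultimately have "q ^ (4 * (j - i)) = 1" using q0 by simp
        hence "d dvd 2 * (2 * (j - i))" unfolding qd by simp
        hence "d dvd j - i" by (rule d4)
        thus False using ij by (auto dest!: dvd_imp_le)
      qed
    qed auto
    have "d = card ((\<lambda>i. q ^ (2 * m + 4 * i)) ` {..<d})" using inj by (simp add: card_image)
    also have "\<dots> \<le> card {x. poly T x = 0}"
      using root by (intro card_mono poly_roots_finite \<open>T \<noteq> 0\<close>) auto
    also have "\<dots> \<le> degree T" by (rule card_poly_roots_bound) fact
    finally show False using deg by (simp add: d_def)
  qed
  thus ?thesis using T_eq[OF p] E_nz[OF p] by simp
qed

subsection \<open>Specialising fractions along ring homomorphisms\<close>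

definition is_hom :: "('r::comm_ring_1 \<Rightarrow> 's::comm_ring_1) \<Rightarrow> bool" where
  "is_hom h \<longleftrightarrow> h 1 = 1 \<and> (\<forall>x y. h (x + y) = h x + h y) \<and> (\<forall>x y. h (x * y) = h x * h y)"

lemma is_homD:
  assumes "is_hom h"
  shows "h 1 = 1" "h (x + y) = h x + h y" "h (x * y) = h x * h y" "h 0 = 0" "h (- x) = - h x"
    "h (x - y) = h x - h y"
proof -
  show 1: "h 1 = 1" "h (x + y) = h x + h y" "h (x * y) = h x * h y" for x y
    using assms by (auto simp: is_hom_def)
  show 0: "h 0 = 0" using 1(2)[of 0 0] by simp
  show 2: "h (- x) = - h x" for x using 1(2)[of x "- x"] 0 by (simp add: eq_neg_iff_add_eq_0 add.commute)
  show "h (x - y) = h x - h y" using 1(2)[of x "- y"] 2[of y] by simp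
qed

definition poly_ext :: "('r::comm_ring_1 \<Rightarrow> 's::comm_ring_1) \<Rightarrow> 's \<Rightarrow> 'r poly \<Rightarrow> 's" where
  "poly_ext h w p = poly (map_poly h p) w"

lemma poly_ext_pCons: "is_hom h \<Longrightarrow> poly_ext h w (pCons c p) = h c + w * poly_ext h w p"
  by (simp add: poly_ext_def map_poly_pCons is_homD)

lemma poly_ext_0 [simp]: "poly_ext h w 0 = 0"
  by (simp add: poly_ext_def)

lemma is_hom_poly_ext:
  assumes "is_hom h"
  shows "is_hom (poly_ext h w)"
proof -
  note e = poly_ext_pCons[OF assms]
  have add: "poly_ext h w (p + r) = poly_ext h w p + poly_ext h w r" for p r
    by (induction p r rule: poly_induct2) (simp_all add: e is_homD[OF assms] algebra_simps)
  have smult: "poly_ext h w (smult c p) = h c * poly_ext h w p" for c p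
    by (induction p) (simp_all add: e is_homD[OF assms] algebra_simps)
  have "poly_ext h w (p * r) = poly_ext h w p * poly_ext h w r" for p r
    by (induction p) (simp_all add: e add smult is_homD[OF assms] algebra_simps)
  moreover have "poly_ext h w 1 = 1" using e[of w 1 0] by (simp add: is_homD[OF assms] one_pCons)
  ultimately show ?thesis using add by (simp add: is_hom_def)
qed

text \<open>The extension of \<open>\<phi>\<close> to the fractions that have a denominator outside
  its kernel. As a relation it gives no value to the other fractions, so the mere existence of a
  value records that \<open>x\<close> is defined at \<open>\<phi>\<close>.\<close>

definition spec :: "('r::idom \<Rightarrow> 'f::field) \<Rightarrow> 'r fract \<Rightarrow> 'f \<Rightarrow> bool" where
  "spec \<phi> x y \<longleftrightarrow> (\<exists>N D. \<phi> D \<noteq> 0 \<and> x = Fract N D \<and> y = \<phi> N / \<phi> D)"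

context
  fixes \<phi> :: "'r::idom \<Rightarrow> 'f::field"
  assumes hom: "is_hom \<phi>"
begin

lemma spec_Fract: "spec \<phi> (Fract N 1) (\<phi> N)"
  unfolding spec_def by (rule exI[of _ N], rule exI[of _ 1]) (simp add: is_homD[OF hom])

lemma hom_nonzeroD: "\<phi> D \<noteq> 0 \<Longrightarrow> D \<noteq> 0"
  using is_homD(4)[OF hom] by auto

lemma spec_1: "spec \<phi> 1 1"
  using spec_Fract[of 1] by (simp add: One_fract_def is_homD[OF hom])

lemma spec_0: "spec \<phi> 0 0"
  using spec_Fract[of 0] by (simp add: Zero_fract_def is_homD[OF hom])

lemma spec_add: "spec \<phi> x y \<Longrightarrow> spec \<phi> x' y' \<Longrightarrow> spec \<phi> (x + x') (y + y')"
  unfolding spec_def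
proof (elim exE conjE)
  fix N D N' D' assume "\<phi> D \<noteq> 0" "x = Fract N D" "y = \<phi> N / \<phi> D" "\<phi> D' \<noteq> 0" "x' = Fract N' D'" "y' = \<phi> N' / \<phi> D'"
  thus "\<exists>N D. \<phi> D \<noteq> 0 \<and> x + x' = Fract N D \<and> y + y' = \<phi> N / \<phi> D"
    by (intro exI[of _ "N * D' + N' * D"] exI[of _ "D * D'"])
       (auto simp: is_homD[OF hom] hom_nonzeroD field_simps)
qed

lemma spec_mult: "spec \<phi> x y \<Longrightarrow> spec \<phi> x' y' \<Longrightarrow> spec \<phi> (x * x') (y * y')"
  unfolding spec_def
proof (elim exE conjE)
  fix N D N' D' assume "\<phi> D \<noteq> 0" "x = Fract N D" "y = \<phi> N / \<phi> D" "\<phi> D' \<noteq> 0" "x' = Fract N' D'" "y' = \<phi> N' / \<phi> D'"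
  thus "\<exists>N D. \<phi> D \<noteq> 0 \<and> x * x' = Fract N D \<and> y * y' = \<phi> N / \<phi> D"
    by (intro exI[of _ "N * N'"] exI[of _ "D * D'"]) (auto simp: is_homD[OF hom])
qed

lemma spec_inverse: "spec \<phi> x y \<Longrightarrow> y \<noteq> 0 \<Longrightarrow> spec \<phi> (inverse x) (inverse y)"
  unfolding spec_def
proof (elim exE conjE)
  fix N D assume "\<phi> D \<noteq> 0" "x = Fract N D" "y = \<phi> N / \<phi> D" "y \<noteq> 0"
  thus "\<exists>N D. \<phi> D \<noteq> 0 \<and> inverse x = Fract N D \<and> inverse y = \<phi> N / \<phi> D"
    by (intro exI[of _ D] exI[of _ N]) auto
qed

lemma spec_minus: "spec \<phi> x y \<Longrightarrow> spec \<phi> (- x) (- y)"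
  using spec_mult[OF spec_Fract[of "- 1"], of x y]
  by (simp add: is_homD[OF hom] One_fract_def[symmetric] minus_fract[symmetric] del: minus_fract)

lemma spec_diff: "spec \<phi> x y \<Longrightarrow> spec \<phi> x' y' \<Longrightarrow> spec \<phi> (x - x') (y - y')"
  using spec_add[OF _ spec_minus, of x y x' y'] by simp

lemma spec_divide: "spec \<phi> x y \<Longrightarrow> spec \<phi> x' y' \<Longrightarrow> y' \<noteq> 0 \<Longrightarrow> spec \<phi> (x / x') (y / y')"
  unfolding divide_inverse by (intro spec_mult spec_inverse)

lemma spec_power: "spec \<phi> x y \<Longrightarrow> spec \<phi> (x ^ n) (y ^ n)"
  by (induction n) (auto intro: spec_1 spec_mult)

lemma spec_sum: "(\<And>i. i \<in> A \<Longrightarrow> spec \<phi> (f i) (g i)) \<Longrightarrow> spec \<phi> (sum f A) (sum g A)"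
  by (induction A rule: infinite_finite_induct) (auto intro: spec_0 spec_add)

lemma spec_prod: "(\<And>i. i \<in> A \<Longrightarrow> spec \<phi> (f i) (g i)) \<Longrightarrow> spec \<phi> (prod f A) (prod g A)"
  by (induction A rule: infinite_finite_induct) (auto intro: spec_1 spec_mult)

lemma spec_qpoch: "spec \<phi> x y \<Longrightarrow> spec \<phi> q r \<Longrightarrow> spec \<phi> (qpoch x q n) (qpoch y r n)"
  unfolding qpoch_def by (intro spec_prod spec_diff spec_1 spec_mult spec_power)

text \<open>Cross-multiplication with the representation witnessing \<open>spec\<close>; the
  argument covers every representation of the fraction, also one with
  \<open>\<phi> D = 0\<close>.\<close>

lemma spec_imp_numerator_0:
  assumes "spec \<phi> (Fract N D) 0" "D \<noteq> 0"
  shows "\<phi> N = 0"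
proof -
  obtain N' D' where *: "\<phi> D' \<noteq> 0" "Fract N D = Fract N' D'" "0 = \<phi> N' / \<phi> D'"
    using assms(1) by (auto simp: spec_def)
  hence "N * D' = N' * D" using assms(2) hom_nonzeroD by (simp add: eq_fract)
  hence "\<phi> N * \<phi> D' = \<phi> N' * \<phi> D" by (metis is_homD(3)[OF hom])
  thus ?thesis using * by simp
qed

end

text \<open>The common kernel of the family is the principal ideal of \<open>P\<close>, so that
  divisibility by \<open>P\<close> becomes vanishing of values in a field.\<close>

definition cuts_out :: "('r::comm_ring_1 \<Rightarrow> 'f::field) set \<Rightarrow> 'r \<Rightarrow> bool" where
  "cuts_out \<Phi> P \<longleftrightarrow> (\<forall>\<phi>\<in>\<Phi>. is_hom \<phi>) \<and> (\<forall>N. (\<forall>\<phi>\<in>\<Phi>. \<phi> N = 0) \<longleftrightarrow> P dvd N)"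

text \<open>Once the first family gives \<open>N = P * M\<close>, a member of the second that does
  not kill \<open>P\<close> must kill \<open>M\<close>. Nonvanishing of the \<open>\<psi> P\<close>
  thus plays the part of coprimality.\<close>

lemma cuts_out_mult:
  assumes "cuts_out \<Phi> P" "cuts_out \<Psi> Q" "\<And>\<psi>. \<psi> \<in> \<Psi> \<Longrightarrow> \<psi> P \<noteq> 0"
  shows "cuts_out (\<Phi> \<union> \<Psi>) (P * Q)"
  unfolding cuts_out_def
proof (intro conjI ballI allI)
  show hom: "is_hom \<phi>" if "\<phi> \<in> \<Phi> \<union> \<Psi>" for \<phi> using assms that by (auto simp: cuts_out_def)
  fix N
  show "(\<forall>\<phi>\<in>\<Phi> \<union> \<Psi>. \<phi> N = 0) \<longleftrightarrow> P * Q dvd N"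
  proof
    assume *: "\<forall>\<phi>\<in>\<Phi> \<union> \<Psi>. \<phi> N = 0"
    hence "P dvd N" using assms(1) by (auto simp: cuts_out_def)
    then obtain M where M: "N = P * M" by auto
    have "\<psi> M = 0" if "\<psi> \<in> \<Psi>" for \<psi>
    proof -
      have "\<psi> P * \<psi> M = 0" using * that hom[of \<psi>] unfolding M by (metis UnI2 is_homD(3))
      thus ?thesis using assms(3)[OF that] by simp
    qed
    hence "Q dvd M" using assms(2) by (auto simp: cuts_out_def)
    thus "P * Q dvd N" unfolding M by (rule mult_dvd_mono[OF dvd_refl])
  next
    assume "P * Q dvd N"
    hence "P dvd N" "Q dvd N" by (auto dest: dvd_mult_left dvd_mult_right)
    thus "\<forall>\<phi>\<in>\<Phi> \<union> \<Psi>. \<phi> N = 0" using assms(1,2) by (auto simp: cuts_out_def)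
  qed
qed

text \<open>Let \<open>c\<close> divide \<open>D\<close> and \<open>P = c * e\<close>. Then
  \<open>\<phi> c\<close> is nonzero and \<open>\<phi> P\<close> is zero, so every
  \<open>\<phi>\<close> kills \<open>e\<close>. Hence \<open>P\<close> divides its own cofactor
  \<open>e\<close>, and \<open>c\<close> is a unit.\<close>

lemma cuts_out_coprime:
  fixes P D :: "'r::{idom_divide,algebraic_semidom}"
  assumes "cuts_out \<Phi> P" "P \<noteq> 0" "\<And>\<phi>. \<phi> \<in> \<Phi> \<Longrightarrow> \<phi> D \<noteq> 0"
  shows "coprime D P"
proof (rule coprimeI)
  fix c assume "c dvd D" "c dvd P"
  then obtain d e where d: "D = c * d" and e: "P = c * e" by (auto elim!: dvdE)
  have "\<phi> e = 0" if "\<phi> \<in> \<Phi>" for \<phi>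
  proof -
    have h: "is_hom \<phi>" and "\<phi> P = 0" using assms(1) that by (auto simp: cuts_out_def)
    thus ?thesis using assms(3)[OF that] by (simp add: d e is_homD)
  qed
  hence "P dvd e" using assms(1) by (auto simp: cuts_out_def)
  then obtain f where f: "e = P * f" by auto
  have "P * 1 = P * (c * f)" using e unfolding f by (simp add: mult_ac)
  hence "1 = c * f" using assms(2) by (simp only: mult_cancel_left) auto
  thus "is_unit c" by (metis dvd_triv_left)
qed

text \<open>Denominators in lowest terms divide every other denominator, hence specialise to something
  nonzero at each homomorphism at which the fraction is defined.\<close>

lemma lowest_terms_coprime:
  fixes P :: "'r::{idom_divide,ring_gcd}"
  assumes cut: "cuts_out \<Phi> P" and "P \<noteq> 0" and X: "\<And>\<phi>. \<phi> \<in> \<Phi> \<Longrightarrow> \<exists>v. spec \<phi> X v"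
  shows "\<exists>N D. D \<noteq> 0 \<and> X = Fract N D \<and> coprime D P"
proof -
  obtain N0 D0 where X0: "X = Fract N0 D0" "D0 \<noteq> 0" by (cases X) auto
  then obtain N D where ND: "N0 = N * gcd N0 D0" "D0 = D * gcd N0 D0" "coprime N D"
    using gcd_coprime_exists[of N0 D0] by auto
  have D0: "D \<noteq> 0" using ND X0 by auto
  have X1: "X = Fract N D" unfolding X0(1) using X0(2) D0 ND(1,2) by (simp add: eq_fract) (metis mult.assoc mult.commute)
  have "\<phi> D \<noteq> 0" if phi: "\<phi> \<in> \<Phi>" for \<phi>
  proof -
    have h: "is_hom \<phi>" using cut phi by (auto simp: cuts_out_def)
    obtain N' D' where *: "\<phi> D' \<noteq> 0" "X = Fract N' D'" using X[OF phi] by (auto simp: spec_def)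
    hence "N * D' = N' * D" using X1 D0 hom_nonzeroD[OF h] by (simp add: eq_fract)
    hence "D dvd N * D'" by simp
    hence "D dvd D'" using ND(3) by (metis coprime_commute coprime_dvd_mult_right_iff)
    thus ?thesis using * by (auto simp: is_homD[OF h] elim!: dvdE)
  qed
  thus ?thesis using cuts_out_coprime[OF cut \<open>P \<noteq> 0\<close>] X1 D0 by blast
qed

text \<open>The existence of values gives the coprime denominators of \<open>X\<close>,
  \<open>Y\<close> and \<open>X - Y\<close>; their equality gives the divisibility of the
  numerator.\<close>

lemma ratfun_cong_by_specialisation:
  fixes P :: "'r::{idom_divide,ring_gcd}"
  assumes cut: "cuts_out \<Phi> P" and "P \<noteq> 0" and "M = Fract P 1"
    and XY: "\<And>\<phi>. \<phi> \<in> \<Phi> \<Longrightarrow> \<exists>v. spec \<phi> X v \<and> spec \<phi> Y v"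
  shows "ratfun_cong X Y M"
  unfolding ratfun_cong_def
proof (rule exI[of _ P], intro conjI)
  show "den_coprime X P" "den_coprime Y P"
    unfolding den_coprime_def using XY by (auto intro!: lowest_terms_coprime[OF cut \<open>P \<noteq> 0\<close>])
  have h: "is_hom \<phi>" if "\<phi> \<in> \<Phi>" for \<phi> using cut that by (auto simp: cuts_out_def)
  have 0: "spec \<phi> (X - Y) 0" if "\<phi> \<in> \<Phi>" for \<phi>
    using XY[OF that] spec_diff[OF h[OF that]] by force
  then obtain N D where ND: "D \<noteq> 0" "X - Y = Fract N D" "coprime D P"
    using lowest_terms_coprime[OF cut \<open>P \<noteq> 0\<close>, of "X - Y"] by blast
  have "\<forall>\<phi>\<in>\<Phi>. \<phi> N = 0" using 0 spec_imp_numerator_0[OF h] ND(1,2) by metis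
  hence "P dvd N" using cut by (auto simp: cuts_out_def)
  thus "\<exists>N D. D \<noteq> 0 \<and> X - Y = Fract N D \<and> P dvd N \<and> coprime D P" using ND by blast
qed fact

subsection \<open>Homomorphisms cutting out the factors of the modulus\<close>

lemma hom_power: "is_hom h \<Longrightarrow> h (x ^ n) = h x ^ n"
  by (induction n) (simp_all add: is_homD)

lemma hom_sum: "is_hom h \<Longrightarrow> h (sum f A) = (\<Sum>i\<in>A. h (f i))"
  by (induction A rule: infinite_finite_induct) (simp_all add: is_homD)

lemma const_poly_power: "[:c:] ^ n = [:c ^ n :: 'a::comm_semiring_1:]"
  by (induction n) (simp_all add: one_pCons mult_ac)

lemma poly_ext_hom_value: "is_hom h \<Longrightarrow> poly_ext h (h t) p = h (poly p t)"
  by (induction p) (simp_all add: poly_ext_pCons is_homD)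

section \<open>Factor theorems for \<open>x - t\<close> and \<open>1 - t * x\<close>\<close>

lemma poly_ext_eq_0_iff_dvd:
  assumes "is_hom h" "\<And>c. h c = 0 \<Longrightarrow> c = 0"
  shows "poly_ext h (h t) p = 0 \<longleftrightarrow> [:- t, 1:] dvd p"
  using assms is_homD(4)[OF assms(1)] by (auto simp: poly_ext_hom_value poly_eq_0_iff_dvd [symmetric])

text \<open>From \<open>t * p = (1 - t * x) * s\<close> follows \<open>s = t * (p + x * s)\<close>;
  so \<open>s\<close> is divisible by \<open>t\<close>, and \<open>t\<close> can be
  cancelled.\<close>

lemma dvd_smult_imp_dvd:
  fixes p :: "'a::idom poly"
  assumes "[:1, - t:] dvd smult t p" "t \<noteq> 0"
  shows "[:1, - t:] dvd p"
proof -
  obtain s where s: "smult t p = [:1, - t:] * s" using assms(1) by (auto elim: dvdE)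
  have s': "s = smult t (p + pCons 0 s)" using s by (simp add: smult_add_right)
  have "smult t p = smult t ([:1, - t:] * (p + pCons 0 s))"
    using s s' by (metis mult_smult_right)
  hence "p = [:1, - t:] * (p + pCons 0 s)"
    using assms(2) by (metis smult_cancel)
  thus ?thesis by (metis dvd_triv_left)
qed

text \<open>The divisor \<open>1 - t * x\<close> has leading coefficient \<open>- t\<close>; a power
  of \<open>t\<close> makes division with a constant remainder possible over the coefficient
  ring.\<close>

lemma pseudo_division_inverse_root:
  fixes p :: "'a::idom poly"
  shows "\<exists>k s r. smult (t ^ k) p = [:1, - t:] * s + [:r:]"
proof (induction p)
  case 0
  show ?case by (intro exI[of _ 0]) simp
next
  case (pCons c p)
  then obtain k s r where IH: "smult (t ^ k) p = [:1, - t:] * s + [:r:]" by blast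
  have "smult (t ^ Suc k) (pCons c p) = [:t ^ Suc k * c:] + [:0, t:] * smult (t ^ k) p"
    by (simp add: mult_ac)
  \<comment> \<open>The remainder is carried along by
    \<open>t * x * r = r - (1 - t * x) * r\<close>.\<close>
  also have "\<dots> = [:1, - t:] * ([:0, t:] * s - [:r:]) + [:t ^ Suc k * c + r:]"
    unfolding IH by (simp add: algebra_simps)
  finally show ?case by blast
qed

text \<open>This serves the factors \<open>1 - a * q ^ n\<close> and \<open>1 - b * q ^ n\<close>,
  which are not monic in \<open>a\<close> or \<open>b\<close>. Pseudo-division leaves a remainder
  killed by the injective \<open>h\<close>, and the power of \<open>t\<close> is then removed one
  factor at a time.\<close>

lemma poly_ext_inverse_eq_0_iff_dvd:
  fixes h :: "'a::idom \<Rightarrow> 'b::field"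
  assumes h: "is_hom h" "\<And>c. h c = 0 \<Longrightarrow> c = 0" and w: "w * h t = 1"
  shows "poly_ext h w p = 0 \<longleftrightarrow> [:1, - t:] dvd p"
proof -
  note e = is_homD[OF is_hom_poly_ext[OF h(1)]]
  have z: "poly_ext h w [:1, - t:] = 0" and c: "poly_ext h w [:r:] = h r" for r
    using w by (simp_all add: poly_ext_pCons h(1) is_homD[OF h(1)])
  have t0: "t \<noteq> 0" using w is_homD(4)[OF h(1)] by auto
  show ?thesis
  proof
    assume "[:1, - t:] dvd p"
    thus "poly_ext h w p = 0" by (auto simp: e z elim!: dvdE simp del: mult_pCons_left)
  next
    assume p: "poly_ext h w p = 0"
    obtain k s r where *: "smult (t ^ k) p = [:1, - t:] * s + [:r:]"
      using pseudo_division_inverse_root by blast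
    have "poly_ext h w ([:t ^ k:] * p) = poly_ext h w ([:1, - t:] * s + [:r:])" using * by simp
    hence "h r = 0" by (simp only: e z c p) simp
    hence "r = 0" by (rule h(2))
    hence "[:1, - t:] dvd smult (t ^ k) p" unfolding * by (simp only: pCons_0_0 add_0_right dvd_triv_left)
    thus "[:1, - t:] dvd p"
    proof (induction k)
      case (Suc k)
      have "[:1, - t:] dvd smult t (smult (t ^ k) p)" using Suc.prems by simp
      thus ?case using dvd_smult_imp_dvd t0 Suc.IH by blast
    qed simp
  qed
qed

text \<open>The variable stays transcendental, and passing to the fraction field makes the target a
  field again. The kernel can therefore be read off coefficientwise.\<close>

definition adjoin :: "('r::comm_ring_1 \<Rightarrow> 'k::field) \<Rightarrow> 'r poly \<Rightarrow> 'k poly fract" where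
  "adjoin g = poly_ext (\<lambda>c. Fract [:g c:] 1) (Fract [:0, 1:] 1)"

lemma is_hom_const_Fract: "is_hom g \<Longrightarrow> is_hom (\<lambda>c. Fract [:g c :: 'k::field:] 1)"
  by (simp add: is_hom_def one_pCons [symmetric] One_fract_def mult.commute)

lemma is_hom_adjoin: "is_hom g \<Longrightarrow> is_hom (adjoin g)"
  unfolding adjoin_def by (intro is_hom_poly_ext is_hom_const_Fract)

lemma adjoin_eq: "is_hom g \<Longrightarrow> adjoin g N = Fract (map_poly g N) 1"
proof (induction N)
  case 0
  show ?case by (simp add: adjoin_def Zero_fract_def)
next
  case (pCons c N)
  have "adjoin g (pCons c N) = Fract [:g c:] 1 + Fract [:0, 1:] 1 * adjoin g N"
    unfolding adjoin_def by (rule poly_ext_pCons[OF is_hom_const_Fract[OF pCons.prems]])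
  thus ?case using pCons by (simp add: map_poly_pCons is_homD)
qed

lemma adjoin_const: "is_hom g \<Longrightarrow> adjoin g [:c:] = Fract [:g c:] 1"
  by (simp add: adjoin_eq map_poly_pCons is_homD)

lemma adjoin_var: "is_hom g \<Longrightarrow> adjoin g [:0, 1:] = Fract [:0, 1:] 1"
  by (simp add: adjoin_eq map_poly_pCons is_homD)

lemma Fract_1_eq_0_iff: "Fract p 1 = 0 \<longleftrightarrow> p = 0"
  by (simp add: Zero_fract_def eq_fract)

lemma adjoin_eq_0_iff: "is_hom g \<Longrightarrow> adjoin g N = 0 \<longleftrightarrow> (\<forall>i. g (coeff N i) = 0)"
  by (simp add: adjoin_eq Fract_1_eq_0_iff poly_eq_iff coeff_map_poly is_homD)

lemma adjoin_inj: "is_hom g \<Longrightarrow> (\<And>c. g c = 0 \<Longrightarrow> c = 0) \<Longrightarrow> adjoin g N = 0 \<Longrightarrow> N = 0"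
  by (auto simp: adjoin_eq_0_iff poly_eq_iff)

lemma is_hom_of_rat: "is_hom (of_rat :: rat \<Rightarrow> complex)"
  by (simp add: is_hom_def of_rat_add of_rat_mult)

section \<open>The common target field and the three kinds of specialisation\<close>

type_synonym funfield = "complex poly fract poly fract"

definition fx :: "complex poly fract" where "fx = Fract [:0, 1:] 1"
definition fX :: funfield where "fX = Fract [:fx:] 1"
definition fY :: funfield where "fY = Fract [:0, 1:] 1"
definition fC :: "complex \<Rightarrow> funfield" where "fC c = Fract [:Fract [:c:] 1:] 1"

text \<open>All specialisations share one target, the rational functions in two indeterminates over
  the complex numbers, so that they can form one set. For \<open>hom_q\<close> the indeterminates
  are the images of \<open>a\<close> and \<open>b\<close>; for \<open>hom_a\<close> and
  \<open>hom_b\<close> they are those of \<open>q\<close> and of the parameter left free.\<close>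

definition hom_q :: "complex \<Rightarrow> pol_qab \<Rightarrow> funfield" where
  "hom_q z = adjoin (adjoin (poly_ext of_rat z))"
definition hom_a :: "complex poly fract \<Rightarrow> pol_qab \<Rightarrow> funfield" where
  "hom_a w = adjoin (poly_ext (adjoin of_rat) w)"
definition hom_b :: "funfield \<Rightarrow> pol_qab \<Rightarrow> funfield" where
  "hom_b w = poly_ext (adjoin (adjoin of_rat)) w"

abbreviation (input) "var_q \<equiv> [:[:[:0, 1:]:]:] :: pol_qab"
abbreviation (input) "var_a \<equiv> [:[:0, 1:]:] :: pol_qab"
abbreviation (input) "var_b \<equiv> [:0, 1:] :: pol_qab"

lemma hom_q: "is_hom (hom_q z)" "hom_q z var_q = fC z" "hom_q z var_a = fX" "hom_q z var_b = fY"
proof -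
  note h = is_hom_poly_ext[OF is_hom_of_rat, of z]
  show "is_hom (hom_q z)" unfolding hom_q_def by (intro is_hom_adjoin h)
  show "hom_q z var_q = fC z" "hom_q z var_a = fX" "hom_q z var_b = fY"
    unfolding hom_q_def
    by (simp_all add: adjoin_const adjoin_var is_hom_adjoin h fC_def fX_def fx_def fY_def
      poly_ext_pCons is_hom_of_rat)
qed

lemma hom_a: "is_hom (hom_a w)" "hom_a w var_q = fX" "hom_a w var_a = Fract [:w:] 1" "hom_a w var_b = fY"
proof -
  note h = is_hom_adjoin[OF is_hom_of_rat]
  show "is_hom (hom_a w)" unfolding hom_a_def by (intro is_hom_adjoin is_hom_poly_ext is_hom_of_rat)
  show "hom_a w var_q = fX" "hom_a w var_a = Fract [:w:] 1" "hom_a w var_b = fY"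
    unfolding hom_a_def
    by (simp_all add: adjoin_const adjoin_var is_hom_poly_ext h fX_def fx_def fY_def
      poly_ext_pCons is_hom_of_rat is_homD[OF h])
qed

lemma hom_b: "is_hom (hom_b w)" "hom_b w var_q = fX" "hom_b w var_a = fY" "hom_b w var_b = w"
proof -
  note h = is_hom_adjoin[OF is_hom_adjoin[OF is_hom_of_rat]]
  show "is_hom (hom_b w)" unfolding hom_b_def by (intro is_hom_poly_ext h)
  show "hom_b w var_q = fX" "hom_b w var_a = fY" "hom_b w var_b = w"
    unfolding hom_b_def
    by (simp_all add: adjoin_const adjoin_var is_hom_poly_ext h fX_def fx_def fY_def
      poly_ext_pCons is_hom_of_rat is_hom_adjoin is_homD[OF h])
qed

lemma fX_fY_monomial: "fC c * fX ^ i * fY ^ j = Fract (monom (Fract (monom c i) 1) j) 1"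
proof -
  have p: "Fract p 1 ^ k = Fract (p ^ k) 1" for p :: "'z::idom" and k
    by (induction k) (simp_all add: One_fract_def)
  have x: "[:0, 1:] ^ k = monom (1::'z::idom) k" for k by (simp add: monom_altdef)
  have c: "[:d:] ^ k = [:d ^ k :: 'z::idom:]" for d k by (induction k) (simp_all add: one_pCons mult_ac)
  show ?thesis
    unfolding fC_def fX_def fY_def fx_def p c x by (simp add: smult_monom)
qed

text \<open>Comparison of leading monomials in two layers. It underlies the inequations that are
  later required of the specialised \<open>q\<close>, \<open>a\<close> and \<open>b\<close>.\<close>

lemma fX_fY_independent:
  assumes "fC c * fX ^ i * fY ^ j = fC c' * fX ^ k * fY ^ l" "c \<noteq> 0"
  shows "c = c' \<and> i = k \<and> j = l"
proof -
  have "monom (Fract (monom c i) 1) j = monom (Fract (monom c' k) 1) l"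
    using assms(1) unfolding fX_fY_monomial by (simp add: eq_fract)
  moreover have "Fract (monom c i) 1 \<noteq> 0" using assms(2) by (simp add: Fract_1_eq_0_iff)
  ultimately have "j = l" "Fract (monom c i) 1 = Fract (monom c' k) 1"
    by (metis coeff_monom)+
  hence "monom c i = monom c' k" by (simp add: eq_fract)
  hence "c = c'" "i = k" using assms(2) by (metis coeff_monom)+
  with \<open>j = l\<close> show ?thesis by simp
qed

definition qbracket :: "nat \<Rightarrow> rat poly" where
  "qbracket n = (\<Sum>i<n. [:0, 1:] ^ i)"

text \<open>The \<open>n\<close>-th roots of unity other than 1 are \<open>n - 1\<close> distinct
  zeros of \<open>qbracket n\<close>. If \<open>p\<close> vanishes at all of them, so does its
  remainder, whose degree is less than \<open>n - 1\<close>; hence the remainder is zero.\<close>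

lemma qbracket_dvd_iff:
  assumes "n > 0"
  shows "(\<forall>z. z ^ n = 1 \<and> z \<noteq> 1 \<longrightarrow> poly_ext of_rat z p = (0::complex)) \<longleftrightarrow> qbracket n dvd p"
proof -
  note h = is_homD[OF is_hom_poly_ext[OF is_hom_of_rat]]
  have br: "poly_ext of_rat z (qbracket n) = (\<Sum>i<n. z ^ i)" for z :: complex
    unfolding qbracket_def hom_sum[OF is_hom_poly_ext[OF is_hom_of_rat]] hom_power[OF is_hom_poly_ext[OF is_hom_of_rat]]
    by (simp add: poly_ext_pCons is_hom_of_rat)
  have br0: "poly_ext of_rat z (qbracket n) = 0" if "z ^ n = 1" "z \<noteq> 1" for z :: complex
    unfolding br using that by (simp add: sum_gp_strict)
  show ?thesis
  proof
    assume "qbracket n dvd p"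
    thus "\<forall>z. z ^ n = 1 \<and> z \<noteq> 1 \<longrightarrow> poly_ext of_rat z p = (0::complex)"
      using br0 by (auto simp: h elim!: dvdE)
  next
    assume *: "\<forall>z. z ^ n = 1 \<and> z \<noteq> 1 \<longrightarrow> poly_ext of_rat z p = (0::complex)"
    define r where "r = p mod qbracket n"
    have co: "coeff (qbracket n) i = (if i < n then 1 else 0)" for i
      by (simp add: qbracket_def coeff_sum monom_altdef [of 1, simplified, symmetric])
    have q0: "qbracket n \<noteq> 0" using co[of 0] assms by auto
    have dq: "degree (qbracket n) \<le> n - 1" by (rule degree_le) (use co in auto)
    show "qbracket n dvd p"
    proof (rule ccontr)
      assume "\<not> qbracket n dvd p"
      hence r0: "r \<noteq> 0" by (simp add: r_def dvd_eq_mod_eq_0)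
      define s :: "complex poly" where "s = map_poly of_rat r"
      have s0: "s \<noteq> (0 :: complex poly)" using r0 by (simp add: s_def map_poly_eq_0_iff)
      have "degree s \<le> degree r" unfolding s_def by (rule map_poly_degree_leq)
      also have "degree r < n - 1"
        using degree_mod_less[OF q0, of p] r0 dq unfolding r_def by simp
      finally have ds: "degree s < n - 1" .
      have "poly s z = 0" if "z \<in> {z. z ^ n = 1} - {1}" for z
      proof -
        have "p = qbracket n * (p div qbracket n) + r" by (simp add: r_def)
        hence "poly_ext of_rat z p = poly_ext of_rat z (qbracket n) * poly_ext of_rat z (p div qbracket n) + poly_ext of_rat z r"
          by (metis h(2,3))
        thus ?thesis using * br0[of z] that by (simp add: s_def poly_ext_def)
      qed
      hence "{z. z ^ n = 1} - {1} \<subseteq> {z. poly s z = 0}" by blast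
      hence "card ({z::complex. z ^ n = 1} - {1}) \<le> card {z. poly s z = 0}"
        by (rule card_mono[OF poly_roots_finite[OF s0]])
      also have "\<dots> \<le> degree s" using s0 by (rule card_poly_roots_bound)
      also note ds
      finally show False using card_roots_unity_eq[OF assms] finite_roots_unity[of n] assms
        by (simp add: card_Diff_singleton)
    qed
  qed
qed

text \<open>As \<open>a\<close> and \<open>b\<close> stay indeterminate, both vanishing and
  divisibility can be tested on each coefficient in \<open>q\<close> separately.\<close>

lemma cuts_out_hom_q:
  assumes "n > 0"
  shows "cuts_out (hom_q ` {z. z ^ n = 1 \<and> z \<noteq> 1}) [:[:qbracket n:]:]"
  unfolding cuts_out_def
proof (intro conjI allI)
  fix N :: pol_qab
  note h = is_hom_poly_ext[OF is_hom_of_rat]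
  have "(\<forall>\<phi>\<in>hom_q ` {z. z ^ n = 1 \<and> z \<noteq> 1}. \<phi> N = 0) \<longleftrightarrow>
    (\<forall>i j z. z ^ n = 1 \<and> z \<noteq> 1 \<longrightarrow> poly_ext of_rat z (coeff (coeff N i) j) = (0::complex))"
    unfolding hom_q_def by (auto simp: adjoin_eq_0_iff is_hom_adjoin h)
  also have "\<dots> \<longleftrightarrow> [:[:qbracket n:]:] dvd N"
    unfolding qbracket_dvd_iff[OF assms] const_poly_dvd_iff ..
  finally show "(\<forall>\<phi>\<in>hom_q ` {z. z ^ n = 1 \<and> z \<noteq> 1}. \<phi> N = 0) \<longleftrightarrow> [:[:qbracket n:]:] dvd N" .
qed (auto simp: hom_q)

lemma of_rat_inj: "of_rat c = (0::complex) \<Longrightarrow> c = 0"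
  by simp

lemma var_q_power: "var_q ^ n = [:[:[:0, 1:] ^ n:]:]"
  by (simp only: const_poly_power)

lemma cuts_out_hom_a:
  shows "cuts_out {hom_a (fx ^ n)} (var_a - var_q ^ n)"
    and "cuts_out {hom_a (1 / fx ^ n)} (1 - var_a * var_q ^ n)"
proof -
  define g where "g = adjoin (of_rat :: rat \<Rightarrow> complex)"
  have g: "is_hom g" unfolding g_def by (rule is_hom_adjoin[OF is_hom_of_rat])
  have inj: "g c = 0 \<Longrightarrow> c = 0" for c unfolding g_def by (rule adjoin_inj[OF is_hom_of_rat of_rat_inj])
  have gx: "g ([:0, 1:] ^ n) = fx ^ n" for n
    unfolding hom_power[OF g] by (simp add: g_def adjoin_var is_hom_of_rat fx_def)
  have fx0: "fx \<noteq> 0" by (simp add: fx_def Fract_1_eq_0_iff)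
  have "hom_a (fx ^ n) N = 0 \<longleftrightarrow> [:[:- ([:0, 1:] ^ n), 1:]:] dvd N" for N
    unfolding hom_a_def g_def[symmetric] const_poly_dvd_iff gx[symmetric]
    by (subst adjoin_eq_0_iff) (simp_all add: is_hom_poly_ext g poly_ext_eq_0_iff_dvd[OF g inj])
  moreover have "var_a - var_q ^ n = [:[:- ([:0, 1:] ^ n), 1:]:]" unfolding var_q_power by simp
  ultimately show "cuts_out {hom_a (fx ^ n)} (var_a - var_q ^ n)" by (simp add: cuts_out_def hom_a)
  have w: "1 / fx ^ n * g ([:0, 1:] ^ n) = 1" unfolding gx using fx0 by simp
  have "hom_a (1 / fx ^ n) N = 0 \<longleftrightarrow> [:[:1, - ([:0, 1:] ^ n):]:] dvd N" for N
    unfolding hom_a_def g_def[symmetric] const_poly_dvd_iff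
    by (subst adjoin_eq_0_iff) (simp_all add: is_hom_poly_ext g poly_ext_inverse_eq_0_iff_dvd[OF g inj w])
  moreover have "1 - var_a * var_q ^ n = [:[:1, - ([:0, 1:] ^ n):]:]" unfolding var_q_power by (simp add: one_pCons)
  ultimately show "cuts_out {hom_a (1 / fx ^ n)} (1 - var_a * var_q ^ n)" by (simp add: cuts_out_def hom_a)
qed

lemma cuts_out_hom_b:
  shows "cuts_out {hom_b (fX ^ n)} (var_b - var_q ^ n)"
    and "cuts_out {hom_b (1 / fX ^ n)} (1 - var_b * var_q ^ n)"
proof -
  define g where "g = adjoin (adjoin (of_rat :: rat \<Rightarrow> complex))"
  have g: "is_hom g" unfolding g_def by (intro is_hom_adjoin is_hom_of_rat)
  have inj: "g c = 0 \<Longrightarrow> c = 0" for c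
    unfolding g_def by (rule adjoin_inj[OF is_hom_adjoin[OF is_hom_of_rat] adjoin_inj[OF is_hom_of_rat of_rat_inj]])
  have gx: "g [:[:0, 1:] ^ n:] = fX ^ n" for n
    unfolding const_poly_power [symmetric] hom_power[OF g] by (simp add: g_def adjoin_const adjoin_var is_hom_adjoin is_hom_of_rat fx_def fX_def)
  have fX0: "fX \<noteq> 0" by (simp add: fX_def fx_def Fract_1_eq_0_iff)
  have "hom_b (fX ^ n) N = 0 \<longleftrightarrow> [:- [:[:0, 1:] ^ n:], 1:] dvd N" for N
    unfolding hom_b_def g_def[symmetric] gx[symmetric] by (rule poly_ext_eq_0_iff_dvd[OF g inj])
  moreover have "var_b - var_q ^ n = [:- [:[:0, 1:] ^ n:], 1:]" unfolding var_q_power by simp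
  ultimately show "cuts_out {hom_b (fX ^ n)} (var_b - var_q ^ n)" by (simp add: cuts_out_def hom_b)
  have w: "1 / fX ^ n * g [:[:0, 1:] ^ n:] = 1" unfolding gx using fX0 by simp
  have "hom_b (1 / fX ^ n) N = 0 \<longleftrightarrow> [:1, - [:[:0, 1:] ^ n:]:] dvd N" for N
    unfolding hom_b_def g_def[symmetric] by (rule poly_ext_inverse_eq_0_iff_dvd[OF g inj w])
  moreover have "1 - var_b * var_q ^ n = [:1, - [:[:0, 1:] ^ n:]:]" unfolding var_q_power by (simp add: one_pCons)
  ultimately show "cuts_out {hom_b (1 / fX ^ n)} (1 - var_b * var_q ^ n)" by (simp add: cuts_out_def hom_b)
qed

subsection \<open>Specialising both sides of the congruence\<close>

lemma qpoch_add: "qpoch x q (m + k) = qpoch x q m * qpoch (x * q ^ m) q k"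
proof -
  have "qpoch x q (m + k) = qpoch x q m * (\<Prod>j<k. 1 - x * q ^ (m + j))"
    unfolding qpoch_def by (induction k) (simp_all add: mult_ac)
  thus ?thesis by (simp add: qpoch_def power_add mult_ac)
qed

text \<open>Gaussian binomial coefficients by Pascal's rule. The recursion contains no division, so
  they specialise at every \<open>q\<close>, also at roots of unity where the quotient of factorials
  is undefined.\<close>

fun qbinom :: "'a::field \<Rightarrow> nat \<Rightarrow> nat \<Rightarrow> 'a" where
  "qbinom q m 0 = 1"
| "qbinom q 0 (Suc k) = 0"
| "qbinom q (Suc m) (Suc k) = qbinom q m k + q ^ Suc k * qbinom q m (Suc k)"

lemma qbinom_eq_0: "m < k \<Longrightarrow> qbinom q m k = 0"
  by (induction q m k rule: qbinom.induct) auto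

lemma qbinom_qpoch: "k \<le> m \<Longrightarrow> qbinom q m k * qpoch q q k * qpoch q q (m - k) = qpoch q q m"
proof (induction q m k rule: qbinom.induct)
  case (3 q m k)
  show ?case
  proof (cases "k = m")
    case True
    thus ?thesis using "3.IH"(1) by (simp add: qbinom_eq_0 qpoch_Suc) (metis mult.assoc)
  next
    case False
    hence km: "Suc k \<le> m" using 3 by simp
    have IH1: "qbinom q m k * qpoch q q k * qpoch q q (m - k) = qpoch q q m" using "3.IH"(1) km by simp
    have IH2: "qbinom q m (Suc k) * qpoch q q (Suc k) * qpoch q q (m - Suc k) = qpoch q q m" using "3.IH"(2) km by simp
    have mk: "qpoch q q (m - k) = qpoch q q (m - Suc k) * (1 - q ^ (m - k))"
      using km by (cases "m - k") (auto simp: qpoch_Suc Suc_diff_Suc [symmetric])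
    have pw: "q ^ Suc k * q ^ (m - k) = q ^ Suc m" using km by (simp add: power_add [symmetric])
    have "qbinom q (Suc m) (Suc k) * qpoch q q (Suc k) * qpoch q q (Suc m - Suc k) =
       (qbinom q m k * qpoch q q k * qpoch q q (m - k)) * (1 - q ^ Suc k) +
       q ^ Suc k * (1 - q ^ (m - k)) * (qbinom q m (Suc k) * qpoch q q (Suc k) * qpoch q q (m - Suc k))"
      by (simp add: qpoch_Suc [of _ _ k] mk algebra_simps)
    also have "\<dots> = qpoch q q m * (1 - q ^ Suc k * q ^ (m - k))"
      unfolding IH1 IH2 by (simp add: algebra_simps)
    also have "\<dots> = qpoch q q (Suc m)" unfolding pw by (simp add: qpoch_Suc)
    finally show ?thesis .
  qed
qed simp_all

lemma qpoch_double: "qpoch q q (2 * k) = qpoch q (q ^ 2) k * qpoch (q ^ 2) (q ^ 2) k"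
proof (induction k)
  case (Suc k)
  have "qpoch q q (2 * Suc k) = qpoch q q (2 * k) * ((1 - q * (q ^ 2) ^ k) * (1 - q ^ 2 * (q ^ 2) ^ k))"
    by (simp add: qpoch_Suc power_mult) (simp add: power2_eq_square mult_ac)
  thus ?case unfolding Suc.IH by (simp add: qpoch_Suc mult_ac)
qed simp

lemma qpoch_square: "qpoch (q ^ 2) (q ^ 2) k = qpoch q q k * (\<Prod>j<k. 1 + q ^ Suc j)"
proof (induction k)
  case (Suc k)
  have "1 - q ^ 2 * (q ^ 2) ^ k = (1 - q * q ^ k) * (1 + q ^ Suc k)"
    by (simp add: algebra_simps power2_eq_square power_mult_distrib)
  thus ?case unfolding qpoch_Suc Suc.IH by (simp add: mult_ac)
qed simp

text \<open>The right-hand side has no zero denominator at roots of unity of odd order, although the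
  individual factors of the left-hand side vanish there.\<close>

lemma central_ratio:
  fixes q :: "'a::field"
  assumes "qpoch (q ^ 2) (q ^ 2) k \<noteq> 0"
  shows "qpoch q (q ^ 2) k / qpoch (q ^ 2) (q ^ 2) k = qbinom q (2 * k) k / (\<Prod>j<k. 1 + q ^ Suc j) ^ 2"
proof -
  have "qbinom q (2 * k) k * qpoch q q k * qpoch q q k = qpoch q (q ^ 2) k * (qpoch q q k * (\<Prod>j<k. 1 + q ^ Suc j))"
    using qbinom_qpoch[of k "2 * k" q] unfolding qpoch_double qpoch_square by simp
  moreover have "qpoch q q k \<noteq> 0" "(\<Prod>j<k. 1 + q ^ Suc j) \<noteq> 0" using assms unfolding qpoch_square by auto
  ultimately show ?thesis unfolding qpoch_square by (simp add: field_simps power2_eq_square)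
qed

lemma spec_qbinom: "is_hom \<phi> \<Longrightarrow> spec \<phi> q r \<Longrightarrow> spec \<phi> (qbinom q m k) (qbinom r m k)"
  by (induction q m k rule: qbinom.induct) (auto intro!: spec_1 spec_0 spec_add spec_mult spec_power simp del: power_Suc)

text \<open>The part of the summand that involves \<open>a\<close> or \<open>b\<close>. For generic
  values its denominator is nonzero even if \<open>q\<close> is a root of unity, so only the
  remaining quotient needs care.\<close>

definition hrest :: "'a::field \<Rightarrow> 'a \<Rightarrow> 'a \<Rightarrow> nat \<Rightarrow> 'a" where
  "hrest q a p k =
     (qpoch (a * q) (q ^ 2) k * qpoch (q / a) (q ^ 2) k * qpoch (p * q) (q ^ 4) k * qpoch (q / p) (q ^ 4) k) /
     (qpoch (q ^ 4 / a) (q ^ 4) k * qpoch (a * q ^ 4) (q ^ 4) k * qpoch (q ^ 2 / p) (q ^ 2) k * qpoch (p * q ^ 2) (q ^ 2) k)"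

lemma hterm_hrest: "hterm q a p k = qpoch (q ^ 2) (q ^ 4) k / qpoch (q ^ 4) (q ^ 4) k * hrest q a p k * q ^ (2 * k)"
  by (simp add: hterm_def hrest_def mult_ac)

definition generic :: "'a::field \<Rightarrow> 'a \<Rightarrow> 'a \<Rightarrow> bool" where
  "generic q a b \<longleftrightarrow> q \<noteq> 0 \<and> q \<noteq> 1 \<and> a \<noteq> 0 \<and> b \<noteq> 0 \<and> a \<noteq> b \<and> a * b \<noteq> 1 \<and>
     (\<forall>j>0. a \<noteq> q ^ (4 * j) \<and> a * q ^ (4 * j) \<noteq> 1 \<and> b ^ 3 \<noteq> q ^ (2 * j) \<and> b ^ 3 * q ^ (2 * j) \<noteq> 1)"

lemma generic_nonzero:
  assumes "generic q a b"
  shows "qpoch (q ^ 4 / a) (q ^ 4) k \<noteq> 0" "qpoch (a * q ^ 4) (q ^ 4) k \<noteq> 0"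
    "qpoch (q ^ 2 / b ^ 3) (q ^ 2) k \<noteq> 0" "qpoch (b ^ 3 * q ^ 2) (q ^ 2) k \<noteq> 0"
    "qpoch (q ^ 2 / b ^ 3) (q ^ 4) k \<noteq> 0" "qpoch (b ^ 3 * q ^ 2) (q ^ 4) k \<noteq> 0"
proof -
  have e4: "q ^ 4 * (q ^ 4) ^ j = q ^ (4 * Suc j)" "q ^ 2 * (q ^ 2) ^ j = q ^ (2 * Suc j)"
    "q ^ 2 * (q ^ 4) ^ j = q ^ (2 * (2 * j + 1))" for j
    by (simp_all only: power_mult [symmetric] power_add [symmetric] mult_Suc_right distrib_left mult.assoc [symmetric] add.commute)
       simp_all
  show "qpoch (q ^ 4 / a) (q ^ 4) k \<noteq> 0"
    using assms by (intro qpoch_nonzero) (auto simp: generic_def e4 simp del: power_Suc mult_Suc_right)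
  show "qpoch (a * q ^ 4) (q ^ 4) k \<noteq> 0"
    using assms by (intro qpoch_nonzero) (auto simp: generic_def e4 mult.assoc simp del: power_Suc mult_Suc_right)
  have b: "q ^ (2 * j) \<noteq> b ^ 3" "b ^ 3 * q ^ (2 * j) \<noteq> 1" if "j > 0" for j
  proof -
    have "b ^ 3 \<noteq> q ^ (2 * j) \<and> b ^ 3 * q ^ (2 * j) \<noteq> 1" using assms that by (simp add: generic_def)
    thus "q ^ (2 * j) \<noteq> b ^ 3" "b ^ 3 * q ^ (2 * j) \<noteq> 1" by metis+
  qed
  have b0: "b ^ 3 \<noteq> 0" using assms by (simp add: generic_def)
  show "qpoch (q ^ 2 / b ^ 3) (q ^ 2) k \<noteq> 0"
    unfolding times_divide_eq_left using b(1)[of "Suc _"] b0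
    by (intro qpoch_nonzero) (auto simp: e4 simp del: power_Suc mult_Suc_right)
  show "qpoch (b ^ 3 * q ^ 2) (q ^ 2) k \<noteq> 0"
    using b(2)[of "Suc _"]
    by (intro qpoch_nonzero) (auto simp: e4 mult.assoc simp del: power_Suc mult_Suc_right)
  show "qpoch (q ^ 2 / b ^ 3) (q ^ 4) k \<noteq> 0"
  proof (rule qpoch_nonzero)
    fix j
    show "q ^ 2 / b ^ 3 * (q ^ 4) ^ j \<noteq> 1"
      unfolding times_divide_eq_left e4 using b(1)[of "2 * j + 1"] b0 by (simp only: divide_eq_1_iff) auto
  qed
  show "qpoch (b ^ 3 * q ^ 2) (q ^ 4) k \<noteq> 0"
  proof (rule qpoch_nonzero)
    fix j
    show "b ^ 3 * q ^ 2 * (q ^ 4) ^ j \<noteq> 1"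
      unfolding mult.assoc e4 using b(2)[of "2 * j + 1"] by simp
  qed
qed

text \<open>The quotients of \<open>q\<close>-shifted factorials free of \<open>a\<close> and \<open>b\<close> are telescoped here, since some of
  their factors vanish at roots of unity.\<close>

definition cong_rhs :: "'a::field \<Rightarrow> 'a \<Rightarrow> 'a \<Rightarrow> nat \<Rightarrow> 'a" where
  "cong_rhs q a b n =
    (1 - a * q ^ n) * (a - q ^ n) * (- 1 - b ^ 2 + b * q ^ n) / ((b - a) * (1 - b * a)) *
      ((1 - q ^ (3 * n)) / (1 - q) *
       (qpoch (a * q ^ 2) (q ^ 4) ((3 * n - 1) div 4) * qpoch (q ^ 2 / a) (q ^ 4) ((3 * n - 1) div 4) /
        (qpoch (q ^ 4 / a) (q ^ 4) ((3 * n - 1) div 4) * qpoch (a * q ^ 4) (q ^ 4) ((3 * n - 1) div 4)))) +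
    (1 - b * q ^ n) * (b - q ^ n) * (- 1 - a ^ 2 + a * q ^ n) / ((a - b) * (1 - a * b)) *
      ((1 - q ^ n) / (1 - 1 / q) *
       (qpoch (b ^ 3) (q ^ 4) ((n + 1) div 4) * qpoch (1 / b ^ 3) (q ^ 4) ((n + 1) div 4) /
        (qpoch (q ^ 2 / b ^ 3) (q ^ 4) ((n + 1) div 4) * qpoch (b ^ 3 * q ^ 2) (q ^ 4) ((n + 1) div 4))))"

context
  fixes \<phi> :: "'r::idom \<Rightarrow> 'f::field" and Q A B :: "'r fract" and q a b :: 'f
  assumes hom: "is_hom \<phi>" and Q: "spec \<phi> Q q" and A: "spec \<phi> A a" and B: "spec \<phi> B b" and gen: "generic q a b"
begin

lemma generic_simps: "q \<noteq> 0" "1 - q \<noteq> 0" "a \<noteq> 0" "b \<noteq> 0" "b ^ 3 \<noteq> 0" "1 - 1 / q \<noteq> 0"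
  "(a - b) * (1 - a * b) \<noteq> 0" "(b - a) * (1 - b * a) \<noteq> 0"
  using gen by (auto simp: generic_def mult.commute)

lemmas spec_intros = spec_add[OF hom] spec_diff[OF hom] spec_mult[OF hom] spec_divide[OF hom] spec_power[OF hom]
  spec_qpoch[OF hom] spec_1[OF hom] spec_minus[OF hom] Q A B

lemma spec_cong_rhs: "spec \<phi> (cong_rhs Q A B n) (cong_rhs q a b n)"
  unfolding cong_rhs_def
  by (intro spec_intros no_zero_divisors generic_nonzero[OF gen] generic_simps)

lemma spec_hrest: "spec \<phi> (hrest Q A (B ^ 3) k) (hrest q a (b ^ 3) k)"
  unfolding hrest_def
  by (intro spec_intros no_zero_divisors generic_nonzero[OF gen] generic_simps)

lemma spec_hsum:
  assumes "\<And>j. j > 0 \<Longrightarrow> q ^ j \<noteq> 1"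
  shows "spec \<phi> (hsum Q A (B ^ 3) n / (1 - Q)) (hsum q a (b ^ 3) n / (1 - q))"
proof -
  have "q ^ 4 * (q ^ 4) ^ j \<noteq> 1" for j using assms[of "4 * Suc j"] by (simp add: power_add power_mult)
  hence "qpoch (q ^ 4) (q ^ 4) k \<noteq> 0" for k by (intro qpoch_nonzero)
  thus ?thesis unfolding hsum_def hterm_hrest
    by (intro spec_intros spec_sum[OF hom] spec_hrest generic_simps)
qed

text \<open>At a root of unity of odd order \<open>d = 2 * m + 1\<close> the sum splits into blocks of length \<open>d\<close>,
  each of them proportional to the first one.\<close>

lemma spec_hsum_root_of_unity:
  assumes Q1: "\<And>j. j > 0 \<Longrightarrow> Q ^ j \<noteq> 1"
    and q: "q ^ (2 * m + 1) = 1" "\<And>j. 0 < j \<Longrightarrow> j < 2 * m + 1 \<Longrightarrow> q ^ j \<noteq> 1"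
    and neg: "(2 :: 'f) \<noteq> 0" and z: "hsum q a (b ^ 3) (Suc m) = 0"
  shows "spec \<phi> (hsum Q A (B ^ 3) (L * (2 * m + 1)) / (1 - Q)) 0"
proof -
  define d where "d = 2 * m + 1"
  have qd: "q ^ i = 1 \<longleftrightarrow> d dvd i" for i
    unfolding d_def by (rule power_eq_1_iff_dvd) (use q in auto)
  have d4: "d dvd x" if "d dvd 4 * x" for x
  proof -
    have "coprime d (2 * 2)" by (simp only: coprime_mult_right_iff) (simp add: d_def)
    thus ?thesis using that by (simp add: coprime_dvd_mult_right_iff)
  qed
  \<comment> \<open>Only the existence of a value \<open>v k\<close> of this quotient matters, since
    it will be multiplied by a vanishing block sum.\<close>
  define w where "w x k = qpoch (x ^ 2) (x ^ 4) k / qpoch (x ^ 4) (x ^ 4) k" for x :: "'r fract" and k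
  have "\<exists>v. spec \<phi> (w Q k) v" for k
  proof -
    have "Q ^ 4 * (Q ^ 4) ^ j \<noteq> 1" for j using Q1[of "4 * Suc j"] by (simp add: power_add power_mult)
    hence "qpoch ((Q ^ 2) ^ 2) ((Q ^ 2) ^ 2) k \<noteq> 0" by (intro qpoch_nonzero) (simp add: power_mult [symmetric])
    hence "w Q k = qbinom (Q ^ 2) (2 * k) k / (\<Prod>j<k. 1 + (Q ^ 2) ^ Suc j) ^ 2"
      using central_ratio[of "Q ^ 2" k] by (simp add: w_def power_mult [symmetric])
    \<comment> \<open>If a power of \<open>q\<close> were \<open>- 1\<close>, raising it to the odd
      exponent \<open>d\<close> would give \<open>1 = - 1\<close>.\<close>
    moreover have "1 + (q ^ 2) ^ Suc j \<noteq> 0" for j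
    proof
      assume "1 + (q ^ 2) ^ Suc j = 0"
      hence "((q ^ 2) ^ Suc j) ^ d = (- 1) ^ d" by (metis add_eq_0_iff)
      moreover have "((q ^ 2) ^ Suc j) ^ d = 1" unfolding power_mult [symmetric] qd by simp
      ultimately show False using neg by (simp add: d_def)
    qed
    hence "(\<Prod>j<k. 1 + (q ^ 2) ^ Suc j) ^ 2 \<noteq> 0" by simp
    hence "spec \<phi> (qbinom (Q ^ 2) (2 * k) k / (\<Prod>j<k. 1 + (Q ^ 2) ^ Suc j) ^ 2)
        (qbinom (q ^ 2) (2 * k) k / (\<Prod>j<k. 1 + (q ^ 2) ^ Suc j) ^ 2)"
      by (intro spec_intros spec_qbinom[OF hom] spec_prod[OF hom])
    ultimately show ?thesis by auto
  qed
  then obtain v where v: "\<And>k. spec \<phi> (w Q k) (v k)" by metis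
  have q4: "(q ^ i) ^ (l * d) = 1" for i l unfolding power_mult [symmetric] qd by simp
  \<comment> \<open>A shift by a multiple of \<open>d\<close> leaves the arguments of the factorials
    unchanged, so they are multiplicative over blocks.\<close>
  have hr: "hrest q a (b ^ 3) (l * d + k) = hrest q a (b ^ 3) (l * d) * hrest q a (b ^ 3) k" for l k
    unfolding hrest_def qpoch_add q4 by (simp add: times_divide_times_eq mult_ac)
  have blk: "spec \<phi> ((1 - Q ^ (6 * (l * d + k) + 1)) * hterm Q A (B ^ 3) (l * d + k))
      (v (l * d) * hrest q a (b ^ 3) (l * d) * ((1 - q ^ (6 * k + 1)) * hterm q a (b ^ 3) k))" if "k < d" for l k
  proof -
    \<comment> \<open>With \<open>w Q (l * d)\<close> split off as a whole, the remaining
      denominator is \<open>(q^4; q^4)_k\<close> with \<open>k < d\<close>, which has no zero factor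
      because \<open>d\<close> is odd.\<close>
    have nz: "qpoch (q ^ 4 * (q ^ 4) ^ (l * d)) (q ^ 4) k \<noteq> 0"
      unfolding q4
    proof (rule qpoch_nonzero)
      fix j assume "j < k"
      have "q ^ (4 * Suc j) \<noteq> 1"
      proof
        assume "q ^ (4 * Suc j) = 1"
        hence "d dvd Suc j" unfolding qd by (rule d4)
        hence "d \<le> Suc j" by (rule dvd_imp_le) simp
        thus False using \<open>j < k\<close> that by simp
      qed
      thus "q ^ 4 * 1 * (q ^ 4) ^ j \<noteq> 1" by (simp add: power_add power_mult)
    qed
    have "w Q (l * d + k) = w Q (l * d) * (qpoch (Q ^ 2 * (Q ^ 4) ^ (l * d)) (Q ^ 4) k / qpoch (Q ^ 4 * (Q ^ 4) ^ (l * d)) (Q ^ 4) k)"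
      unfolding w_def qpoch_add by simp
    hence "hterm Q A (B ^ 3) (l * d + k) = w Q (l * d) *
        (qpoch (Q ^ 2 * (Q ^ 4) ^ (l * d)) (Q ^ 4) k / qpoch (Q ^ 4 * (Q ^ 4) ^ (l * d)) (Q ^ 4) k) *
        hrest Q A (B ^ 3) (l * d + k) * Q ^ (2 * (l * d + k))"
      by (simp add: hterm_hrest w_def)
    moreover have "spec \<phi> ((1 - Q ^ (6 * (l * d + k) + 1)) * (w Q (l * d) *
        (qpoch (Q ^ 2 * (Q ^ 4) ^ (l * d)) (Q ^ 4) k / qpoch (Q ^ 4 * (Q ^ 4) ^ (l * d)) (Q ^ 4) k) *
        hrest Q A (B ^ 3) (l * d + k) * Q ^ (2 * (l * d + k))))
       ((1 - q ^ (6 * (l * d + k) + 1)) * (v (l * d) *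
        (qpoch (q ^ 2 * (q ^ 4) ^ (l * d)) (q ^ 4) k / qpoch (q ^ 4 * (q ^ 4) ^ (l * d)) (q ^ 4) k) *
        hrest q a (b ^ 3) (l * d + k) * q ^ (2 * (l * d + k))))"
      by (intro spec_intros v spec_hrest nz)
    moreover have "q ^ (6 * (l * d + k) + 1) = q ^ (6 * k + 1)" "q ^ (2 * (l * d + k)) = q ^ (2 * k)"
      using q4[of 6 l] q4[of 2 l] by (simp_all add: distrib_left power_add power_mult)
    ultimately show ?thesis unfolding q4 hr hterm_hrest by (simp only: mult_1_left mult_1_right mult_ac)
  qed
  have e: "hsum Q A (B ^ 3) (L * d) / (1 - Q) =
      (\<Sum>l<L. \<Sum>k<d. (1 - Q ^ (6 * (l * d + k) + 1)) * hterm Q A (B ^ 3) (l * d + k)) / (1 - Q)"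
  proof -
    have group: "(\<Sum>l<L. sum f {l * d..<l * d + d}) = sum f {..<L * d}" for f :: "nat \<Rightarrow> 'r fract"
      by (rule sum.nat_group)
    have shift: "sum f {l * d..<l * d + d} = (\<Sum>k<d. f (l * d + k))" for f :: "nat \<Rightarrow> 'r fract" and l
      using sum.shift_bounds_nat_ivl[of f 0 "l * d" d] by (simp add: lessThan_atLeast0 add.commute)
    show ?thesis unfolding hsum_def group [symmetric] shift ..
  qed
  have sp: "spec \<phi> ((\<Sum>l<L. \<Sum>k<d. (1 - Q ^ (6 * (l * d + k) + 1)) * hterm Q A (B ^ 3) (l * d + k)) / (1 - Q))
    ((\<Sum>l<L. \<Sum>k<d. v (l * d) * hrest q a (b ^ 3) (l * d) * ((1 - q ^ (6 * k + 1)) * hterm q a (b ^ 3) k)) / (1 - q))"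
    by (intro spec_intros spec_sum[OF hom] blk generic_simps) simp
  \<comment> \<open>A full block has no nonzero terms beyond \<open>k = m\<close>, where
    \<open>(q^2; q^4)_k\<close> begins to vanish.\<close>
  have z: "(\<Sum>k<d. c * ((1 - q ^ (6 * k + 1)) * hterm q a (b ^ 3) k)) = 0" for c
  proof -
    have "hterm q a (b ^ 3) k = 0" if "Suc m \<le> k" for k
    proof -
      have "q ^ (2 + 4 * m) = 1" unfolding qd using dvd_triv_left[of d 2] by (simp add: d_def algebra_simps)
      hence "q ^ 2 * (q ^ 4) ^ m = 1" by (simp only: power_add power_mult)
      thus ?thesis using qpoch_eq_0[of m k "q ^ 2" "q ^ 4"] that by (simp add: hterm_def)
    qed
    hence "(\<Sum>k<d. (1 - q ^ (6 * k + 1)) * hterm q a (b ^ 3) k) = hsum q a (b ^ 3) (Suc m)"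
      unfolding hsum_def by (intro sum.mono_neutral_right) (auto simp: d_def)
    thus ?thesis using z by (simp only: sum_distrib_left [symmetric]) simp
  qed
  show ?thesis
    unfolding d_def [symmetric] e using sp by (simp only: z sum.neutral_const div_0)
qed

end

section \<open>Both sides of the congruence and their values at powers of \<open>q\<close>\<close>

lemma cong_lhs_eq_hsum:
  fixes q a b :: "'a::field"
  assumes "n > 0"
  shows "(\<Sum>k=0..n - 1. qint q (6 * k + 1) *
        ((qpochs [a * q, q / a] (q ^ 2) k * qpochs [q ^ 2, b ^ 3 * q, q / b ^ 3] (q ^ 4) k) /
         (qpochs [q ^ 4, q ^ 4 / a, a * q ^ 4] (q ^ 4) k *
          qpochs [q ^ 2 / b ^ 3, b ^ 3 * q ^ 2] (q ^ 2) k)) * q ^ (2 * k)) = hsum q a (b ^ 3) n / (1 - q)"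
proof -
  have "{0..n - 1} = {..<n}" using assms by auto
  thus ?thesis
    unfolding hsum_def sum_divide_distrib
    by (auto intro!: sum.cong simp: qpochs_def qint_def hterm_def mult_ac)
qed

lemma qpoch_shift_ratio:
  assumes "qpoch x q k \<noteq> 0" "x \<noteq> 1"
  shows "qpoch (x * q) q k / qpoch x q k = (1 - x * q ^ k) / (1 - x)"
  using qpoch_shift[of x q k] assms by (simp add: frac_eq_eq mult_ac)

text \<open>Numerator and denominator differ by one shift: \<open>(q^5; q^4)_N / (q; q^4)_N\<close>
  leaves the exponent \<open>4 * N + 1 = 3 * n\<close>, and
  \<open>(q^3; q^4)_M / (1/q; q^4)_M\<close> leaves \<open>4 * M - 1 = n\<close>.\<close>

lemma cong_rhs_eq:
  fixes q a b :: "'a::field"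
  assumes q: "q \<noteq> 0" "\<And>j. j > 0 \<Longrightarrow> q ^ j \<noteq> 1" and n: "n mod 4 = 3"
  shows "(1 - a * q ^ n) * (a - q ^ n) * (- 1 - b ^ 2 + b * q ^ n) / ((b - a) * (1 - b * a)) *
       (qpochs [q ^ 5, a * q ^ 2, q ^ 2 / a] (q ^ 4) ((3 * n - 1) div 4) /
        qpochs [q, q ^ 4 / a, a * q ^ 4] (q ^ 4) ((3 * n - 1) div 4)) +
     (1 - b * q ^ n) * (b - q ^ n) * (- 1 - a ^ 2 + a * q ^ n) / ((a - b) * (1 - a * b)) *
       (qpochs [q ^ 3, b ^ 3, 1 / b ^ 3] (q ^ 4) ((n + 1) div 4) /
        qpochs [1 / q, q ^ 2 / b ^ 3, b ^ 3 * q ^ 2] (q ^ 4) ((n + 1) div 4)) = cong_rhs q a b n"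
proof -
  define N where "N = (3 * n - 1) div 4"
  define M where "M = (n + 1) div 4"
  have N: "3 * n = 4 * N + 1" and M: "4 * M = n + 1" using n unfolding N_def M_def by presburger+
  have q1: "q \<noteq> 1" using q(2)[of 1] by simp
  have "q * (q ^ 4) ^ j \<noteq> 1" for j using q(2)[of "4 * j + 1"] by (simp add: power_mult)
  hence "qpoch q (q ^ 4) N \<noteq> 0" by (intro qpoch_nonzero)
  moreover have "q * q ^ 4 = q ^ 5" "q * (q ^ 4) ^ N = q ^ (3 * n)"
    by (simp add: eval_nat_numeral, simp add: N power_mult)
  ultimately have 1: "qpoch (q ^ 5) (q ^ 4) N / qpoch q (q ^ 4) N = (1 - q ^ (3 * n)) / (1 - q)"
    using qpoch_shift_ratio[of q "q ^ 4" N] q1 by simp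
  have "1 / q * (q ^ 4) ^ j \<noteq> 1" for j
  proof (cases j)
    case (Suc i)
    have "4 * j = Suc (4 * i + 3)" using Suc by simp
    hence "(q ^ 4) ^ j = q * q ^ (4 * i + 3)" by (simp only: power_mult [symmetric] power_Suc)
    thus ?thesis using q(1) q(2)[of "4 * i + 3"] by simp
  qed (use q1 in auto)
  hence "qpoch (1 / q) (q ^ 4) M \<noteq> 0" by (intro qpoch_nonzero)
  moreover have "1 / q \<noteq> 1" using q1 by auto
  ultimately have "qpoch (1 / q * q ^ 4) (q ^ 4) M / qpoch (1 / q) (q ^ 4) M = (1 - 1 / q * (q ^ 4) ^ M) / (1 - 1 / q)"
    by (rule qpoch_shift_ratio)
  moreover have "1 / q * q ^ 4 = q ^ 3" using q(1) by (simp add: eval_nat_numeral)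
  moreover have "1 / q * (q ^ 4) ^ M = q ^ n" using q(1) by (simp add: power_mult [symmetric] M)
  ultimately have 2: "qpoch (q ^ 3) (q ^ 4) M / qpoch (1 / q) (q ^ 4) M = (1 - q ^ n) / (1 - 1 / q)" by simp
  show ?thesis
    unfolding cong_rhs_def qpochs_def N_def [symmetric] M_def [symmetric] 1 [symmetric] 2 [symmetric]
    by (simp add: mult_ac)
qed

text \<open>The residue of \<open>n\<close> gives \<open>n = 4 * m + 3\<close>, the exponent at
  which the sum was evaluated, and \<open>(n + 1) / 4 = Suc m\<close>, the length of the
  factorials.\<close>

lemma hsum_at_power_a:
  fixes q a b :: "'a::field"
  assumes q: "q \<noteq> 0" "\<And>j. j > 0 \<Longrightarrow> q ^ j \<noteq> 1" and n: "n mod 4 = 3"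
    and b: "b \<noteq> 0" "\<And>j. b ^ 3 \<noteq> q ^ (2 * j)" "\<And>j. b ^ 3 * q ^ (2 * j) \<noteq> 1" "b \<noteq> q ^ n" "b * q ^ n \<noteq> 1"
    and a: "a = q ^ n \<or> a = 1 / q ^ n"
  shows "hsum q a (b ^ 3) n / (1 - q) = cong_rhs q a b n"
proof -
  define m where "m = n div 4"
  have nm: "n = 4 * m + 3" using n unfolding m_def by presburger
  have q1: "1 - q \<noteq> 0" using q(2)[of 1] by simp
  have "b ^ 3 \<noteq> 0" using b(1) by simp
  hence s: "hsum q (1 / q ^ (4 * m + 3)) (b ^ 3) (Suc (n - 1)) =
    (1 - q) * (qpoch (q ^ 3) (q ^ 4) (Suc m) * qpoch (b ^ 3) (q ^ 4) (Suc m) * qpoch (1 / b ^ 3) (q ^ 4) (Suc m)) /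
      (qpoch (1 / q) (q ^ 4) (Suc m) * qpoch (q ^ 2 / b ^ 3) (q ^ 4) (Suc m) * qpoch (b ^ 3 * q ^ 2) (q ^ 4) (Suc m))"
    by (intro hsum_at_negative_power_a q b) (use nm in auto)
  have "Suc (n - 1) = n" using nm by simp
  note s = s[unfolded this nm [symmetric]]
  have "hsum q a (b ^ 3) n = hsum q (1 / q ^ n) (b ^ 3) n"
    using a hterm_inverse_a[of q "q ^ n"] by (auto simp: hsum_def)
  hence s': "hsum q a (b ^ 3) n / (1 - q) = qpoch (q ^ 3) (q ^ 4) (Suc m) * qpoch (b ^ 3) (q ^ 4) (Suc m) * qpoch (1 / b ^ 3) (q ^ 4) (Suc m) /
      (qpoch (1 / q) (q ^ 4) (Suc m) * qpoch (q ^ 2 / b ^ 3) (q ^ 4) (Suc m) * qpoch (b ^ 3 * q ^ 2) (q ^ 4) (Suc m))"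
    using s q1 by simp
  have "q ^ n \<noteq> 0" using q(1) by simp
  \<comment> \<open>The weight of the second summand: \<open>- 1 - a ^ 2 + a * q ^ n\<close> is
    \<open>- 1\<close> at \<open>a = q ^ n\<close> and \<open>- a ^ 2\<close> at
    \<open>a = 1 / q ^ n\<close>, and in both cases the rest makes the quotient 1.\<close>
  have c: "(1 - b * q ^ n) * (b - q ^ n) * (- 1 - a ^ 2 + a * q ^ n) / ((a - b) * (1 - a * b)) = 1"
    using a
  proof
    assume a: "a = q ^ n"
    have "(a - b) * (1 - a * b) \<noteq> 0" using b(4,5) a by (auto simp: mult.commute)
    thus ?thesis unfolding a by (simp add: divide_eq_eq) (simp add: algebra_simps power2_eq_square)
  next
    assume a: "a = 1 / q ^ n"
    hence aq: "a * q ^ n = 1" using q(1) by simp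
    have "a - b \<noteq> 0" using aq b(5) by auto
    moreover have "1 - a * b \<noteq> 0"
    proof
      assume "1 - a * b = 0"
      hence "a * b = a * q ^ n" using aq by simp
      moreover have "a \<noteq> 0" using aq by auto
      ultimately show False using b(4) by simp
    qed
    moreover have "(1 - b * z) * (b - z) * (- 1 - a ^ 2 + a * z) = (a - b) * (1 - a * b)" if "a * z = 1" for z
      using that by algebra
    ultimately show ?thesis using aq by simp
  qed
  have z: "(1 - a * q ^ n) * (a - q ^ n) = 0" using a q(1) by auto
  have M: "(n + 1) div 4 = Suc m" using nm by simp
  have "qpochs [q ^ 3, b ^ 3, 1 / b ^ 3] (q ^ 4) ((n + 1) div 4) /
        qpochs [1 / q, q ^ 2 / b ^ 3, b ^ 3 * q ^ 2] (q ^ 4) ((n + 1) div 4) = cong_rhs q a b n"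
    using cong_rhs_eq[OF q n, of a b] unfolding z c by simp
  thus ?thesis unfolding s' M by (simp add: qpochs_def mult_ac)
qed

text \<open>Here \<open>b ^ 3\<close> has exponent \<open>3 * n\<close> or its negative, and
  \<open>3 * n = 4 * N + 1\<close> with \<open>N < n\<close> because \<open>n\<close> is 3 modulo
  4.\<close>

lemma hsum_at_power_b:
  fixes q a b :: "'a::field"
  assumes q: "q \<noteq> 0" "\<And>j. j > 0 \<Longrightarrow> q ^ j \<noteq> 1" and n: "n mod 4 = 3"
    and a: "a \<noteq> 0" "\<And>j. a \<noteq> q ^ (2 * j)" "\<And>j. a * q ^ (2 * j) \<noteq> 1" "a \<noteq> q ^ n" "a * q ^ n \<noteq> 1"
    and b: "b = q ^ n \<or> b = 1 / q ^ n"
  shows "hsum q a (b ^ 3) n / (1 - q) = cong_rhs q a b n"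
proof -
  define N where "N = (3 * n - 1) div 4"
  have N: "3 * n = 4 * N + 1" using n unfolding N_def by presburger
  have q1: "1 - q \<noteq> 0" using q(2)[of 1] by simp
  have s: "hsum q a (1 / q ^ (4 * N + 1)) n =
    (1 - q) * (qpoch (q ^ 5) (q ^ 4) N * qpoch (a * q ^ 2) (q ^ 4) N * qpoch (q ^ 2 / a) (q ^ 4) N) /
      (qpoch q (q ^ 4) N * qpoch (q ^ 4 / a) (q ^ 4) N * qpoch (a * q ^ 4) (q ^ 4) N)"
    by (intro hsum_at_negative_power_p q a) (use N in auto)
  have "b ^ 3 = q ^ (3 * n) \<or> b ^ 3 = 1 / q ^ (3 * n)"
    using b by (auto simp: power_divide power_mult [symmetric] mult.commute)
  hence "hsum q a (b ^ 3) n = hsum q a (1 / q ^ (4 * N + 1)) n"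
    using hterm_inverse_p[of q a "q ^ (3 * n)"] unfolding N by (auto simp: hsum_def)
  hence s': "hsum q a (b ^ 3) n / (1 - q) = qpoch (q ^ 5) (q ^ 4) N * qpoch (a * q ^ 2) (q ^ 4) N * qpoch (q ^ 2 / a) (q ^ 4) N /
      (qpoch q (q ^ 4) N * qpoch (q ^ 4 / a) (q ^ 4) N * qpoch (a * q ^ 4) (q ^ 4) N)"
    using s q1 by simp
  have c: "(1 - a * q ^ n) * (a - q ^ n) * (- 1 - b ^ 2 + b * q ^ n) / ((b - a) * (1 - b * a)) = 1"
    using b
  proof
    assume b: "b = q ^ n"
    have "(b - a) * (1 - b * a) \<noteq> 0" using a(4,5) b by (auto simp: mult.commute)
    thus ?thesis unfolding b by (simp add: divide_eq_eq) (simp add: algebra_simps power2_eq_square)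
  next
    assume b: "b = 1 / q ^ n"
    hence bq: "b * q ^ n = 1" using q(1) by simp
    have "b - a \<noteq> 0" using bq a(5) by auto
    moreover have "1 - b * a \<noteq> 0"
    proof
      assume "1 - b * a = 0"
      hence "b * a = b * q ^ n" using bq by simp
      moreover have "b \<noteq> 0" using bq by auto
      ultimately show False using a(4) by simp
    qed
    moreover have "(1 - a * z) * (a - z) * (- 1 - b ^ 2 + b * z) = (b - a) * (1 - b * a)" if "b * z = 1" for z
      using that by algebra
    ultimately show ?thesis using bq by simp
  qed
  have z: "(1 - b * q ^ n) * (b - q ^ n) = 0" using b q(1) by auto
  have "qpochs [q ^ 5, a * q ^ 2, q ^ 2 / a] (q ^ 4) N /
        qpochs [q, q ^ 4 / a, a * q ^ 4] (q ^ 4) N = cong_rhs q a b n"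
    using cong_rhs_eq[OF q n, of a b] unfolding z c N_def by simp
  thus ?thesis unfolding s' by (simp add: qpochs_def mult_ac)
qed

section \<open>Inequations between monomials in the target field\<close>

lemma fC_1 [simp]: "fC 1 = 1"
  by (simp only: fC_def one_pCons [symmetric] One_fract_def [symmetric])

lemma fX_fY_eq_iff: "fX ^ i * fY ^ j = fX ^ k * fY ^ l \<longleftrightarrow> i = k \<and> j = l"
  using fX_fY_independent[of 1 i j 1 k l] by auto

lemma fX_fY_simps [simp]:
  "fX \<noteq> 0" "fY \<noteq> 0" "fX ^ i = 1 \<longleftrightarrow> i = 0" "fX ^ i = fX ^ k \<longleftrightarrow> i = k"
  "fY ^ j = fX ^ k \<longleftrightarrow> j = 0 \<and> k = 0" "fY ^ j * fX ^ k = 1 \<longleftrightarrow> j = 0 \<and> k = 0"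
proof -
  show "fX \<noteq> 0" "fY \<noteq> 0" by (simp_all add: fX_def fY_def fx_def Fract_1_eq_0_iff)
  show "fX ^ i = 1 \<longleftrightarrow> i = 0" using fX_fY_eq_iff[of i 0 0 0] by simp
  show "fX ^ i = fX ^ k \<longleftrightarrow> i = k" using fX_fY_eq_iff[of i 0 k 0] by simp
  show "fY ^ j = fX ^ k \<longleftrightarrow> j = 0 \<and> k = 0" using fX_fY_eq_iff[of 0 j k 0] by auto
  show "fY ^ j * fX ^ k = 1 \<longleftrightarrow> j = 0 \<and> k = 0" using fX_fY_eq_iff[of k j 0 0] by (auto simp: mult.commute)
qed

lemma fC_power: "fC z ^ j = fC (z ^ j)"
proof (induction j)
  case (Suc j)
  have "fC z * fC (z ^ j) = fC (z * z ^ j)" by (simp add: fC_def)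
  thus ?case using Suc by simp
qed simp

lemma monomial_neq_fC:
  assumes "z \<noteq> 0" "i > 0 \<or> j > 0"
  shows "fX ^ i * fY ^ j \<noteq> fC z"
  using fX_fY_independent[of z 0 0 1 i j] assms by auto

lemma infinite_funfield: "infinite (UNIV :: funfield set)"
proof -
  have "inj (\<lambda>i. fX ^ i)" by (simp add: inj_def)
  hence "infinite (range (\<lambda>i. fX ^ i))" by (rule range_inj_infinite)
  thus ?thesis by (rule infinite_super[OF subset_UNIV])
qed

lemma hom_a_power_values:
  "hom_a (fx ^ n) var_a = fX ^ n" "hom_a (1 / fx ^ n) var_a = 1 / fX ^ n"
proof -
  have h: "is_hom (\<lambda>c. Fract [:c :: complex poly fract:] 1)"
    using is_hom_const_Fract[of "\<lambda>c. c :: complex poly fract"] by (simp add: is_hom_def)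
  have p: "Fract [:fx ^ n:] 1 = fX ^ n" unfolding fX_def using hom_power[OF h, of fx n] by simp
  thus "hom_a (fx ^ n) var_a = fX ^ n" unfolding hom_a(3) .
  have "fx \<noteq> 0" by (simp add: fx_def Fract_1_eq_0_iff)
  hence "Fract [:1 / fx ^ n:] 1 * Fract [:fx ^ n:] 1 = 1"
    unfolding is_homD(3)[OF h, symmetric] by (simp add: is_homD[OF h])
  hence "Fract [:1 / fx ^ n:] 1 = 1 / fX ^ n" unfolding p by (simp add: eq_divide_eq)
  thus "hom_a (1 / fx ^ n) var_a = 1 / fX ^ n" unfolding hom_a(3) .
qed

section \<open>The modulus and the comparison at each specialisation\<close>

lemma indet_eq: "indet_q = Fract var_q 1" "indet_a = Fract var_a 1" "indet_b = Fract var_b 1"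
  by (simp_all add: indet_q_def indet_a_def indet_b_def)

lemma indet_q_power_neq_1: "j > 0 \<Longrightarrow> indet_q ^ j \<noteq> 1"
proof
  assume j: "j > 0" "indet_q ^ j = 1"
  have h: "is_hom (\<lambda>p :: pol_qab. Fract p 1)" by (simp add: is_hom_def One_fract_def)
  have "Fract (var_q ^ j) 1 = indet_q ^ j" unfolding indet_eq by (rule hom_power[OF h])
  hence "Fract (var_q ^ j) 1 = 1" using j by simp
  hence "var_q ^ j = 1" by (simp add: One_fract_def eq_fract)
  hence "hom_b 0 (var_q ^ j) = hom_b 0 1" by simp
  thus False using j(1) unfolding hom_power[OF hom_b(1)] hom_b(2) is_homD(1)[OF hom_b(1)] by simp
qed

text \<open>The families follow the order of the factors of \<open>modulus\<close>, so that
  \<open>cuts_out_mult\<close> can run through the product; inverse powers belong to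
  \<open>1 - a * q ^ n\<close> and \<open>1 - b * q ^ n\<close>.\<close>

definition spec_homs :: "nat \<Rightarrow> (pol_qab \<Rightarrow> funfield) set" where
  "spec_homs n = hom_q ` {z. z ^ n = 1 \<and> z \<noteq> 1} \<union>
    {hom_a (1 / fx ^ n)} \<union> {hom_a (fx ^ n)} \<union> {hom_b (1 / fX ^ n)} \<union> {hom_b (fX ^ n)}"

definition modulus :: "nat \<Rightarrow> pol_qab" where
  "modulus n = [:[:qbracket n:]:] * (1 - var_a * var_q ^ n) * (var_a - var_q ^ n) *
     (1 - var_b * var_q ^ n) * (var_b - var_q ^ n)"

lemma qbracket_var_q: "[:[:qbracket n:]:] = (\<Sum>i<n. var_q ^ i)"
proof -
  have h: "is_hom (\<lambda>c :: rat poly. [:[:c:]:])" by (simp add: is_hom_def one_pCons)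
  show ?thesis unfolding qbracket_def hom_sum[OF h] hom_power[OF h] ..
qed

context
  fixes n :: nat
  assumes n: "n mod 4 = 3"
begin

lemma n_pos: "n > 0"
  using n by presburger

lemma sum_powers_nonzero: "(\<Sum>i<n. fX ^ i) \<noteq> 0"
proof
  assume "(\<Sum>i<n. fX ^ i) = 0"
  hence "1 - fX ^ n = 0" by (simp add: one_diff_power_eq)
  thus False using n_pos by simp
qed

text \<open>What \<open>cuts_out_mult\<close> leaves to check is that no homomorphism kills a factor
  of an earlier family. For \<open>[n]\<close> this is \<open>fX ^ n \<noteq> 1\<close>; the other
  factors reduce to \<open>fX ^ n * fX ^ n \<noteq> 1\<close> or to the independence of
  \<open>fX\<close> and \<open>fY\<close>.\<close>

lemma cuts_out_modulus: "cuts_out (spec_homs n) (modulus n)"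
proof -
  have br: "h [:[:qbracket n:]:] \<noteq> 0" if "is_hom h" "h var_q = fX" for h
    unfolding qbracket_var_q hom_sum[OF that(1)] hom_power[OF that(1)] that(2) by (rule sum_powers_nonzero)
  have one: "h (1 - x * var_q ^ n) = 1 - h x * fX ^ n" "h (x - var_q ^ n) = h x - fX ^ n"
    if "is_hom h" "h var_q = fX" for h x
    by (simp_all only: is_homD[OF that(1)] hom_power[OF that(1)] that(2))
  have XX: "1 - fX ^ n * fX ^ n \<noteq> 0" using n_pos by (simp add: power_add [symmetric])
  have XX': "1 / fX ^ n - fX ^ n \<noteq> 0" using XX by (simp add: field_simps)
  have YX: "1 - fY * fX ^ n \<noteq> 0" "fY - fX ^ n \<noteq> 0" using fX_fY_simps(5)[of 1 n] fX_fY_simps(6)[of 1 n] by auto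
  show ?thesis
    unfolding spec_homs_def modulus_def
  proof (intro cuts_out_mult cuts_out_hom_q cuts_out_hom_a cuts_out_hom_b n_pos)
    fix \<psi> assume "\<psi> \<in> {hom_a (1 / fx ^ n)}"
    thus "\<psi> [:[:qbracket n:]:] \<noteq> 0" using br hom_a by blast
  next
    fix \<psi> assume "\<psi> \<in> {hom_a (fx ^ n)}"
    hence \<psi>: "\<psi> = hom_a (fx ^ n)" by simp
    show "\<psi> ([:[:qbracket n:]:] * (1 - var_a * var_q ^ n)) \<noteq> 0"
      unfolding \<psi> is_homD(3)[OF hom_a(1)] one[OF hom_a(1,2)] hom_a_power_values
      using br[OF hom_a(1,2)] XX by (intro no_zero_divisors)
  next
    fix \<psi> assume "\<psi> \<in> {hom_b (1 / fX ^ n)}"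
    hence \<psi>: "\<psi> = hom_b (1 / fX ^ n)" by simp
    show "\<psi> ([:[:qbracket n:]:] * (1 - var_a * var_q ^ n) * (var_a - var_q ^ n)) \<noteq> 0"
      unfolding \<psi> is_homD(3)[OF hom_b(1)] one[OF hom_b(1,2)] hom_b(3)
      using br[OF hom_b(1,2)] YX by (intro no_zero_divisors)
  next
    fix \<psi> assume "\<psi> \<in> {hom_b (fX ^ n)}"
    hence \<psi>: "\<psi> = hom_b (fX ^ n)" by simp
    show "\<psi> ([:[:qbracket n:]:] * (1 - var_a * var_q ^ n) * (var_a - var_q ^ n) * (1 - var_b * var_q ^ n)) \<noteq> 0"
      unfolding \<psi> is_homD(3)[OF hom_b(1)] one[OF hom_b(1,2)] hom_b(3,4)
      using br[OF hom_b(1,2)] YX XX by (intro no_zero_divisors)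
  qed
qed

lemma modulus_nonzero: "modulus n \<noteq> 0"
proof
  assume "modulus n = 0"
  moreover have h: "is_hom (hom_b 0)" "hom_b 0 var_q = fX" by (rule hom_b)+
  \<comment> \<open>Setting \<open>b = 0\<close> turns the last two factors into \<open>1\<close>
    and \<open>- fX ^ n\<close>.\<close>
  have "hom_b 0 (modulus n) = (\<Sum>i<n. fX ^ i) * (1 - fY * fX ^ n) * (fY - fX ^ n) * (1 - 0 * fX ^ n) * (0 - fX ^ n)"
    unfolding modulus_def qbracket_var_q
    by (simp only: is_homD[OF h(1)] hom_power[OF h(1)] hom_sum[OF h(1)] hom_b)
  moreover have "1 - fY * fX ^ n \<noteq> 0" "fY - fX ^ n \<noteq> 0" using fX_fY_simps(5)[of 1 n] fX_fY_simps(6)[of 1 n] by auto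
  ultimately show False using sum_powers_nonzero is_homD(4)[OF h(1)] by simp
qed

lemma Fract_modulus:
  "qint indet_q n * (1 - indet_a * indet_q ^ n) * (indet_a - indet_q ^ n) * (1 - indet_b * indet_q ^ n) *
     (indet_b - indet_q ^ n) = Fract (modulus n) 1"
proof -
  have h: "is_hom (\<lambda>p :: pol_qab. Fract p 1)" by (simp add: is_hom_def One_fract_def)
  have "1 - indet_q \<noteq> 0" using indet_q_power_neq_1[of 1] by simp
  hence "qint indet_q n = (\<Sum>i<n. indet_q ^ i)"
    unfolding qint_def one_diff_power_eq by simp
  thus ?thesis
    unfolding modulus_def qbracket_var_q is_homD[OF h] hom_sum[OF h] hom_power[OF h] indet_eq by simp
qed

text \<open>The residue of \<open>n\<close> keeps the denominators nonzero: \<open>n\<close> is not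
  divisible by 4, which is needed for \<open>a\<close>, and \<open>3 * n\<close> is odd, which is
  needed for \<open>b ^ 3\<close>.\<close>

lemma generic_cases:
  assumes "(a = fX ^ n \<or> a = 1 / fX ^ n) \<and> b = fY \<or> a = fY \<and> (b = fX ^ n \<or> b = 1 / fX ^ n)"
  shows "generic fX a b"
proof -
  have par: "n \<noteq> 4 * j" "n + 4 * j \<noteq> 0" "3 * n \<noteq> 2 * j" "2 * j \<noteq> 3 * n" "3 * n + 2 * j \<noteq> 0" for j using n by presburger+
  have ps: "fX ^ i * fX ^ k = fX ^ (i + k)" "(fX ^ n) ^ 3 = fX ^ (3 * n)" for i k
    by (simp_all add: power_add power_mult [symmetric] mult.commute)
  have Y1: "fY = fX ^ k \<longleftrightarrow> False" "fY * fX ^ k = 1 \<longleftrightarrow> False" "fX ^ k = fY \<longleftrightarrow> False" "fX ^ k * fY = 1 \<longleftrightarrow> False" for k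
    using fX_fY_simps(5)[of 1 k] fX_fY_simps(6)[of 1 k] by (auto simp: mult.commute)
  have "fX \<noteq> 1" using fX_fY_simps(3)[of 1] by simp
  hence "generic fX (fX ^ n) fY" "generic fX (1 / fX ^ n) fY" "generic fX fY (fX ^ n)" "generic fX fY (1 / fX ^ n)"
    using n_pos unfolding generic_def
    by (auto simp: ps Y1 par power_divide divide_eq_eq eq_divide_eq add.commute)
  thus ?thesis using assms by blast
qed

lemma spec_cases:
  assumes "\<phi> \<in> spec_homs n"
  shows "\<exists>v. spec \<phi> (hsum indet_q indet_a (indet_b ^ 3) n / (1 - indet_q)) v \<and>
     spec \<phi> (cong_rhs indet_q indet_a indet_b n) v"
proof -
  have X1: "fX ^ j \<noteq> 1" if "j > 0" for j using that by simp
  have X0: "fX \<noteq> 0" by simp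
  have Yn: "fY \<noteq> fX ^ j" "fY * fX ^ j \<noteq> 1" "fY ^ 3 \<noteq> fX ^ j" "fY ^ 3 * fX ^ j \<noteq> 1" for j
    using fX_fY_simps(5)[of 1 j] fX_fY_simps(6)[of 1 j] by auto
  have main: "spec \<phi> (hsum indet_q indet_a (indet_b ^ 3) n / (1 - indet_q)) (cong_rhs fX a b n) \<and>
      spec \<phi> (cong_rhs indet_q indet_a indet_b n) (cong_rhs fX a b n)"
    if h: "is_hom \<phi>" "\<phi> var_q = fX" "\<phi> var_a = a" "\<phi> var_b = b"
      and ab: "(a = fX ^ n \<or> a = 1 / fX ^ n) \<and> b = fY \<or> a = fY \<and> (b = fX ^ n \<or> b = 1 / fX ^ n)" for a b
  proof -
    have sp: "spec \<phi> indet_q fX" "spec \<phi> indet_a a" "spec \<phi> indet_b b"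
      unfolding indet_eq h(2-4) [symmetric] by (rule spec_Fract[OF h(1)])+
    have gen: "generic fX a b" using ab by (rule generic_cases)
    have "hsum fX a (b ^ 3) n / (1 - fX) = cong_rhs fX a b n"
      using ab
    proof
      assume *: "(a = fX ^ n \<or> a = 1 / fX ^ n) \<and> b = fY"
      have b: "b = fY" using * by simp
      show ?thesis unfolding b
        by (rule hsum_at_power_a[OF X0 X1 n]) (use * Yn in auto)
    next
      assume *: "a = fY \<and> (b = fX ^ n \<or> b = 1 / fX ^ n)"
      have a: "a = fY" using * by simp
      show ?thesis unfolding a
        by (rule hsum_at_power_b[OF X0 X1 n]) (use * Yn in auto)
    qed
    thus ?thesis using spec_hsum[OF h(1) sp gen X1, of n] spec_cong_rhs[OF h(1) sp gen, of n] by simp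
  qed
  consider z where "z ^ n = 1" "z \<noteq> 1" "\<phi> = hom_q z"
    | "\<phi> = hom_a (fx ^ n)" | "\<phi> = hom_a (1 / fx ^ n)" | "\<phi> = hom_b (fX ^ n)" | "\<phi> = hom_b (1 / fX ^ n)"
    using assms unfolding spec_homs_def by blast
  thus ?thesis
  proof cases
    case 2
    show ?thesis unfolding 2 using main[unfolded 2, OF hom_a(1,2) hom_a_power_values(1) hom_a(4)] by blast
  next
    case 3
    show ?thesis unfolding 3 using main[unfolded 3, OF hom_a(1,2) hom_a_power_values(2) hom_a(4)] by blast
  next
    case 4
    show ?thesis unfolding 4 using main[unfolded 4, OF hom_b] by blast
  next
    case 5
    show ?thesis unfolding 5 using main[unfolded 5, OF hom_b] by blast
  next
    case 1
    \<comment> \<open>The order of \<open>z\<close> divides \<open>n\<close> and may be smaller; it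
      is odd because \<open>n\<close> is, and greater than 1 because \<open>z\<close> is not
      1.\<close>
    define d where "d = (LEAST d. d > 0 \<and> z ^ d = 1)"
    have "n > 0 \<and> z ^ n = 1" using n_pos 1 by simp
    hence d: "d > 0 \<and> z ^ d = 1" unfolding d_def by (rule LeastI)
    have d_min: "z ^ j \<noteq> 1" if "0 < j" "j < d" for j
      using not_less_Least[of j "\<lambda>d. d > 0 \<and> z ^ d = 1"] that unfolding d_def by blast
    have zd: "z ^ i = 1 \<longleftrightarrow> d dvd i" for i
      by (rule power_eq_1_iff_dvd) (use d d_min in auto)
    have "d dvd n" using 1 zd by simp
    then obtain L where L: "n = L * d" by (metis dvd_def mult.commute)
    have "odd d" using n unfolding L by (metis L dvd_mult even_even_mod_4_iff odd_numeral n)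
    moreover have "d \<noteq> 1" using d 1 by auto
    ultimately obtain m where m: "d = 2 * m + 1" "m > 0" by (metis oddE add_0 mult_0_right neq0_conv)
    have z0: "z \<noteq> 0" using 1 n_pos by (auto simp: power_0_left)
    define q where "q = fC z"
    have qj: "q ^ j = 1 \<longleftrightarrow> z ^ j = 1" for j
    proof
      assume "q ^ j = 1"
      hence "fC (z ^ j) * fX ^ 0 * fY ^ 0 = fC 1 * fX ^ 0 * fY ^ 0" by (simp add: q_def fC_power)
      thus "z ^ j = 1" using fX_fY_independent[of "z ^ j" 0 0 1 0 0] z0 by simp
    qed (simp add: q_def fC_power)
    have mono: "fX ^ i * fY ^ k \<noteq> q ^ j" if "i > 0 \<or> k > 0" for i j k
      unfolding q_def fC_power using that z0 by (intro monomial_neq_fC) auto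
    have inv: "x * q ^ j \<noteq> 1" if "\<And>j. x \<noteq> q ^ j" for x j
    proof
      assume "x * q ^ j = 1"
      moreover have "q ^ j * q ^ (2 * m * j) = 1"
        unfolding power_add [symmetric] qj zd using dvd_triv_left[of d j] by (simp add: m algebra_simps)
      moreover have "x * (q ^ j * q ^ (2 * m * j)) = (x * q ^ j) * q ^ (2 * m * j)" by (simp only: mult.assoc)
      ultimately have "x = q ^ (2 * m * j)" by simp
      with that show False by blast
    qed
    have a: "fX \<noteq> q ^ j" and b: "fY ^ 3 \<noteq> q ^ j" for j
      using mono[of 1 0 j] mono[of 0 3 j] by simp_all
    have ab: "fX \<noteq> fY" "fX * fY \<noteq> 1"
      using fX_fY_simps(5)[of 1 1] fX_fY_simps(6)[of 1 1] by (auto simp: mult.commute)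
    have q0: "q \<noteq> 0" and q1: "q \<noteq> 1" using d qj[of d] qj[of 1] 1 by (auto simp: power_0_left)
    have gen: "generic q fX fY"
      unfolding generic_def using q0 q1 ab a b inv[OF a] inv[OF b] by simp
    have qd: "q ^ (2 * m + 1) = 1" using d unfolding qj m(1) by blast
    have q_min: "q ^ j \<noteq> 1" if "0 < j" "j < 2 * m + 1" for j using d_min[of j] that by (simp add: qj m(1))
    have S: "hsum q fX (fY ^ 3) (Suc m) = 0"
      by (rule hsum_root_of_unity[OF infinite_funfield qd q_min m(2) _ a _ b]) simp_all
    have sp: "spec \<phi> indet_q q" "spec \<phi> indet_a fX" "spec \<phi> indet_b fY"
      unfolding indet_eq 1 q_def hom_q(2-4) [of z, symmetric] by (rule spec_Fract[OF hom_q(1)])+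
    have h: "is_hom \<phi>" unfolding 1 by (rule hom_q)
    have "(2 :: funfield) \<noteq> 0"
    proof
      assume two: "(2 :: funfield) = 0"
      have "fC 2 = fC 1 + fC 1" unfolding fC_def by simp
      also have "\<dots> = 0" using two by simp
      finally show False by (simp add: fC_def Fract_1_eq_0_iff)
    qed
    from spec_hsum_root_of_unity[OF h sp gen indet_q_power_neq_1 qd q_min this S, of L]
    have "spec \<phi> (hsum indet_q indet_a (indet_b ^ 3) n / (1 - indet_q)) 0"
      unfolding L m(1) by simp
    \<comment> \<open>The right-hand side vanishes as well: its two summands carry the factors
      \<open>1 - q ^ (3 * n)\<close> and \<open>1 - q ^ n\<close>.\<close>
    moreover have "cong_rhs q fX fY n = 0"
    proof -
      have "q ^ n = 1" "q ^ (3 * n) = 1" unfolding qj zd L by simp_all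
      thus ?thesis by (simp add: cong_rhs_def)
    qed
    ultimately show ?thesis using spec_cong_rhs[OF h sp gen, of n] by auto
  qed
qed

end

theorem theorem3p1:
  fixes n :: nat and q a b :: ratfun_qab
  assumes "n > 0" and "n mod 4 = 3"
    and "q = indet_q" and "a = indet_a" and "b = indet_b"
  shows "ratfun_cong
    (\<Sum>k=0..n - 1. qint q (6 * k + 1) *
        ((qpochs [a * q, q / a] (q ^ 2) k * qpochs [q ^ 2, b ^ 3 * q, q / b ^ 3] (q ^ 4) k) /
         (qpochs [q ^ 4, q ^ 4 / a, a * q ^ 4] (q ^ 4) k *
          qpochs [q ^ 2 / b ^ 3, b ^ 3 * q ^ 2] (q ^ 2) k)) * q ^ (2 * k))
    ((1 - a * q ^ n) * (a - q ^ n) * (- 1 - b ^ 2 + b * q ^ n) / ((b - a) * (1 - b * a)) *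
       (qpochs [q ^ 5, a * q ^ 2, q ^ 2 / a] (q ^ 4) ((3 * n - 1) div 4) /
        qpochs [q, q ^ 4 / a, a * q ^ 4] (q ^ 4) ((3 * n - 1) div 4)) +
     (1 - b * q ^ n) * (b - q ^ n) * (- 1 - a ^ 2 + a * q ^ n) / ((a - b) * (1 - a * b)) *
       (qpochs [q ^ 3, b ^ 3, 1 / b ^ 3] (q ^ 4) ((n + 1) div 4) /
        qpochs [1 / q, q ^ 2 / b ^ 3, b ^ 3 * q ^ 2] (q ^ 4) ((n + 1) div 4)))
    (qint q n * (1 - a * q ^ n) * (a - q ^ n) * (1 - b * q ^ n) * (b - q ^ n))"
proof -
  have q0: "indet_q \<noteq> 0" by (simp add: indet_q_def Fract_1_eq_0_iff)
  show ?thesis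
    unfolding assms(3-5) cong_lhs_eq_hsum[OF assms(1)]
    by (subst cong_rhs_eq[OF q0 indet_q_power_neq_1 assms(2)], assumption,
        rule ratfun_cong_by_specialisation[OF cuts_out_modulus[OF assms(2)] modulus_nonzero[OF assms(2)]
          Fract_modulus[OF assms(2)]],
        rule spec_cases[OF assms(2)])
qed

end
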